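(* Let $k$ be an algebraically closed field of characteristic $p\ge0$, $X$ an irreducible smooth proper curve over $k$ of genus $g\ge2$ embedded in its jacobian $J$ using a base point $\infty\in X(k)$. Let $N\ge2$ be an integer, let $\mathsf{D}_N$ be as in the context, and let $r\in\{0,1,\dots,N-\mathsf{D}_N\}$. (a) Suppose $p=0$. Then $(N-r)_*X\not\subseteq W_r^-$. (b) Suppose $p>N$. Then $(\mathsf{D}_N)_*X\not\subseteq W^-_{N-\mathsf{D}_N}$.
   Context: The embedding $X\hookrightarrow J$ sends $\xi$ to the class of $[\xi]-[\infty]$. $\mathsf{D}_N$ is the dimension over $k$ of the space of functions in $k(X)$ regular on $X-\{\infty\}$ with a pole of order at most $N$ at $\infty$; by Riemann-Roch $0\le N-\mathsf{D}_N\le g-1$. For $M\in\mathbb{Z}$, $M_*X$ is the image of $X$ under multiplication by $M$ on $J$. For $r\in\{0,\dots,g-1\}$, $W_r=\{\sum_{i=1}^r\xi_i\mid\xi_i\in X\}\subseteq J$ (so $W_0=\{0\}$), and $W_r^-$ is the image of $W_r$ under multiplication by $-1$. *)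

theory Defs
  imports
    "HOL-Analysis.Abstract_Topology"
    "HOL-Analysis.Function_Topology"
    "HOL-Library.Function_Algebras"
    "HOL-Computational_Algebra.Polynomial"
    "HOL-Algebra.Coset"
    "HOL-Algebra.FiniteProduct"
begin

section \<open>Vector spaces of functions\<close>

abbreviation fun_scale :: "'k::field \<Rightarrow> ('a \<Rightarrow> 'k) \<Rightarrow> 'a \<Rightarrow> 'k" where
  "fun_scale c f \<equiv> (\<lambda>x. c * f x)"

lemma vector_space_fun_scale: "vector_space (fun_scale :: 'k::field \<Rightarrow> ('a \<Rightarrow> 'k) \<Rightarrow> 'a \<Rightarrow> 'k)"
  by unfold_locales (auto simp: algebra_simps fun_eq_iff)

text \<open>As everywhere in the library, the dimension of an infinite-dimensional space is \<open>0\<close>.\<close>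

abbreviation fdim :: "('a \<Rightarrow> 'k::field) set \<Rightarrow> nat" where
  "fdim V \<equiv> vector_space.dim fun_scale V"


section \<open>Spaces with functions and varieties\<close>

text \<open>
  Varieties over an algebraically closed field \<open>k\<close> are taken in the sense of Serre: a topological
  space (whose points are the \<open>k\<close>-points) with a sheaf of \<open>k\<close>-valued functions, locally isomorphic
  to affine algebraic sets, and separated.

  Functions are total in HOL, so \<^term>\<open>regular_on X U\<close> is a set of total functions which is
  required to be insensitive to the values outside \<open>U\<close>. A section over \<open>U\<close> is an element of this
  set up to equality on \<open>U\<close>.
\<close>

record ('a, 'k) fun_space =
  top_of :: "'a topology"
  regular_on :: "'a set \<Rightarrow> ('a \<Rightarrow> 'k) set"

abbreviation points :: "('a, 'k) fun_space \<Rightarrow> 'a set" where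
  "points X \<equiv> topspace (top_of X)"

definition sheaf_of_functions :: "('a, 'k::field) fun_space \<Rightarrow> bool" where
  "sheaf_of_functions X \<longleftrightarrow>
     (\<forall>U f g. openin (top_of X) U \<and> f \<in> regular_on X U \<and> (\<forall>x\<in>U. g x = f x) \<longrightarrow> g \<in> regular_on X U) \<and>
     (\<forall>U V. openin (top_of X) U \<and> openin (top_of X) V \<and> V \<subseteq> U \<longrightarrow> regular_on X U \<subseteq> regular_on X V) \<and>
     (\<forall>\<U> f. (\<forall>U\<in>\<U>. openin (top_of X) U \<and> f \<in> regular_on X U) \<longrightarrow> f \<in> regular_on X (\<Union>\<U>)) \<and>
     (\<forall>U. openin (top_of X) U \<longrightarrow>
        (\<forall>c. (\<lambda>_. c) \<in> regular_on X U) \<and>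
        (\<forall>f\<in>regular_on X U. \<forall>g\<in>regular_on X U.
           (\<lambda>x. f x + g x) \<in> regular_on X U \<and> (\<lambda>x. f x * g x) \<in> regular_on X U))"

definition open_subspace :: "('a, 'k) fun_space \<Rightarrow> 'a set \<Rightarrow> ('a, 'k) fun_space" where
  "open_subspace X U = \<lparr>top_of = subtopology (top_of X) U, regular_on = regular_on X\<rparr>"

definition fun_space_iso ::
  "('a, 'k) fun_space \<Rightarrow> ('b, 'k) fun_space \<Rightarrow> ('a \<Rightarrow> 'b) \<Rightarrow> bool" where
  "fun_space_iso X Y \<phi> \<longleftrightarrow>
     homeomorphic_map (top_of X) (top_of Y) \<phi> \<and>
     (\<forall>W h. openin (top_of Y) W \<longrightarrow>
        (h \<in> regular_on Y W \<longleftrightarrow> h \<circ> \<phi> \<in> regular_on X (points X \<inter> \<phi> -` W)))"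


subsection \<open>Affine algebraic sets\<close>

definition affine_space :: "nat \<Rightarrow> (nat \<Rightarrow> 'k) set" where
  "affine_space n = {..<n} \<rightarrow>\<^sub>E UNIV"

text \<open>Polynomial functions; the ground field being infinite, these are the same as polynomials.\<close>

inductive_set poly_funs :: "nat \<Rightarrow> ((nat \<Rightarrow> 'k::field) \<Rightarrow> 'k) set" for n :: nat where
  const: "(\<lambda>_. c) \<in> poly_funs n"
| coord: "i < n \<Longrightarrow> (\<lambda>a. a i) \<in> poly_funs n"
| add: "F \<in> poly_funs n \<Longrightarrow> G \<in> poly_funs n \<Longrightarrow> (\<lambda>a. F a + G a) \<in> poly_funs n"
| mult: "F \<in> poly_funs n \<Longrightarrow> G \<in> poly_funs n \<Longrightarrow> (\<lambda>a. F a * G a) \<in> poly_funs n"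

definition zariski :: "nat \<Rightarrow> (nat \<Rightarrow> 'k::field) topology" where
  "zariski n = topology_generated_by {{a \<in> affine_space n. F a \<noteq> 0} | F. F \<in> poly_funs n}"

definition affine_alg_set :: "nat \<Rightarrow> (nat \<Rightarrow> 'k::field) set \<Rightarrow> (nat \<Rightarrow> 'k, 'k) fun_space" where
  "affine_alg_set n Z =
     \<lparr>top_of = subtopology (zariski n) Z,
      regular_on = (\<lambda>W. {h. \<forall>a\<in>W. \<exists>W' F G. openin (subtopology (zariski n) Z) W' \<and> a \<in> W' \<and> W' \<subseteq> W \<and>
         F \<in> poly_funs n \<and> G \<in> poly_funs n \<and> (\<forall>b\<in>W'. G b \<noteq> 0 \<and> h b = F b / G b)})\<rparr>"

definition affine_variety :: "('a, 'k::field) fun_space \<Rightarrow> bool" where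
  "affine_variety X \<longleftrightarrow>
     (\<exists>n Z \<phi>. closedin (zariski n) Z \<and> fun_space_iso X (affine_alg_set n Z) \<phi>)"


subsection \<open>Varieties, completeness\<close>

definition prevariety :: "('a, 'k::field) fun_space \<Rightarrow> bool" where
  "prevariety X \<longleftrightarrow> sheaf_of_functions X \<and>
     (\<exists>\<U>. finite \<U> \<and> \<Union>\<U> = points X \<and>
        (\<forall>U\<in>\<U>. openin (top_of X) U \<and> affine_variety (open_subspace X U)))"

text \<open>
  The Zariski topology of a product of prevarieties. For affine open \<open>U\<close> and \<open>V\<close>, the sums
  \<open>\<Sum>i<m. f i x * g i y\<close> are the elements of the coordinate ring of \<open>U \<times> V\<close>.
\<close>

definition zariski_prod :: "('a, 'k::field) fun_space \<Rightarrow> ('b, 'k) fun_space \<Rightarrow> ('a \<times> 'b) topology" where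
  "zariski_prod X Y = topology_generated_by
     {{(x, y). x \<in> U \<and> y \<in> V \<and> (\<Sum>i<m. f i x * g i y) \<noteq> 0} | U V (m::nat) f g.
        openin (top_of X) U \<and> openin (top_of Y) V \<and>
        (\<forall>i<m. f i \<in> regular_on X U \<and> g i \<in> regular_on Y V)}"

definition variety :: "('a, 'k::field) fun_space \<Rightarrow> bool" where
  "variety X \<longleftrightarrow> prevariety X \<and> closedin (zariski_prod X X) {(x, x) | x. x \<in> points X}"

text \<open>
  Universal closedness. Restricting the test varieties \<open>Y\<close> to point sets in \<^typ>\<open>nat \<Rightarrow> 'k\<close> loses
  nothing: a variety over an infinite field \<open>k\<close> has at most \<open>|k|\<close> points, so it is isomorphic to
  one of these.
\<close>

definition proper_variety :: "('a, 'k::field) fun_space \<Rightarrow> bool" where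
  "proper_variety X \<longleftrightarrow> variety X \<and>
     (\<forall>Y :: (nat \<Rightarrow> 'k, 'k) fun_space. variety Y \<longrightarrow> closed_map (zariski_prod X Y) (top_of Y) snd)"


subsection \<open>Irreducibility and dimension\<close>

definition irreducible_subset :: "'a topology \<Rightarrow> 'a set \<Rightarrow> bool" where
  "irreducible_subset T Z \<longleftrightarrow> Z \<noteq> {} \<and> Z \<subseteq> topspace T \<and>
     (\<forall>A B. closedin T A \<and> closedin T B \<and> Z \<subseteq> A \<union> B \<longrightarrow> Z \<subseteq> A \<or> Z \<subseteq> B)"

definition irreducible_chain :: "'a topology \<Rightarrow> nat \<Rightarrow> (nat \<Rightarrow> 'a set) \<Rightarrow> bool" where
  "irreducible_chain T d Z \<longleftrightarrow>
     (\<forall>i\<le>d. closedin T (Z i) \<and> irreducible_subset T (Z i)) \<and> (\<forall>i<d. Z i \<subset> Z (Suc i))"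

definition has_dimension :: "'a topology \<Rightarrow> nat \<Rightarrow> bool" where
  "has_dimension T d \<longleftrightarrow> (\<exists>Z. irreducible_chain T d Z) \<and> \<not> (\<exists>Z. irreducible_chain T (Suc d) Z)"


subsection \<open>Tangent spaces and smoothness\<close>

definition regular_at :: "('a, 'k) fun_space \<Rightarrow> 'a \<Rightarrow> ('a \<Rightarrow> 'k) set" where
  "regular_at X P = {f. \<exists>U. openin (top_of X) U \<and> P \<in> U \<and> f \<in> regular_on X U}"

text \<open>
  Tangent vectors at \<open>P\<close> are the \<open>k\<close>-derivations of the local ring at \<open>P\<close> into the residue field
  \<open>k\<close>. The product rule forces \<open>v f\<close> to depend only on the germ of \<open>f\<close> at \<open>P\<close>: multiply by the
  indicator function of a neighbourhood, which is idempotent with germ \<open>1\<close>. The first clause only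
  makes the representing HOL function unique.
\<close>

definition tangent_space :: "('a, 'k::field) fun_space \<Rightarrow> 'a \<Rightarrow> (('a \<Rightarrow> 'k) \<Rightarrow> 'k) set" where
  "tangent_space X P = {v.
     (\<forall>f. f \<notin> regular_at X P \<longrightarrow> v f = 0) \<and>
     (\<forall>c. \<forall>f\<in>regular_at X P. v (\<lambda>x. c * f x) = c * v f) \<and>
     (\<forall>f\<in>regular_at X P. \<forall>g\<in>regular_at X P.
        v (\<lambda>x. f x + g x) = v f + v g \<and>
        v (\<lambda>x. f x * g x) = f P * v g + g P * v f)}"

definition smooth_proper_curve :: "('a, 'k::field) fun_space \<Rightarrow> bool" where
  "smooth_proper_curve X \<longleftrightarrow> proper_variety X \<and>
     irreducible_subset (top_of X) (points X) \<and>
     has_dimension (top_of X) 1 \<and>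
     (\<forall>P\<in>points X. fdim (tangent_space X P) = 1)"


section \<open>Genus\<close>

text \<open>
  A regular differential form assigns to each point a cotangent vector, that is a linear form on the
  tangent space, in such a way that it is locally of the form \<open>\<Sum>i. f\<^sub>i dg\<^sub>i\<close> with regular \<open>f\<^sub>i\<close> and
  \<open>g\<^sub>i\<close>, where \<open>dg\<close> at \<open>y\<close> sends a tangent vector \<open>v\<close> to \<open>v g\<close>.
\<close>

definition regular_forms ::
  "('a, 'k::field) fun_space \<Rightarrow> ('a \<times> (('a \<Rightarrow> 'k) \<Rightarrow> 'k) \<Rightarrow> 'k) set" where
  "regular_forms X = {\<omega>.
     (\<forall>x v. \<not> (x \<in> points X \<and> v \<in> tangent_space X x) \<longrightarrow> \<omega> (x, v) = 0) \<and>
     (\<forall>x\<in>points X. \<exists>U (m::nat) f g. openin (top_of X) U \<and> x \<in> U \<and>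
        (\<forall>i<m. f i \<in> regular_on X U \<and> g i \<in> regular_on X U) \<and>
        (\<forall>y\<in>U. \<forall>v\<in>tangent_space X y. \<omega> (y, v) = (\<Sum>i<m. f i y * v (g i))))}"

definition genus :: "('a, 'k::field) fun_space \<Rightarrow> nat" where
  "genus X = fdim (regular_forms X)"


section \<open>Rational functions and their orders\<close>

text \<open>
  An element of \<open>k(X)\<close> is represented by any total function that is regular on some nonempty open
  set; two such functions represent the same element iff they are generically equal.
\<close>

definition rational_funs :: "('a, 'k) fun_space \<Rightarrow> ('a \<Rightarrow> 'k) set" where
  "rational_funs X = {f. \<exists>U. openin (top_of X) U \<and> U \<noteq> {} \<and> f \<in> regular_on X U}"

definition gen_eq :: "('a, 'k) fun_space \<Rightarrow> ('a \<Rightarrow> 'k) \<Rightarrow> ('a \<Rightarrow> 'k) \<Rightarrow> bool" where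
  "gen_eq X f g \<longleftrightarrow> (\<exists>U. openin (top_of X) U \<and> U \<noteq> {} \<and> (\<forall>x\<in>U. f x = g x))"

definition uniformizer :: "('a, 'k::field) fun_space \<Rightarrow> 'a \<Rightarrow> ('a \<Rightarrow> 'k) \<Rightarrow> bool" where
  "uniformizer X P t \<longleftrightarrow> t \<in> regular_at X P \<and> t P = 0 \<and>
     (\<forall>s\<in>regular_at X P. s P = 0 \<longrightarrow>
        (\<exists>h\<in>regular_at X P. \<exists>U. openin (top_of X) U \<and> P \<in> U \<and> (\<forall>x\<in>U. s x = h x * t x)))"

text \<open>The order at \<open>P\<close> of a nonzero rational function; unspecified for the zero function.\<close>

definition ord_at :: "('a, 'k::field) fun_space \<Rightarrow> 'a \<Rightarrow> ('a \<Rightarrow> 'k) \<Rightarrow> int" where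
  "ord_at X P f = (THE n. \<exists>t u. uniformizer X P t \<and> u \<in> regular_at X P \<and> u P \<noteq> 0 \<and>
     gen_eq X f (\<lambda>x. u x * t x powi n))"

text \<open>
  The functions regular on \<open>X - {b}\<close> with a pole of order at most \<open>N\<close> at \<open>b\<close>. They are determined by
  their values on \<open>X - {b}\<close> and normalised to be \<open>0\<close> elsewhere, so that each is counted once.
\<close>

definition pole_space :: "('a, 'k::field) fun_space \<Rightarrow> 'a \<Rightarrow> nat \<Rightarrow> ('a \<Rightarrow> 'k) set" where
  "pole_space X b N = {f \<in> regular_on X (points X - {b}).
     (\<forall>x. x \<notin> points X - {b} \<longrightarrow> f x = 0) \<and>
     (gen_eq X f (\<lambda>_. 0) \<or> ord_at X b f \<ge> - int N)}"

definition pole_dim :: "('a, 'k::field) fun_space \<Rightarrow> 'a \<Rightarrow> nat \<Rightarrow> nat" where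
  "pole_dim X b N = fdim (pole_space X b N)"


section \<open>The jacobian\<close>

definition Div0 :: "('a, 'k) fun_space \<Rightarrow> ('a \<Rightarrow> int) monoid" where
  "Div0 X = \<lparr>carrier = {D. finite {P. D P \<noteq> 0} \<and> {P. D P \<noteq> 0} \<subseteq> points X \<and> (\<Sum>P | D P \<noteq> 0. D P) = 0},
     mult = (+), one = 0\<rparr>"

definition principal_divisors :: "('a, 'k::field) fun_space \<Rightarrow> ('a \<Rightarrow> int) set" where
  "principal_divisors X =
     {(\<lambda>P. if P \<in> points X then ord_at X P f else 0) | f.
        f \<in> rational_funs X \<and> \<not> gen_eq X f (\<lambda>_. 0)}"

text \<open>
  The group \<open>J(k)\<close> of points of the jacobian: divisors of degree \<open>0\<close> up to linear equivalence.
  Intersecting with the divisors of degree \<open>0\<close> changes nothing on a proper curve, but makes it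
  immediate that one divides by a subset of \<^term>\<open>Div0 X\<close>. The group is written multiplicatively.
\<close>

definition Jac :: "('a, 'k::field) fun_space \<Rightarrow> ('a \<Rightarrow> int) set monoid" where
  "Jac X = Div0 X Mod (principal_divisors X \<inter> carrier (Div0 X))"

definition point_divisor :: "'a \<Rightarrow> 'a \<Rightarrow> int" where
  "point_divisor P = (\<lambda>Q. if Q = P then 1 else 0)"

definition jac_emb :: "('a, 'k::field) fun_space \<Rightarrow> 'a \<Rightarrow> 'a \<Rightarrow> ('a \<Rightarrow> int) set" where
  "jac_emb X b \<xi> = (principal_divisors X \<inter> carrier (Div0 X)) #>\<^bsub>Div0 X\<^esub> (point_divisor \<xi> - point_divisor b)"

definition mult_image :: "('a, 'k::field) fun_space \<Rightarrow> 'a \<Rightarrow> int \<Rightarrow> ('a \<Rightarrow> int) set set" where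
  "mult_image X b M = (\<lambda>x. x [^]\<^bsub>Jac X\<^esub> M) ` (jac_emb X b ` points X)"

definition W_locus :: "('a, 'k::field) fun_space \<Rightarrow> 'a \<Rightarrow> nat \<Rightarrow> ('a \<Rightarrow> int) set set" where
  "W_locus X b r = {finprod (Jac X) (\<lambda>i. jac_emb X b (\<xi> i)) {1..r} | \<xi>. \<forall>i\<in>{1..r}. \<xi> i \<in> points X}"

definition W_minus :: "('a, 'k::field) fun_space \<Rightarrow> 'a \<Rightarrow> nat \<Rightarrow> ('a \<Rightarrow> int) set set" where
  "W_minus X b r = m_inv (Jac X) ` W_locus X b r"

end

theory Submission
  imports Defs "HOL-Analysis.Abstract_Limits"
begin

text \<open>
  Suppose that multiplication by \<open>m\<close> sends the curve into \<open>W\<^sub>r\<^sup>-\<close>, where \<open>m + r = N\<close> and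
  \<open>m \<ge> D\<close>, the dimension of the space \<open>V\<close> of functions with at most an \<open>N\<close>-fold pole at \<open>b\<close> and
  no other pole. By the definition of the jacobian, every point \<open>Q\<close> then carries a function with
  divisor \<open>m [Q] + [\<xi>\<^sub>1] + \<dots> + [\<xi>\<^sub>r] - N [b]\<close> (\<open>function_of_inverse_classes\<close>). It is a nonzero
  element of \<open>V\<close> which vanishes at \<open>Q\<close> to order at least \<open>D\<close>. A dimension count alone makes
  elements vanish only to order \<open>D - 1\<close>, and if the characteristic is zero or greater than \<open>N\<close> this
  is all that happens at a general point. Both parts of the theorem follow
  (\<open>mult_image_not_subset\<close>).

  The claim about general points is \<open>generic_osculation\<close>. The space \<open>V\<close> has a basis whose members
  have distinct pole orders at \<open>b\<close>, between \<open>0\<close> and \<open>N\<close>, hence distinct in the ground field. For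
  such a family one divides by one member, which becomes the constant \<open>1\<close>, and differentiates with
  respect to a coordinate \<open>t\<close> at \<open>b\<close>. This gives a family with one member less, again with orders
  at \<open>b\<close> distinct in the ground field, because \<open>t\<^sup>e\<close> has the derivative \<open>e t\<^sup>e\<^sup>-\<^sup>1\<close>. Induction shows
  that no nontrivial combination vanishes at a general point to an order as large as the number of
  members (\<open>generic_vanishing\<close>).

  The argument needs three facts about the curve, which are derived from the definition of a variety
  as a space with functions.

  \<^item> Orders exist, that is, the local rings are discrete valuation rings. That the tangent spaces
  are lines makes their maximal ideals principal (\<open>uniformizer_exists\<close>), and Krull's intersection
  theorem (\<open>at_factor_power\<close>) excludes nonzero functions of infinite order; it rests on Hilbert's
  basis theorem.

  \<^item> There is a derivation \<open>d/dt\<close> which preserves regularity near \<open>b\<close> (\<open>vector_field_exists\<close>). It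
  consists of the tangent vectors \<open>v\<close> with \<open>v t = 1\<close> at the points near \<open>b\<close>.

  \<^item> Regular functions on the whole curve are constant, by properness
  (\<open>global_regular_constant\<close>). So nonzero elements of \<open>V\<close> have nonpositive order at \<open>b\<close>, which
  bounds the differences of their orders by \<open>N\<close>.
\<close>

section \<open>Hilbert's basis theorem\<close>

definition is_subring :: "'r::comm_ring_1 set \<Rightarrow> bool" where
  "is_subring R \<longleftrightarrow> 1 \<in> R \<and> (\<forall>x\<in>R. \<forall>y\<in>R. x + y \<in> R \<and> x * y \<in> R \<and> - x \<in> R)"

lemma is_subringD:
  assumes "is_subring R"
  shows "1 \<in> R" "0 \<in> R" "x \<in> R \<Longrightarrow> y \<in> R \<Longrightarrow> x + y \<in> R" "x \<in> R \<Longrightarrow> y \<in> R \<Longrightarrow> x * y \<in> R"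
    "x \<in> R \<Longrightarrow> - x \<in> R" "x \<in> R \<Longrightarrow> y \<in> R \<Longrightarrow> x - y \<in> R"
proof -
  have a: "1 \<in> R" "\<And>x y. x \<in> R \<Longrightarrow> y \<in> R \<Longrightarrow> x + y \<in> R" "\<And>x. x \<in> R \<Longrightarrow> - x \<in> R"
    "\<And>x y. x \<in> R \<Longrightarrow> y \<in> R \<Longrightarrow> x * y \<in> R"
    using assms by (auto simp: is_subring_def)
  have m: "x - y \<in> R" if "x \<in> R" "y \<in> R" for x y using a(2)[OF that(1) a(3)[OF that(2)]] by simp
  show "1 \<in> R" "0 \<in> R" "x \<in> R \<Longrightarrow> y \<in> R \<Longrightarrow> x + y \<in> R" "x \<in> R \<Longrightarrow> y \<in> R \<Longrightarrow> x * y \<in> R"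
    "x \<in> R \<Longrightarrow> - x \<in> R" "x \<in> R \<Longrightarrow> y \<in> R \<Longrightarrow> x - y \<in> R"
    using a m m[of 1 1] by auto
qed

lemma is_subring_sum:
  assumes "is_subring R" "\<And>i. i \<in> I \<Longrightarrow> f i \<in> R"
  shows "sum f I \<in> R"
  using assms(2) by (induction I rule: infinite_finite_induct) (auto simp: is_subringD[OF assms(1)])

inductive_set ideal_of :: "'r::comm_ring_1 set \<Rightarrow> 'r set \<Rightarrow> 'r set" for R S where
  zero: "0 \<in> ideal_of R S"
| step: "x \<in> ideal_of R S \<Longrightarrow> r \<in> R \<Longrightarrow> s \<in> S \<Longrightarrow> x + r * s \<in> ideal_of R S"

lemma ideal_of_add:
  assumes "y \<in> ideal_of R S" "x \<in> ideal_of R S"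
  shows "x + y \<in> ideal_of R S"
  using assms(1)
proof induction
  case zero
  show ?case using assms(2) by simp
next
  case (step y r s)
  show ?case using ideal_of.step[OF step(4,2,3)] by (simp add: add.assoc)
qed

lemma ideal_of_mult:
  assumes "is_subring R" "x \<in> ideal_of R S" "c \<in> R"
  shows "c * x \<in> ideal_of R S"
  using assms(2)
proof induction
  case zero
  show ?case by (simp add: ideal_of.zero)
next
  case (step x r s)
  show ?case
    using ideal_of.step[OF step(4) is_subringD(4)[OF assms(1,3) step(2)] step(3)]
    by (simp add: algebra_simps)
qed

lemma ideal_of_base:
  assumes "is_subring R" "s \<in> S"
  shows "s \<in> ideal_of R S"
  using ideal_of.step[OF ideal_of.zero is_subringD(1)[OF assms(1)] assms(2)] by simp

lemma ideal_of_subset: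
  assumes "is_subring R" "S \<subseteq> ideal_of R T"
  shows "ideal_of R S \<subseteq> ideal_of R T"
proof
  fix x assume "x \<in> ideal_of R S"
  then show "x \<in> ideal_of R T"
  proof induction
    case zero
    show ?case by (rule ideal_of.zero)
  next
    case (step x r s)
    then show ?case using ideal_of_add ideal_of_mult[OF assms(1)] assms(2) by blast
  qed
qed

lemma ideal_of_mono: "is_subring R \<Longrightarrow> S \<subseteq> T \<Longrightarrow> ideal_of R S \<subseteq> ideal_of R T"
  by (meson ideal_of_base ideal_of_subset subset_iff)

lemma ideal_of_subring:
  assumes "is_subring R" "S \<subseteq> R"
  shows "ideal_of R S \<subseteq> R"
proof
  fix x assume "x \<in> ideal_of R S"
  then show "x \<in> R"
    using assms(2) by induction (auto intro!: is_subringD(2,3,4)[OF assms(1)])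
qed

lemma ideal_of_UN:
  assumes "is_subring R" "x \<in> ideal_of R (range s)"
  shows "\<exists>m::nat. x \<in> ideal_of R (s ` {..<m})"
  using assms(2)
proof induction
  case zero
  show ?case using ideal_of.zero by blast
next
  case (step x r y)
  then obtain m j where m: "x \<in> ideal_of R (s ` {..<m})" "y = s j" by blast
  have "x \<in> ideal_of R (s ` {..<max m (Suc j)})"
    using m(1) ideal_of_mono[OF assms(1), of "s ` {..<m}" "s ` {..<max m (Suc j)}"] by fastforce
  then have "x + r * y \<in> ideal_of R (s ` {..<max m (Suc j)})"
    by (rule ideal_of.step) (use step(2) m(2) in auto)
  then show ?case by blast
qed

text \<open>
  This form of the ascending chain condition is the one which the proof of Krull's intersection
  theorem consumes, and it passes from a ring to its homomorphic images by choosing preimages.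
\<close>

definition noetherian :: "'r::comm_ring_1 set \<Rightarrow> bool" where
  "noetherian R \<longleftrightarrow> (\<forall>s. range s \<subseteq> R \<longrightarrow> (\<exists>m::nat. s m \<in> ideal_of R (s ` {..<m})))"

definition polys_over :: "'r::comm_ring_1 set \<Rightarrow> 'r poly set" where
  "polys_over R = {p. \<forall>i. coeff p i \<in> R}"

lemma is_subring_polys_over:
  assumes "is_subring R"
  shows "is_subring (polys_over R)"
  unfolding is_subring_def polys_over_def
  by (auto simp: is_subringD[OF assms] coeff_mult coeff_1 intro!: is_subring_sum[OF assms])

lemma monom_polys_over: "is_subring R \<Longrightarrow> c \<in> R \<Longrightarrow> monom c n \<in> polys_over R"
  by (auto simp: polys_over_def is_subringD)

text \<open>
  Multiplying each \<open>p\<^sub>j\<close> by the power of the variable which raises its degree to \<open>d\<close> turns a linear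
  combination of leading coefficients into one of polynomials.
\<close>

lemma lift_leading_coeffs:
  assumes R: "is_subring R" and d: "\<And>j. j \<in> J \<Longrightarrow> degree (p j) \<le> d"
    and x: "x \<in> ideal_of R ((\<lambda>j. lead_coeff (p j)) ` J)"
  shows "\<exists>q \<in> ideal_of (polys_over R) (p ` J). degree q \<le> d \<and> coeff q d = x"
  using x
proof induction
  case zero
  show ?case by (rule bexI[of _ 0]) (auto intro: ideal_of.zero)
next
  case (step x r s)
  then obtain q where q: "q \<in> ideal_of (polys_over R) (p ` J)" "degree q \<le> d" "coeff q d = x" by blast
  obtain j where j: "j \<in> J" "s = lead_coeff (p j)" using step(3) by blast
  let ?m = "monom r (d - degree (p j))"
  have dm: "degree (?m * p j) \<le> d"
    using degree_mult_le[of ?m "p j"] degree_monom_le[of r "d - degree (p j)"] d[OF j(1)] by linarith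
  have c: "coeff (?m * p j) d = r * s"
    using d[OF j(1)] by (simp add: coeff_monom_mult j(2))
  show ?case
  proof (rule bexI[of _ "q + ?m * p j"])
    show "degree (q + ?m * p j) \<le> d \<and> coeff (q + ?m * p j) d = x + r * s"
      using q dm c by (auto intro: degree_add_le)
    show "q + ?m * p j \<in> ideal_of (polys_over R) (p ` J)"
      using q(1) monom_polys_over[OF R step(2)] j(1) by (intro ideal_of.step) auto
  qed
qed

text \<open>
  In an ideal that is not finitely generated one can choose again and again an element of least
  degree outside the ideal generated by the previous choices. The leading coefficient of some choice
  is a combination of the earlier ones, and subtracting the corresponding combination of earlier
  choices contradicts the minimality of its degree.
\<close>

theorem noetherian_polys_over:
  fixes R :: "'r::comm_ring_1 set"
  assumes R: "is_subring R" and noeth: "noetherian R"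
  shows "noetherian (polys_over R)"
proof (rule ccontr)
  let ?P = "polys_over R"
  have P: "is_subring ?P" by (rule is_subring_polys_over[OF R])
  assume "\<not> noetherian ?P"
  then obtain s :: "nat \<Rightarrow> 'r poly"
    where s: "range s \<subseteq> ?P" "\<And>m. s m \<notin> ideal_of ?P (s ` {..<m})"
    unfolding noetherian_def by blast
  define I where "I = ideal_of ?P (range s)"
  have not_fg: "\<exists>x\<in>I. x \<notin> ideal_of ?P F" if F: "finite F" "F \<subseteq> I" for F
  proof (rule ccontr)
    assume "\<not> ?thesis"
    then have sub: "I \<subseteq> ideal_of ?P F" by blast
    have "\<exists>m. F \<subseteq> ideal_of ?P (s ` {..<m})"
      using F
    proof (induction F rule: finite_induct)
      case empty
      show ?case by simp
    next
      case (insert x F)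
      then obtain m where m: "F \<subseteq> ideal_of ?P (s ` {..<m})" by auto
      obtain m' where m': "x \<in> ideal_of ?P (s ` {..<m'})"
        using ideal_of_UN[OF P] insert.prems unfolding I_def by blast
      have "ideal_of ?P (s ` {..<m}) \<subseteq> ideal_of ?P (s ` {..<max m m'})"
        "ideal_of ?P (s ` {..<m'}) \<subseteq> ideal_of ?P (s ` {..<max m m'})"
        by (auto intro!: ideal_of_mono[OF P])
      then show ?case using m m' by (intro exI[of _ "max m m'"]) auto
    qed
    then obtain m where "F \<subseteq> ideal_of ?P (s ` {..<m})" by blast
    then have "ideal_of ?P F \<subseteq> ideal_of ?P (s ` {..<m})" by (rule ideal_of_subset[OF P])
    moreover have "s m \<in> I" unfolding I_def by (rule ideal_of_base[OF P]) simp
    ultimately show False using sub s(2)[of m] by blast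
  qed
  define Q where "Q f n r \<longleftrightarrow> r \<in> I \<and> r \<notin> ideal_of ?P (f ` {..<n}) \<and>
    (\<forall>r'\<in>I. r' \<notin> ideal_of ?P (f ` {..<n}) \<longrightarrow> degree r \<le> degree r')" for f :: "nat \<Rightarrow> 'r poly" and n r
  have "\<exists>f. \<forall>n. Q f n (f n)"
  proof (rule dependent_wellorder_choice)
    fix r and f g :: "nat \<Rightarrow> 'r poly" and n :: nat
    assume "\<And>k. k < n \<Longrightarrow> f k = g k"
    then have "f ` {..<n} = g ` {..<n}" by (intro image_cong) auto
    then show "Q f n r = Q g n r" unfolding Q_def by metis
  next
    fix n :: nat and f :: "nat \<Rightarrow> 'r poly"
    assume *: "\<And>k. k < n \<Longrightarrow> Q f k (f k)"
    have "f ` {..<n} \<subseteq> I" using * by (auto simp: Q_def)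
    then have "\<exists>r. r \<in> I \<and> r \<notin> ideal_of ?P (f ` {..<n})" using not_fg[of "f ` {..<n}"] by blast
    from ex_has_least_nat[of "\<lambda>r. r \<in> I \<and> r \<notin> ideal_of ?P (f ` {..<n})" _ degree] this
    show "\<exists>r. Q f n r" unfolding Q_def by blast
  qed
  then obtain f where f: "\<And>n. Q f n (f n)" by blast
  have fI: "f n \<in> I" and fn: "f n \<notin> ideal_of ?P (f ` {..<n})"
    and fmin: "r \<in> I \<Longrightarrow> r \<notin> ideal_of ?P (f ` {..<n}) \<Longrightarrow> degree (f n) \<le> degree r" for n r
    using f[of n] by (auto simp: Q_def)
  have mono: "degree (f i) \<le> degree (f n)" if "i < n" for i n
  proof (rule fmin[OF fI])
    show "f n \<notin> ideal_of ?P (f ` {..<i})"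
      using fn[of n] ideal_of_mono[OF P, of "f ` {..<i}" "f ` {..<n}"] that by fastforce
  qed
  have IP: "I \<subseteq> ?P" unfolding I_def using s(1) by (intro ideal_of_subring[OF P])
  have "range (\<lambda>n. lead_coeff (f n)) \<subseteq> R"
    using fI IP by (auto simp: polys_over_def)
  then obtain m where m: "lead_coeff (f m) \<in> ideal_of R ((\<lambda>n. lead_coeff (f n)) ` {..<m})"
    using noeth unfolding noetherian_def by meson
  have "\<exists>q\<in>ideal_of ?P (f ` {..<m}). degree q \<le> degree (f m) \<and> coeff q (degree (f m)) = lead_coeff (f m)"
    using mono by (intro lift_leading_coeffs[OF R _ m]) auto
  then obtain q where q: "q \<in> ideal_of ?P (f ` {..<m})" "degree q \<le> degree (f m)"
    "coeff q (degree (f m)) = lead_coeff (f m)" by blast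
  have nI: "f m - q \<notin> ideal_of ?P (f ` {..<m})"
    using ideal_of_add[OF q(1), of "f m - q"] fn[of m] by auto
  have "ideal_of ?P (f ` {..<m}) \<subseteq> I"
    unfolding I_def by (rule ideal_of_subset[OF P]) (use fI in \<open>auto simp: I_def\<close>)
  then have "- 1 * q \<in> I"
    unfolding I_def using q(1) is_subringD(1,5)[OF P] by (intro ideal_of_mult[OF P]) (auto simp: I_def)
  then have "f m - q \<in> I"
    using ideal_of_add[of "- 1 * q" ?P "range s" "f m"] fI[of m] by (auto simp: I_def)
  from fmin[OF this nI] have "degree (f m) \<le> degree (f m - q)" .
  moreover have "degree (f m - q) \<le> degree (f m)" using q(2) by (intro degree_diff_le) auto
  ultimately have "degree (f m - q) = degree (f m)" by simp
  moreover have "coeff (f m - q) (degree (f m)) = 0" using q(3) by simp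
  ultimately have "lead_coeff (f m - q) = 0" by metis
  then have "f m - q = 0" by (simp only: leading_coeff_0_iff)
  then show False using nI ideal_of.zero by metis
qed

definition adjoin :: "'r::comm_ring_1 set \<Rightarrow> 'r \<Rightarrow> 'r set" where
  "adjoin R y = (\<lambda>p. poly p y) ` polys_over R"

lemma noetherian_adjoin:
  assumes R: "is_subring R" and "noetherian R"
  shows "noetherian (adjoin R y)"
  unfolding noetherian_def
proof (intro allI impI)
  fix s :: "nat \<Rightarrow> 'a" assume s: "range s \<subseteq> adjoin R y"
  have "\<forall>n. \<exists>p. p \<in> polys_over R \<and> s n = poly p y"
    using s by (auto simp: adjoin_def)
  then obtain p where p: "\<And>n. p n \<in> polys_over R" "\<And>n. s n = poly (p n) y" by metis
  obtain m where m: "p m \<in> ideal_of (polys_over R) (p ` {..<m})"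
    using noetherian_polys_over[OF assms] p(1) unfolding noetherian_def by blast
  have "poly q y \<in> ideal_of (adjoin R y) (s ` {..<m})"
    if "q \<in> ideal_of (polys_over R) (p ` {..<m})" for q
    using that
  proof induction
    case zero
    show ?case by (simp add: ideal_of.zero)
  next
    case (step x r z)
    then obtain j where j: "j < m" "z = p j" by blast
    have "poly x y + poly r y * s j \<in> ideal_of (adjoin R y) (s ` {..<m})"
      by (rule ideal_of.step) (use step j in \<open>auto simp: adjoin_def\<close>)
    then show ?case by (simp add: j(2) p(2))
  qed
  then show "\<exists>m. s m \<in> ideal_of (adjoin R y) (s ` {..<m})" using m p(2) by metis
qed

lemma is_subring_poly_funs: "is_subring (poly_funs n)"
proof -
  have m: "- f \<in> poly_funs n" if "f \<in> poly_funs n" for f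
    using poly_funs.mult[OF poly_funs.const[of "-1"] that] by (simp add: fun_Compl_def)
  show ?thesis
    unfolding is_subring_def
    by (auto simp: plus_fun_def times_fun_def one_fun_def m intro: poly_funs.intros)
qed

text \<open>This makes the basis theorem available by induction on the number of variables.\<close>

lemma poly_funs_Suc: "poly_funs (Suc n) = adjoin (poly_funs n) (\<lambda>a. a n)"
proof -
  let ?A = "adjoin (poly_funs n) (\<lambda>a. a n) :: ((nat \<Rightarrow> 'a) \<Rightarrow> 'a) set"
  have emb: "F \<in> ?A" if "F \<in> poly_funs n" for F
    unfolding adjoin_def
    by (rule image_eqI[of _ _ "[:F:]"])
      (use that is_subringD(2)[OF is_subring_poly_funs] in \<open>auto simp: polys_over_def coeff_pCons split: nat.splits\<close>)
  have P: "is_subring (polys_over (poly_funs n :: ((nat \<Rightarrow> 'a) \<Rightarrow> 'a) set))"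
    by (intro is_subring_polys_over is_subring_poly_funs)
  have add: "F + G \<in> ?A" and mult: "F * G \<in> ?A" if "F \<in> ?A" "G \<in> ?A" for F G
    using that is_subringD(3,4)[OF P] unfolding adjoin_def
    by (auto simp flip: poly_add poly_mult)
  have var: "(\<lambda>a. a n) \<in> ?A"
    unfolding adjoin_def
    by (rule image_eqI[of _ _ "[:0, 1:]"])
      (use is_subringD(1,2)[OF is_subring_poly_funs] in \<open>auto simp: polys_over_def coeff_pCons split: nat.splits\<close>)
  have "F \<in> ?A" if "F \<in> poly_funs (Suc n)" for F
    using that
  proof induction
    case (const c)
    show ?case by (rule emb) (rule poly_funs.const)
  next
    case (coord i)
    then show ?case using var emb[OF poly_funs.coord] by (cases "i = n") auto
  next
    case (add F G)
    then show ?case using \<open>\<And>G F. F \<in> ?A \<Longrightarrow> G \<in> ?A \<Longrightarrow> F + G \<in> ?A\<close> by (simp add: plus_fun_def)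
  next
    case (mult F G)
    then show ?case using \<open>\<And>G F. F \<in> ?A \<Longrightarrow> G \<in> ?A \<Longrightarrow> F * G \<in> ?A\<close> by (simp add: times_fun_def)
  qed
  moreover have "F \<in> poly_funs (Suc n)" if F: "F \<in> ?A" for F
  proof -
    have sub: "G \<in> poly_funs (Suc n)" if "G \<in> poly_funs n" for G :: "(nat \<Rightarrow> 'a) \<Rightarrow> 'a"
      using that by induction (auto intro: poly_funs.intros)
    obtain p where p: "p \<in> polys_over (poly_funs n)" "F = poly p (\<lambda>a. a n)"
      using F unfolding adjoin_def by blast
    have "poly p (\<lambda>a. a n) \<in> poly_funs (Suc n)" using p(1)
    proof (induction p)
      case 0
      show ?case using is_subringD(2)[OF is_subring_poly_funs, of "Suc n"] by (simp add: zero_fun_def)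
    next
      case (pCons c p)
      have "coeff (pCons c p) i \<in> poly_funs n" for i
        using pCons.prems unfolding polys_over_def by blast
      from this[of 0] this[of "Suc _"] have c: "c \<in> poly_funs n" "p \<in> polys_over (poly_funs n)"
        by (auto simp: polys_over_def)
      have "(\<lambda>a. a n) * poly p (\<lambda>a. a n) \<in> poly_funs (Suc n)"
        using is_subringD(4)[OF is_subring_poly_funs poly_funs.coord[of n "Suc n"] pCons.IH[OF c(2)]]
        by simp
      then show ?case
        using is_subringD(3)[OF is_subring_poly_funs sub[OF c(1)]]
        by (simp add: plus_fun_def times_fun_def)
    qed
    then show ?thesis using p(2) by simp
  qed
  ultimately show ?thesis by blast
qed

theorem noetherian_poly_funs: "noetherian (poly_funs n :: ((nat \<Rightarrow> 'k::field) \<Rightarrow> 'k) set)"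
proof (induction n)
  case 0
  have const: "\<exists>c. F = (\<lambda>_. c)" if "F \<in> poly_funs 0" for F :: "(nat \<Rightarrow> 'k) \<Rightarrow> 'k"
    using that by induction auto
  show ?case
    unfolding noetherian_def
  proof (intro allI impI)
    fix s :: "nat \<Rightarrow> (nat \<Rightarrow> 'k) \<Rightarrow> 'k" assume "range s \<subseteq> poly_funs 0"
    then have "\<forall>n. \<exists>c. s n = (\<lambda>_. c)" using const by blast
    then obtain c where c: "\<And>n. s n = (\<lambda>_. c n)" by metis
    show "\<exists>m. s m \<in> ideal_of (poly_funs 0) (s ` {..<m})"
    proof (cases "c 0 = 0")
      case True
      then have "s 0 = 0" using c[of 0] by (simp add: zero_fun_def)
      then show ?thesis using ideal_of.zero by metis
    next
      case False
      have "0 + (\<lambda>_. c 1 / c 0) * s 0 \<in> ideal_of (poly_funs 0) (s ` {..<1})"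
        by (intro ideal_of.intros poly_funs.intros) auto
      moreover have "0 + (\<lambda>_. c 1 / c 0) * s 0 = s 1"
        using False by (auto simp: c)
      ultimately show ?thesis by metis
    qed
  qed
next
  case (Suc n)
  then show ?case unfolding poly_funs_Suc by (intro noetherian_adjoin is_subring_poly_funs)
qed


section \<open>Sheaves of functions\<close>

lemma sheaf_cong:
  assumes "sheaf_of_functions X" "openin (top_of X) U" "f \<in> regular_on X U" "\<And>x. x \<in> U \<Longrightarrow> g x = f x"
  shows "g \<in> regular_on X U"
proof -
  note * = assms(1)[unfolded sheaf_of_functions_def, THEN conjunct1, THEN spec, THEN spec, THEN spec, THEN mp]
  show ?thesis by (rule *[of U f g]) (use assms(2-4) in simp)
qed

lemma sheaf_restrict:
  assumes "sheaf_of_functions X" "openin (top_of X) U" "openin (top_of X) V" "V \<subseteq> U" "f \<in> regular_on X U"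
  shows "f \<in> regular_on X V"
  using assms(1)[unfolded sheaf_of_functions_def, THEN conjunct2, THEN conjunct1] assms(2-5) by blast

lemma sheaf_glue:
  assumes sh: "sheaf_of_functions X"
    and loc: "\<And>x. x \<in> U \<Longrightarrow> \<exists>V. openin (top_of X) V \<and> x \<in> V \<and> V \<subseteq> U \<and> f \<in> regular_on X V"
  shows "f \<in> regular_on X U"
proof -
  let ?\<U> = "{V. openin (top_of X) V \<and> V \<subseteq> U \<and> f \<in> regular_on X V}"
  note * = sh[unfolded sheaf_of_functions_def, THEN conjunct2, THEN conjunct2, THEN conjunct1,
      THEN spec, THEN spec, THEN mp, of ?\<U> f]
  have "f \<in> regular_on X (\<Union>?\<U>)" by (rule *) simp
  moreover have "\<Union>?\<U> = U" using loc by blast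
  ultimately show ?thesis by simp
qed

lemma sheaf_ring:
  assumes sh: "sheaf_of_functions X" and U: "openin (top_of X) U"
  shows "(\<lambda>_. c) \<in> regular_on X U"
    and "f \<in> regular_on X U \<Longrightarrow> g \<in> regular_on X U \<Longrightarrow> (\<lambda>x. f x + g x) \<in> regular_on X U"
    and "f \<in> regular_on X U \<Longrightarrow> g \<in> regular_on X U \<Longrightarrow> (\<lambda>x. f x * g x) \<in> regular_on X U"
  using sh[unfolded sheaf_of_functions_def, THEN conjunct2, THEN conjunct2, THEN conjunct2, THEN spec, THEN mp, OF U]
  by blast+


section \<open>Affine algebraic sets\<close>

lemma topspace_zariski [simp]: "topspace (zariski n) = affine_space n"
proof -
  have "affine_space n \<in> {{a \<in> affine_space n. F a \<noteq> 0} | F. F \<in> poly_funs n}"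
    by (rule CollectI, rule exI[of _ "\<lambda>_. 1"]) (auto intro: poly_funs.const)
  then show ?thesis unfolding zariski_def topology_generated_by_topspace by auto
qed

lemma openin_zariski_nonvanishing:
  "F \<in> poly_funs n \<Longrightarrow> openin (zariski n) {a \<in> affine_space n. F a \<noteq> 0}"
  unfolding zariski_def by (rule topology_generated_by_Basis) blast

text \<open>The principal open sets form a basis: they are closed under intersection, by multiplication.\<close>

lemma zariski_basis:
  assumes "openin (zariski n) W" "a \<in> W"
  shows "\<exists>F\<in>poly_funs n. F a \<noteq> 0 \<and> {x \<in> affine_space n. F x \<noteq> 0} \<subseteq> W"
proof -
  have "generate_topology_on {{a \<in> affine_space n. F a \<noteq> 0} | F. F \<in> poly_funs n} W"
    using assms(1) unfolding zariski_def by (rule openin_topology_generated_by)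
  then show ?thesis using assms(2)
  proof induction
    case Empty
    then show ?case by simp
  next
    case (Int A B)
    then obtain F G where F: "F \<in> poly_funs n" "F a \<noteq> 0" "{x \<in> affine_space n. F x \<noteq> 0} \<subseteq> A"
      and G: "G \<in> poly_funs n" "G a \<noteq> 0" "{x \<in> affine_space n. G x \<noteq> 0} \<subseteq> B" by blast
    show ?case
      by (rule bexI[of _ "\<lambda>x. F x * G x"]) (use F G in \<open>auto intro: poly_funs.mult\<close>)
  next
    case (UN K)
    then show ?case by blast
  next
    case (Basis s)
    then show ?case by blast
  qed
qed

lemma topspace_affine_alg_set:
  "Z \<subseteq> affine_space n \<Longrightarrow> points (affine_alg_set n Z) = Z"
  by (auto simp: affine_alg_set_def)

lemma affine_alg_set_regularE:
  assumes "h \<in> regular_on (affine_alg_set n Z) W" "a \<in> W"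
  obtains W' F G where "openin (subtopology (zariski n) Z) W'" "a \<in> W'" "W' \<subseteq> W"
    "F \<in> poly_funs n" "G \<in> poly_funs n" "\<And>b. b \<in> W' \<Longrightarrow> G b \<noteq> 0" "\<And>b. b \<in> W' \<Longrightarrow> h b = F b / G b"
  using assms by (auto simp: affine_alg_set_def)

lemma affine_alg_set_regular_frac:
  assumes "openin (subtopology (zariski n) Z) W" "F \<in> poly_funs n" "G \<in> poly_funs n"
    "\<And>b. b \<in> W \<Longrightarrow> G b \<noteq> 0" "\<And>b. b \<in> W \<Longrightarrow> h b = F b / G b"
  shows "h \<in> regular_on (affine_alg_set n Z) W"
  unfolding affine_alg_set_def using assms
  by (simp, intro ballI exI[of _ W] exI[of _ F] exI[of _ G]) auto

text \<open>
  Dropping the requirement that the neighbourhood lies in the given open set makes the sheaf axioms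
  statements about single points.
\<close>

definition fraction_near :: "nat \<Rightarrow> (nat \<Rightarrow> 'k::field) set \<Rightarrow> ((nat \<Rightarrow> 'k) \<Rightarrow> 'k) \<Rightarrow> (nat \<Rightarrow> 'k) \<Rightarrow> bool" where
  "fraction_near n Z h a \<longleftrightarrow> (\<exists>W F G. openin (subtopology (zariski n) Z) W \<and> a \<in> W \<and>
     F \<in> poly_funs n \<and> G \<in> poly_funs n \<and> (\<forall>b\<in>W. G b \<noteq> 0 \<and> h b = F b / G b))"

lemma affine_alg_set_regular_iff:
  assumes W: "openin (subtopology (zariski n) Z) W"
  shows "h \<in> regular_on (affine_alg_set n Z) W \<longleftrightarrow> (\<forall>a\<in>W. fraction_near n Z h a)"
proof
  assume h: "h \<in> regular_on (affine_alg_set n Z) W"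
  show "\<forall>a\<in>W. fraction_near n Z h a"
  proof
    fix a assume "a \<in> W"
    with h show "fraction_near n Z h a"
      unfolding fraction_near_def by (rule affine_alg_set_regularE) (intro exI conjI ballI, assumption+)
  qed
next
  assume *: "\<forall>a\<in>W. fraction_near n Z h a"
  have "\<exists>V F G. openin (subtopology (zariski n) Z) V \<and> a \<in> V \<and> V \<subseteq> W \<and>
      F \<in> poly_funs n \<and> G \<in> poly_funs n \<and> (\<forall>b\<in>V. G b \<noteq> 0 \<and> h b = F b / G b)" if a: "a \<in> W" for a
  proof -
    obtain V F G where "openin (subtopology (zariski n) Z) V" "a \<in> V" "F \<in> poly_funs n" "G \<in> poly_funs n"
      "\<forall>b\<in>V. G b \<noteq> 0 \<and> h b = F b / G b" using bspec[OF * a] unfolding fraction_near_def by (elim exE conjE)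
    then show ?thesis using W a by (intro exI[of _ "V \<inter> W"] exI[of _ F] exI[of _ G]) auto
  qed
  then show "h \<in> regular_on (affine_alg_set n Z) W" by (simp add: affine_alg_set_def)
qed

lemma fraction_near_ring:
  assumes "fraction_near n Z f a" "fraction_near n Z g a"
  shows "fraction_near n Z (\<lambda>x. f x + g x) a" "fraction_near n Z (\<lambda>x. f x * g x) a"
proof -
  let ?T = "subtopology (zariski n) Z"
  obtain V F1 G1 where 1: "openin ?T V" "a \<in> V" "F1 \<in> poly_funs n" "G1 \<in> poly_funs n"
    "\<forall>b\<in>V. G1 b \<noteq> 0 \<and> f b = F1 b / G1 b" using assms(1) unfolding fraction_near_def by (elim exE conjE)
  obtain W F2 G2 where 2: "openin ?T W" "a \<in> W" "F2 \<in> poly_funs n" "G2 \<in> poly_funs n"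
    "\<forall>b\<in>W. G2 b \<noteq> 0 \<and> g b = F2 b / G2 b" using assms(2) unfolding fraction_near_def by (elim exE conjE)
  show "fraction_near n Z (\<lambda>x. f x + g x) a"
    unfolding fraction_near_def
    by (rule exI[of _ "V \<inter> W"], rule exI[of _ "\<lambda>b. F1 b * G2 b + F2 b * G1 b"],
        rule exI[of _ "\<lambda>b. G1 b * G2 b"])
      (use 1 2 in \<open>auto intro!: poly_funs.add poly_funs.mult simp: add_frac_eq\<close>)
  show "fraction_near n Z (\<lambda>x. f x * g x) a"
    unfolding fraction_near_def
    by (rule exI[of _ "V \<inter> W"], rule exI[of _ "\<lambda>b. F1 b * F2 b"], rule exI[of _ "\<lambda>b. G1 b * G2 b"])
      (use 1 2 in \<open>auto intro!: poly_funs.mult\<close>)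
qed

lemma sheaf_of_functions_affine_alg_set:
  "sheaf_of_functions (affine_alg_set n Z :: (nat \<Rightarrow> 'k::field, 'k) fun_space)"
proof -
  let ?T = "subtopology (zariski n) Z" and ?R = "regular_on (affine_alg_set n Z)"
  have top: "top_of (affine_alg_set n Z) = ?T" by (simp add: affine_alg_set_def)
  note iff = affine_alg_set_regular_iff[of n Z]
  show ?thesis
    unfolding sheaf_of_functions_def top
  proof (intro conjI allI impI ballI, elim conjE)
    fix U and f g :: "(nat \<Rightarrow> 'k) \<Rightarrow> 'k"
    assume U: "openin ?T U" "f \<in> ?R U" and eq: "\<forall>x\<in>U. g x = f x"
    have "fraction_near n Z g a" if a: "a \<in> U" for a
    proof -
      from U(2) a obtain W F G where "openin ?T W" "a \<in> W" "W \<subseteq> U"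
        "F \<in> poly_funs n" "G \<in> poly_funs n" "\<And>b. b \<in> W \<Longrightarrow> G b \<noteq> 0" "\<And>b. b \<in> W \<Longrightarrow> f b = F b / G b"
        by (rule affine_alg_set_regularE) (rule that)
      then show ?thesis
        unfolding fraction_near_def using eq by (intro exI[of _ W] exI[of _ F] exI[of _ G]) auto
    qed
    then show "g \<in> ?R U" unfolding iff[OF U(1)] by blast
  next
    fix U V assume "openin ?T U \<and> openin ?T V \<and> V \<subseteq> U"
    then show "?R U \<subseteq> ?R V" using iff[of U] iff[of V] by blast
  next
    fix \<U> :: "(nat \<Rightarrow> 'k) set set" and f :: "(nat \<Rightarrow> 'k) \<Rightarrow> 'k"
    assume *: "\<forall>U\<in>\<U>. openin ?T U \<and> f \<in> ?R U"
    then have "openin ?T (\<Union>\<U>)" by blast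
    from iff[OF this, of f] show "f \<in> ?R (\<Union>\<U>)" using * iff by blast
  next
    fix U c assume "openin ?T U"
    then show "(\<lambda>_. c) \<in> ?R U"
      by (rule affine_alg_set_regular_frac[of _ _ _ "\<lambda>_. c" "\<lambda>_. 1"]) (auto intro: poly_funs.const)
  next
    fix U and f g :: "(nat \<Rightarrow> 'k) \<Rightarrow> 'k"
    assume U: "openin ?T U" and "f \<in> ?R U" "g \<in> ?R U"
    then have "\<forall>a\<in>U. fraction_near n Z f a" "\<forall>a\<in>U. fraction_near n Z g a" by (simp_all only: iff[OF U])
    then show "(\<lambda>x. f x + g x) \<in> ?R U" "(\<lambda>x. f x * g x) \<in> ?R U"
      unfolding iff[OF U] by (simp_all add: fraction_near_ring)
  qed
qed

lemma topspace_zariski_prod: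
  assumes "sheaf_of_functions X" "sheaf_of_functions Y"
  shows "topspace (zariski_prod X Y) = points X \<times> points Y"
proof -
  let ?B = "{{(x, y). x \<in> U \<and> y \<in> V \<and> (\<Sum>i<m. f i x * g i y) \<noteq> 0} | U V (m::nat) f g.
        openin (top_of X) U \<and> openin (top_of Y) V \<and>
        (\<forall>i<m. f i \<in> regular_on X U \<and> g i \<in> regular_on Y V)}"
  have "points X \<times> points Y \<in> ?B"
    by (rule CollectI, rule exI[of _ "points X"], rule exI[of _ "points Y"], rule exI[of _ 1],
        rule exI[of _ "\<lambda>_ _. 1"], rule exI[of _ "\<lambda>_ _. 1"])
      (use assms in \<open>auto simp: sheaf_of_functions_def\<close>)
  moreover have "\<Union>?B \<subseteq> points X \<times> points Y"
    by (auto dest: openin_subset)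
  ultimately show ?thesis
    unfolding zariski_prod_def topology_generated_by_topspace
    by (meson Union_upper subset_antisym)
qed

lemma openin_zariski_prod_nonvanishing:
  fixes f :: "nat \<Rightarrow> 'a \<Rightarrow> 'k::field"
  assumes "openin (top_of X) U" "openin (top_of Y) V"
    "\<And>i. i < m \<Longrightarrow> f i \<in> regular_on X U" "\<And>i. i < m \<Longrightarrow> g i \<in> regular_on Y V"
  shows "openin (zariski_prod X Y) {(x, y). x \<in> U \<and> y \<in> V \<and> (\<Sum>i<m. f i x * g i y) \<noteq> 0}"
  unfolding zariski_prod_def
  by (rule topology_generated_by_Basis, rule CollectI)
    (intro exI[of _ U] exI[of _ V] exI[of _ m] exI[of _ f] exI[of _ g], use assms in auto)

text \<open>
  The complement of the diagonal is the union of the open sets on which some coordinate differs.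
  The case of the affine line provides the test variety for properness.
\<close>

lemma variety_affine_alg_set:
  assumes "closedin (zariski n) (Z :: (nat \<Rightarrow> 'k::field) set)"
  shows "variety (affine_alg_set n Z)"
proof -
  let ?A = "affine_alg_set n Z"
  have Z: "Z \<subseteq> affine_space n" using closedin_subset[OF assms] by simp
  note sh = sheaf_of_functions_affine_alg_set[of n Z]
  have pts: "points ?A = Z" by (rule topspace_affine_alg_set[OF Z])
  have "open_subspace ?A Z = ?A"
    by (simp add: open_subspace_def affine_alg_set_def subtopology_subtopology)
  moreover have "fun_space_iso ?A ?A id"
  proof -
    have "points ?A \<inter> W = W" if "openin (top_of ?A) W" for W using openin_subset[OF that] by blast
    then show ?thesis unfolding fun_space_iso_def by simp
  qed
  ultimately have "affine_variety (open_subspace ?A Z)"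
    unfolding affine_variety_def using assms by auto
  then have pre: "prevariety ?A"
    unfolding prevariety_def using sh pts openin_topspace[of "top_of ?A"]
    by (intro conjI exI[of _ "{Z}"]) auto
  have coord: "(\<lambda>a. a i) \<in> regular_on ?A Z" if "i < n" for i
    by (rule affine_alg_set_regular_frac[of _ _ _ "\<lambda>a. a i" "\<lambda>_. 1"])
      (use that Z pts openin_topspace[of "top_of ?A"] in
        \<open>auto intro: poly_funs.intros simp: affine_alg_set_def\<close>)
  have const: "(\<lambda>_. c) \<in> regular_on ?A Z" for c
    using sh pts openin_topspace[of "top_of ?A"] by (auto simp: sheaf_of_functions_def)
  \<comment> \<open>The sum is \<open>x i - y i\<close>, in the form in which the product topology is generated.\<close>
  define D where "D i = {(x, y). x \<in> Z \<and> y \<in> Z \<and>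
      (\<Sum>j<(2::nat). (if j = 0 then (\<lambda>a. a i) else (\<lambda>_. -1)) x * (if j = 0 then (\<lambda>_. 1) else (\<lambda>a. a i)) y) \<noteq> (0::'k)}"
    for i :: nat
  have D: "openin (zariski_prod ?A ?A) (D i)" if "i < n" for i
    unfolding D_def using that coord const pts openin_topspace[of "top_of ?A"]
    by (intro openin_zariski_prod_nonvanishing) auto
  have Di: "D i = {(x, y). x \<in> Z \<and> y \<in> Z \<and> x i \<noteq> y i}" for i
    unfolding D_def by (auto simp: numeral_2_eq_2)
  have "x = y" if "x \<in> Z" "y \<in> Z" "\<And>i. i < n \<Longrightarrow> x i = y i" for x y
    using that Z unfolding affine_space_def by (intro PiE_ext[of x "{..<n}" "\<lambda>_. UNIV" y]) auto
  then have "Z \<times> Z - {(x, x) | x. x \<in> Z} = (\<Union>i\<in>{..<n}. D i)"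
    unfolding Di by auto
  then have "openin (zariski_prod ?A ?A) (Z \<times> Z - {(x, x) | x. x \<in> Z})"
    using D by auto
  then have "closedin (zariski_prod ?A ?A) {(x, x) | x. x \<in> points ?A}"
    unfolding closedin_def topspace_zariski_prod[OF sh sh] pts by auto
  then show ?thesis unfolding variety_def using pre by simp
qed

lemma finite_zeros_affine_line:
  assumes "F \<in> poly_funs 1" "F a \<noteq> (0::'k::field)"
  shows "finite {x \<in> affine_space 1. F x = 0}"
proof -
  have "\<exists>p. \<forall>x. F x = poly p (x 0)"
    using assms(1)
  proof induction
    case (const c)
    show ?case by (rule exI[of _ "[:c:]"]) simp
  next
    case (coord i)
    then show ?case by (intro exI[of _ "[:0, 1:]"]) simp
  next
    case (add F G)
    then obtain p q where "\<forall>x. F x = poly p (x 0)" "\<forall>x. G x = poly q (x 0)" by blast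
    then show ?case by (intro exI[of _ "p + q"]) simp
  next
    case (mult F G)
    then obtain p q where "\<forall>x. F x = poly p (x 0)" "\<forall>x. G x = poly q (x 0)" by blast
    then show ?case by (intro exI[of _ "p * q"]) simp
  qed
  then obtain p where p: "\<And>x. F x = poly p (x 0)" by blast
  have "p \<noteq> 0" using p[of a] assms(2) by auto
  then have fin: "finite {c. poly p c = 0}" by (rule poly_roots_finite)
  have inj: "inj_on (\<lambda>x. x 0) (affine_space 1 :: (nat \<Rightarrow> 'k) set)"
  proof (rule inj_onI)
    fix x y :: "nat \<Rightarrow> 'k" assume "x \<in> affine_space 1" "y \<in> affine_space 1" "x 0 = y 0"
    then show "x = y" unfolding affine_space_def by (intro PiE_ext) auto
  qed
  show ?thesis
    by (rule finite_imageD[of "\<lambda>x. x 0"])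
      (rule finite_subset[OF _ fin], use p inj in \<open>auto intro: inj_on_subset\<close>)
qed


section \<open>Charts\<close>

text \<open>
  An affine open set enters the proof only through coordinates on it, which generate the rings of
  regular functions up to denominators; the affine algebraic set itself can be forgotten.
\<close>

definition chart ::
  "('a, 'k::field) fun_space \<Rightarrow> 'a set \<Rightarrow> nat \<Rightarrow> ('a \<Rightarrow> nat \<Rightarrow> 'k) \<Rightarrow> bool" where
  "chart X U n \<phi> \<longleftrightarrow> openin (top_of X) U \<and> inj_on \<phi> U \<and> \<phi> ` U \<subseteq> affine_space n \<and>
     (\<forall>F\<in>poly_funs n. openin (top_of X) {x \<in> U. F (\<phi> x) \<noteq> 0}) \<and>
     (\<forall>W F G. openin (top_of X) W \<and> W \<subseteq> U \<and> F \<in> poly_funs n \<and> G \<in> poly_funs n \<and> (\<forall>y\<in>W. G (\<phi> y) \<noteq> 0) \<longrightarrow>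
        (\<lambda>x. F (\<phi> x) / G (\<phi> x)) \<in> regular_on X W) \<and>
     (\<forall>V f x. openin (top_of X) V \<and> V \<subseteq> U \<and> f \<in> regular_on X V \<and> x \<in> V \<longrightarrow>
        (\<exists>W F G. openin (top_of X) W \<and> x \<in> W \<and> W \<subseteq> V \<and> F \<in> poly_funs n \<and> G \<in> poly_funs n \<and>
           (\<forall>y\<in>W. G (\<phi> y) \<noteq> 0 \<and> f y = F (\<phi> y) / G (\<phi> y))))"

lemma chart_of_iso:
  fixes X :: "('a, 'k::field) fun_space"
  assumes sh: "sheaf_of_functions X" and U: "openin (top_of X) U"
    and Z: "closedin (zariski n) Z" and iso: "fun_space_iso (open_subspace X U) (affine_alg_set n Z) \<phi>"
  shows "chart X U n \<phi>"
proof -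
  have ZA: "Z \<subseteq> affine_space n" using closedin_subset[OF Z] by simp
  have UX: "U \<subseteq> points X" using openin_subset[OF U] .
  define T where "T = subtopology (zariski n) Z"
  have hom: "homeomorphic_map (subtopology (top_of X) U) T \<phi>"
    and reg: "\<And>W h. openin T W \<Longrightarrow> h \<in> regular_on (affine_alg_set n Z) W \<longleftrightarrow> h \<circ> \<phi> \<in> regular_on X (U \<inter> \<phi> -` W)"
    using iso UX by (auto simp: fun_space_iso_def open_subspace_def affine_alg_set_def T_def Int_absorb1)
  have tU: "topspace (subtopology (top_of X) U) = U" using UX by auto
  have tZ: "topspace T = Z" unfolding T_def using ZA by auto
  have inj: "inj_on \<phi> U" and im: "\<phi> ` U = Z"
    using homeomorphic_imp_injective_map[OF hom] homeomorphic_imp_surjective_map[OF hom] tU tZ by auto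
  have pre: "openin (top_of X) (U \<inter> \<phi> -` W)" if "openin T W" for W
  proof -
    have "openin (subtopology (top_of X) U) {x \<in> U. \<phi> x \<in> W}"
      using openin_continuous_map_preimage[OF homeomorphic_imp_continuous_map[OF hom] that]
      unfolding tU .
    then have "openin (top_of X) {x \<in> U. \<phi> x \<in> W}"
      unfolding openin_open_subtopology[OF U] by blast
    moreover have "{x \<in> U. \<phi> x \<in> W} = U \<inter> \<phi> -` W" by auto
    ultimately show ?thesis by simp
  qed
  have post: "openin T (\<phi> ` W)" if "openin (top_of X) W" "W \<subseteq> U" for W
    using homeomorphic_imp_open_map[OF hom] that
    unfolding open_map_def openin_open_subtopology[OF U] by blast
  have preim: "U \<inter> \<phi> -` (\<phi> ` W) = W" if "W \<subseteq> U" for W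
    using that inj by (auto dest: inj_onD)
  have 1: "openin (top_of X) {x \<in> U. F (\<phi> x) \<noteq> 0}" if "F \<in> poly_funs n" for F
  proof -
    have "openin T (Z \<inter> {a \<in> affine_space n. F a \<noteq> 0})"
      unfolding T_def openin_subtopology using openin_zariski_nonvanishing[OF that] by blast
    from pre[OF this] show ?thesis
      by (rule back_subst[of "openin (top_of X)"]) (use im ZA in auto)
  qed
  have 2: "(\<lambda>x. F (\<phi> x) / G (\<phi> x)) \<in> regular_on X W"
    if W: "openin (top_of X) W" "W \<subseteq> U" and FG: "F \<in> poly_funs n" "G \<in> poly_funs n" "\<And>y. y \<in> W \<Longrightarrow> G (\<phi> y) \<noteq> 0"
    for W F G
  proof -
    have "(\<lambda>a. F a / G a) \<in> regular_on (affine_alg_set n Z) (\<phi> ` W)"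
      by (rule affine_alg_set_regular_frac[of _ _ _ F G]) (use post[OF W] FG in \<open>auto simp: T_def\<close>)
    then show ?thesis
      unfolding reg[OF post[OF W]] preim[OF W(2)] by (simp add: comp_def)
  qed
  have 3: "\<exists>W F G. openin (top_of X) W \<and> x \<in> W \<and> W \<subseteq> V \<and> F \<in> poly_funs n \<and> G \<in> poly_funs n \<and>
           (\<forall>y\<in>W. G (\<phi> y) \<noteq> 0 \<and> f y = F (\<phi> y) / G (\<phi> y))"
    if V: "openin (top_of X) V" "V \<subseteq> U" and f: "f \<in> regular_on X V" and x: "x \<in> V" for V f x
  proof -
    define h where "h = f \<circ> inv_into U \<phi>"
    have hf: "(h \<circ> \<phi>) y = f y" if "y \<in> V" for y
      using that V(2) inj by (auto simp: h_def)
    then have "h \<circ> \<phi> \<in> regular_on X V"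
      by (rule sheaf_cong[OF sh V(1) f])
    then have "h \<in> regular_on (affine_alg_set n Z) (\<phi> ` V)"
      unfolding reg[OF post[OF V]] preim[OF V(2)] .
    moreover have "\<phi> x \<in> \<phi> ` V" using x by blast
    ultimately obtain W' F G where W': "openin (subtopology (zariski n) Z) W'" "\<phi> x \<in> W'" "W' \<subseteq> \<phi> ` V"
      "F \<in> poly_funs n" "G \<in> poly_funs n" "\<And>b. b \<in> W' \<Longrightarrow> G b \<noteq> 0" "\<And>b. b \<in> W' \<Longrightarrow> h b = F b / G b"
      by (rule affine_alg_set_regularE) blast
    have sub: "U \<inter> \<phi> -` W' \<subseteq> V" using W'(3) preim[OF V(2)] by blast
    show ?thesis
    proof (intro exI conjI ballI)
      show "openin (top_of X) (U \<inter> \<phi> -` W')" by (rule pre) (use W'(1) in \<open>simp add: T_def\<close>)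
      show "x \<in> U \<inter> \<phi> -` W'" using x V(2) W'(2) by auto
      fix y assume y: "y \<in> U \<inter> \<phi> -` W'"
      show "G (\<phi> y) \<noteq> 0" using y W'(6) by auto
      show "f y = F (\<phi> y) / G (\<phi> y)" using y W'(7)[of "\<phi> y"] hf[of y] sub by auto
    qed (use sub W' in auto)
  qed
  show ?thesis
    unfolding chart_def using U inj im ZA 1 2 3 by auto
qed

lemma prevariety_chart:
  assumes "prevariety X" "P \<in> points X"
  shows "\<exists>U n \<phi>. P \<in> U \<and> chart X U n \<phi>"
proof -
  from assms obtain U where U: "openin (top_of X) U" "P \<in> U" "affine_variety (open_subspace X U)"
    unfolding prevariety_def by blast
  then obtain n Z \<phi> where "closedin (zariski n) Z" "fun_space_iso (open_subspace X U) (affine_alg_set n Z) \<phi>"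
    unfolding affine_variety_def by blast
  then have "chart X U n \<phi>"
    using assms(1) U(1) by (intro chart_of_iso) (auto simp: prevariety_def)
  then show ?thesis using U(2) by blast
qed

lemma chartD:
  assumes c: "chart X U n \<phi>"
  shows "openin (top_of X) U" "inj_on \<phi> U" "\<And>x. x \<in> U \<Longrightarrow> \<phi> x \<in> affine_space n"
    "\<And>F. F \<in> poly_funs n \<Longrightarrow> openin (top_of X) {x \<in> U. F (\<phi> x) \<noteq> 0}"
    "\<And>W F G. openin (top_of X) W \<Longrightarrow> W \<subseteq> U \<Longrightarrow> F \<in> poly_funs n \<Longrightarrow> G \<in> poly_funs n \<Longrightarrow>
        (\<And>y. y \<in> W \<Longrightarrow> G (\<phi> y) \<noteq> 0) \<Longrightarrow> (\<lambda>x. F (\<phi> x) / G (\<phi> x)) \<in> regular_on X W"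
    "\<And>F. F \<in> poly_funs n \<Longrightarrow> (\<lambda>x. F (\<phi> x)) \<in> regular_on X U"
proof -
  note c' = c[unfolded chart_def]
  note c2 = c'[THEN conjunct2] note c3 = c2[THEN conjunct2] note c4 = c3[THEN conjunct2]
  note c5 = c4[THEN conjunct2]
  show 1: "openin (top_of X) U" by (rule c'[THEN conjunct1])
  show "inj_on \<phi> U" by (rule c2[THEN conjunct1])
  show "\<phi> x \<in> affine_space n" if "x \<in> U" for x
    using c3[THEN conjunct1] that by (rule subsetD[OF _ imageI])
  show "openin (top_of X) {x \<in> U. F (\<phi> x) \<noteq> 0}" if "F \<in> poly_funs n" for F
    using c4[THEN conjunct1] that by (rule bspec)
  show 5: "(\<lambda>x. F (\<phi> x) / G (\<phi> x)) \<in> regular_on X W"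
    if "openin (top_of X) W" "W \<subseteq> U" "F \<in> poly_funs n" "G \<in> poly_funs n" "\<And>y. y \<in> W \<Longrightarrow> G (\<phi> y) \<noteq> 0"
    for W F G
    using c5[THEN conjunct1, THEN spec, THEN spec, THEN spec, THEN mp, of W F G] that by simp
  show "(\<lambda>x. F (\<phi> x)) \<in> regular_on X U" if "F \<in> poly_funs n" for F
    using 5[OF 1 subset_refl that poly_funs.const[of 1]] by simp
qed

lemma chartE:
  assumes c: "chart X U n \<phi>" and V: "openin (top_of X) V" "V \<subseteq> U" "f \<in> regular_on X V" "x \<in> V"
  obtains W F G where "openin (top_of X) W" "x \<in> W" "W \<subseteq> V" "F \<in> poly_funs n" "G \<in> poly_funs n"
    "\<And>y. y \<in> W \<Longrightarrow> G (\<phi> y) \<noteq> 0" "\<And>y. y \<in> W \<Longrightarrow> f y = F (\<phi> y) / G (\<phi> y)"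
proof -
  note c6 = c[unfolded chart_def, THEN conjunct2, THEN conjunct2, THEN conjunct2, THEN conjunct2, THEN conjunct2]
  from c6[THEN spec, THEN spec, THEN spec, THEN mp, OF conjI[OF V(1) conjI[OF V(2) conjI[OF V(3,4)]]]]
  obtain W F G where "openin (top_of X) W" "x \<in> W" "W \<subseteq> V" "F \<in> poly_funs n" "G \<in> poly_funs n"
    "\<forall>y\<in>W. G (\<phi> y) \<noteq> 0 \<and> f y = F (\<phi> y) / G (\<phi> y)" by (elim exE conjE)
  then show ?thesis by (intro that[of W F G]) auto
qed


section \<open>Regular functions on an irreducible prevariety\<close>

locale irreducible_prevariety =
  fixes X :: "('a, 'k::field) fun_space"
  assumes prevar: "prevariety X"
    and irreducible: "irreducible_subset (top_of X) (points X)"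
begin

abbreviation "op U \<equiv> openin (top_of X) U"
abbreviation "\<O> P \<equiv> regular_at X P"
abbreviation "near P \<equiv> nhdsin (top_of X) P"

text \<open>
  Equality of rational functions is equality which holds eventually along this filter. Irreducibility
  makes the nonempty open sets a filter base.
\<close>

definition generic :: "'a filter" where
  "generic = (INF U\<in>{U. op U \<and> U \<noteq> {}}. principal U)"

lemma sh: "sheaf_of_functions X"
  using prevar by (simp add: prevariety_def)

lemma points_nonempty: "points X \<noteq> {}"
  using irreducible by (simp add: irreducible_subset_def)

lemma open_meet:
  assumes "op U" "op V" "U \<noteq> {}" "V \<noteq> {}"
  shows "U \<inter> V \<noteq> {}"
proof
  assume *: "U \<inter> V = {}"
  have "closedin (top_of X) (points X - U)" "closedin (top_of X) (points X - V)"
    using assms by auto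
  moreover have "points X \<subseteq> (points X - U) \<union> (points X - V)" using * by blast
  ultimately have "points X \<subseteq> points X - U \<or> points X \<subseteq> points X - V"
    using irreducible unfolding irreducible_subset_def by blast
  then show False using assms openin_subset[of "top_of X" U] openin_subset[of "top_of X" V] by blast
qed

lemma eventually_generic:
  "eventually Q generic \<longleftrightarrow> (\<exists>U. op U \<and> U \<noteq> {} \<and> (\<forall>x\<in>U. Q x))"
proof -
  have "eventually Q generic \<longleftrightarrow> (\<exists>U\<in>{U. op U \<and> U \<noteq> {}}. eventually Q (principal U))"
    unfolding generic_def
  proof (rule eventually_INF_base)
    show "{U. op U \<and> U \<noteq> {}} \<noteq> {}" using points_nonempty openin_topspace by blast
    fix U V assume "U \<in> {U. op U \<and> U \<noteq> {}}" "V \<in> {U. op U \<and> U \<noteq> {}}"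
    then show "\<exists>W\<in>{U. op U \<and> U \<noteq> {}}. principal W \<le> inf (principal U) (principal V)"
      using open_meet by (intro bexI[of _ "U \<inter> V"]) auto
  qed
  then show ?thesis by (auto simp: eventually_principal)
qed

lemma gen_eq_iff: "gen_eq X f g \<longleftrightarrow> eventually (\<lambda>x. f x = g x) generic"
  by (simp add: gen_eq_def eventually_generic)

lemma generic_not_bot: "generic \<noteq> bot"
  unfolding trivial_limit_def eventually_generic by blast

lemma eventually_near:
  "P \<in> points X \<Longrightarrow> eventually Q (near P) \<longleftrightarrow> (\<exists>U. op U \<and> P \<in> U \<and> (\<forall>x\<in>U. Q x))"
  by (auto simp: eventually_nhdsin)

lemma eventually_nearI: "op U \<Longrightarrow> P \<in> U \<Longrightarrow> (\<And>x. x \<in> U \<Longrightarrow> Q x) \<Longrightarrow> eventually Q (near P)"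
  using eventually_near[of P Q] openin_subset[of "top_of X" U] by blast

lemma near_imp_generic: "P \<in> points X \<Longrightarrow> eventually Q (near P) \<Longrightarrow> eventually Q generic"
  unfolding eventually_near eventually_generic by blast

lemma near_imp_at: "P \<in> points X \<Longrightarrow> eventually Q (near P) \<Longrightarrow> Q P"
  unfolding eventually_near by blast

lemma generic_openI: "op U \<Longrightarrow> U \<noteq> {} \<Longrightarrow> eventually (\<lambda>x. x \<in> U) generic"
  unfolding eventually_generic by blast

lemma eventually_near_near:
  assumes "P \<in> points X" "eventually Q (near P)"
  shows "eventually (\<lambda>R. R \<in> points X \<and> eventually Q (near R)) (near P)"
proof -
  obtain U where U: "op U" "P \<in> U" "\<forall>x\<in>U. Q x" using assms eventually_near by blast
  show ?thesis
  proof (rule eventually_nearI[OF U(1,2)])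
    fix x assume x: "x \<in> U"
    then have "x \<in> points X" using openin_subset[OF U(1)] by blast
    then show "x \<in> points X \<and> eventually Q (near x)" using U x eventually_near by blast
  qed
qed

lemma eventually_generic_near:
  assumes "eventually Q generic"
  shows "eventually (\<lambda>R. R \<in> points X \<and> eventually Q (near R)) generic"
proof -
  obtain U where U: "op U" "U \<noteq> {}" "\<forall>x\<in>U. Q x" using assms eventually_generic by blast
  have "R \<in> points X \<and> eventually Q (near R)" if "R \<in> U" for R
    using that U openin_subset[OF U(1)] eventually_near by blast
  then show ?thesis using U eventually_generic by blast
qed

subsection \<open>The ring operations\<close>

lemma reg_cong: "op U \<Longrightarrow> f \<in> regular_on X U \<Longrightarrow> (\<And>x. x \<in> U \<Longrightarrow> g x = f x) \<Longrightarrow> g \<in> regular_on X U"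
  by (rule sheaf_cong[OF sh])

lemma reg_restrict: "op U \<Longrightarrow> op V \<Longrightarrow> V \<subseteq> U \<Longrightarrow> f \<in> regular_on X U \<Longrightarrow> f \<in> regular_on X V"
  by (rule sheaf_restrict[OF sh])

lemmas reg_const = sheaf_ring(1)[OF sh] and reg_add = sheaf_ring(2)[OF sh]
  and reg_mult = sheaf_ring(3)[OF sh]

lemma reg_uminus: "op U \<Longrightarrow> f \<in> regular_on X U \<Longrightarrow> (\<lambda>x. - f x) \<in> regular_on X U"
  using reg_mult[OF _ reg_const, of U f "-1"] by simp

lemma reg_diff:
  "op U \<Longrightarrow> f \<in> regular_on X U \<Longrightarrow> g \<in> regular_on X U \<Longrightarrow> (\<lambda>x. f x - g x) \<in> regular_on X U"
  using reg_add[OF _ _ reg_uminus, of U f g] by simp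

lemma reg_local_fraction:
  assumes "op V" "f \<in> regular_on X V" "x \<in> V"
  shows "\<exists>U n \<phi> W F G. chart X U n \<phi> \<and> op W \<and> x \<in> W \<and> W \<subseteq> V \<and> W \<subseteq> U \<and> F \<in> poly_funs n \<and> G \<in> poly_funs n \<and>
    (\<forall>y\<in>W. G (\<phi> y) \<noteq> 0 \<and> f y = F (\<phi> y) / G (\<phi> y))"
proof -
  have "x \<in> points X" using assms(1,3) openin_subset by blast
  from prevariety_chart[OF prevar this]
  obtain U n \<phi> where U: "x \<in> U" "chart X U n \<phi>" by blast
  note c = chartD[OF U(2)]
  have o: "op (V \<inter> U)" using assms(1) c(1) by blast
  have "f \<in> regular_on X (V \<inter> U)" by (rule reg_restrict[OF assms(1) o _ assms(2)]) simp
  from chartE[OF U(2) o _ this, of x]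
  obtain W F G where "op W" "x \<in> W" "W \<subseteq> V \<inter> U" "F \<in> poly_funs n" "G \<in> poly_funs n"
    "\<And>y. y \<in> W \<Longrightarrow> G (\<phi> y) \<noteq> 0" "\<And>y. y \<in> W \<Longrightarrow> f y = F (\<phi> y) / G (\<phi> y)"
    using assms(3) U(1) by (metis IntI inf_le2)
  then show ?thesis using U(2) by (intro exI[of _ U] exI[of _ n] exI[of _ \<phi>] exI[of _ W] exI[of _ F] exI[of _ G]) auto
qed

lemma reg_nonvanishing_open:
  assumes "op V" "f \<in> regular_on X V"
  shows "op {x \<in> V. f x \<noteq> 0}"
proof (subst openin_subopen, rule ballI)
  fix x assume "x \<in> {x \<in> V. f x \<noteq> 0}"
  then have x: "x \<in> V" "f x \<noteq> 0" by auto
  obtain U n \<phi> W F G where *: "chart X U n \<phi>" "op W" "x \<in> W" "W \<subseteq> V" "W \<subseteq> U" "F \<in> poly_funs n" "G \<in> poly_funs n"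
    "\<forall>y\<in>W. G (\<phi> y) \<noteq> 0 \<and> f y = F (\<phi> y) / G (\<phi> y)"
    using reg_local_fraction[OF assms x(1)] by blast
  have "op (W \<inter> {x \<in> U. F (\<phi> x) \<noteq> 0})" using chartD(4)[OF *(1,6)] *(2) by blast
  then show "\<exists>T. op T \<and> x \<in> T \<and> T \<subseteq> {x \<in> V. f x \<noteq> 0}"
    by (rule_tac exI[of _ "W \<inter> {x \<in> U. F (\<phi> x) \<noteq> 0}"]) (use * x in auto)
qed

lemma reg_inverse:
  assumes "op V" "f \<in> regular_on X V" "\<And>x. x \<in> V \<Longrightarrow> f x \<noteq> 0"
  shows "(\<lambda>x. inverse (f x)) \<in> regular_on X V"
proof (rule sheaf_glue[OF sh])
  fix x assume x: "x \<in> V"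
  obtain U n \<phi> W F G where *: "chart X U n \<phi>" "op W" "x \<in> W" "W \<subseteq> V" "W \<subseteq> U" "F \<in> poly_funs n" "G \<in> poly_funs n"
    "\<forall>y\<in>W. G (\<phi> y) \<noteq> 0 \<and> f y = F (\<phi> y) / G (\<phi> y)"
    using reg_local_fraction[OF assms(1,2) x(1)] by blast
  have nz: "F (\<phi> y) \<noteq> 0" if "y \<in> W" for y using that *(4,8) assms(3)[of y] by auto
  have "(\<lambda>x. G (\<phi> x) / F (\<phi> x)) \<in> regular_on X W"
    by (rule chartD(5)[OF *(1,2,5,7,6)]) (rule nz)
  then have "(\<lambda>x. inverse (f x)) \<in> regular_on X W"
    by (rule reg_cong[OF *(2)]) (use *(8) in auto)
  then show "\<exists>W. op W \<and> x \<in> W \<and> W \<subseteq> V \<and> (\<lambda>x. inverse (f x)) \<in> regular_on X W" using * by blast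
qed

text \<open>A regular function vanishes on a closed set, and nonempty open sets are dense.\<close>

lemma reg_eqI:
  assumes "op U" "f \<in> regular_on X U" "g \<in> regular_on X U" "gen_eq X f g" "x \<in> U"
  shows "f x = g x"
proof (rule ccontr)
  assume ne: "f x \<noteq> g x"
  have "op {x \<in> U. f x - g x \<noteq> 0}" by (intro reg_nonvanishing_open reg_diff assms(1-3))
  then have "eventually (\<lambda>x. x \<in> {x \<in> U. f x - g x \<noteq> 0}) generic"
    by (rule generic_openI) (use ne assms(5) in auto)
  then have "eventually (\<lambda>x. False) generic"
    using assms(4) unfolding gen_eq_iff by eventually_elim auto
  then show False using generic_not_bot by (simp add: trivial_limit_def)
qed

lemma reg_generic_nonzero:
  assumes "op U" "f \<in> regular_on X U" "U \<noteq> {}" "\<not> gen_eq X f (\<lambda>_. 0)"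
  shows "eventually (\<lambda>x. f x \<noteq> 0) generic"
proof -
  have "{x \<in> U. f x \<noteq> 0} \<noteq> {}" using assms unfolding gen_eq_def by auto
  from generic_openI[OF reg_nonvanishing_open[OF assms(1,2)] this] show ?thesis
    by eventually_elim simp
qed

subsection \<open>The local rings\<close>

lemma regular_atI: "op U \<Longrightarrow> P \<in> U \<Longrightarrow> f \<in> regular_on X U \<Longrightarrow> f \<in> \<O> P"
  by (auto simp: regular_at_def)

lemma regular_atE:
  assumes "f \<in> \<O> P"
  obtains U where "op U" "P \<in> U" "f \<in> regular_on X U"
  using assms by (auto simp: regular_at_def)

lemma regular_at2E:
  assumes "f \<in> \<O> P" "g \<in> \<O> P"
  obtains U where "op U" "P \<in> U" "f \<in> regular_on X U" "g \<in> regular_on X U"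
proof -
  obtain U where U: "op U" "P \<in> U" "f \<in> regular_on X U" using assms(1) by (rule regular_atE)
  obtain V where V: "op V" "P \<in> V" "g \<in> regular_on X V" using assms(2) by (rule regular_atE)
  have o: "op (U \<inter> V)" using U(1) V(1) by blast
  show ?thesis
    by (rule that[OF o]) (use U V reg_restrict[OF U(1) o] reg_restrict[OF V(1) o] in auto)
qed

lemma regular_at_point: "f \<in> \<O> P \<Longrightarrow> P \<in> points X"
  using openin_subset by (fastforce simp: regular_at_def)

lemma regular_at_near_regular:
  assumes "f \<in> \<O> P"
  shows "eventually (\<lambda>Q. f \<in> \<O> Q) (near P)"
proof -
  obtain U where U: "op U" "P \<in> U" "f \<in> regular_on X U" using assms(1) by (rule regular_atE)
  show ?thesis by (rule eventually_nearI[OF U(1,2)]) (rule regular_atI[OF U(1) _ U(3)])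
qed

lemma regular_at_near_cong:
  assumes "f \<in> \<O> P" "eventually (\<lambda>x. g x = f x) (near P)"
  shows "g \<in> \<O> P"
proof -
  obtain U where U: "op U" "P \<in> U" "f \<in> regular_on X U" using assms(1) by (rule regular_atE)
  obtain V where V: "op V" "P \<in> V" "\<forall>x\<in>V. g x = f x"
    using assms(2) eventually_near[OF regular_at_point[OF assms(1)]] by blast
  have o: "op (U \<inter> V)" using U(1) V(1) by blast
  have "g \<in> regular_on X (U \<inter> V)"
    by (rule reg_cong[OF o reg_restrict[OF U(1) o _ U(3)]]) (use V in auto)
  then show ?thesis using o U V by (intro regular_atI[of "U \<inter> V"]) auto
qed

lemma reg_of_at:
  assumes "op V" "\<And>Q. Q \<in> V \<Longrightarrow> f \<in> \<O> Q"
  shows "f \<in> regular_on X V"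
proof (rule sheaf_glue[OF sh])
  fix Q assume Q: "Q \<in> V"
  obtain U where U: "op U" "Q \<in> U" "f \<in> regular_on X U" using assms(2)[OF Q] by (rule regular_atE)
  have o: "op (U \<inter> V)" using U(1) assms(1) by blast
  show "\<exists>W. op W \<and> Q \<in> W \<and> W \<subseteq> V \<and> f \<in> regular_on X W"
    by (rule exI[of _ "U \<inter> V"]) (use o U Q reg_restrict[OF U(1) o _ U(3)] in auto)
qed

lemma at_const: "P \<in> points X \<Longrightarrow> (\<lambda>_. c) \<in> \<O> P"
  using reg_const[OF openin_topspace] regular_atI[OF openin_topspace] by blast

lemma at_add: "f \<in> \<O> P \<Longrightarrow> g \<in> \<O> P \<Longrightarrow> (\<lambda>x. f x + g x) \<in> \<O> P"
  by (erule (1) regular_at2E) (blast intro: regular_atI reg_add)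

lemma at_mult: "f \<in> \<O> P \<Longrightarrow> g \<in> \<O> P \<Longrightarrow> (\<lambda>x. f x * g x) \<in> \<O> P"
  by (erule (1) regular_at2E) (blast intro: regular_atI reg_mult)

lemma at_diff: "f \<in> \<O> P \<Longrightarrow> g \<in> \<O> P \<Longrightarrow> (\<lambda>x. f x - g x) \<in> \<O> P"
  by (erule (1) regular_at2E) (blast intro: regular_atI reg_diff)

lemma at_cmult: "f \<in> \<O> P \<Longrightarrow> (\<lambda>x. c * f x) \<in> \<O> P"
  using at_mult[OF at_const] regular_at_point by blast

lemma at_sum:
  assumes "P \<in> points X" "\<And>i. i \<in> I \<Longrightarrow> f i \<in> \<O> P"
  shows "(\<lambda>x. \<Sum>i\<in>I. f i x) \<in> \<O> P"
  using assms(2)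
  by (induction I rule: infinite_finite_induct) (auto intro: at_add at_const[OF assms(1)])

lemma at_power: "f \<in> \<O> P \<Longrightarrow> (\<lambda>x. f x ^ n) \<in> \<O> P"
  by (induction n) (auto intro: at_mult at_const regular_at_point)

lemma at_inverse:
  assumes "f \<in> \<O> P" "f P \<noteq> 0"
  shows "(\<lambda>x. inverse (f x)) \<in> \<O> P"
proof -
  obtain U where U: "op U" "P \<in> U" "f \<in> regular_on X U" using assms(1) by (rule regular_atE)
  note o = reg_nonvanishing_open[OF U(1,3)]
  have "f \<in> regular_on X {x \<in> U. f x \<noteq> 0}" by (rule reg_restrict[OF U(1) o _ U(3)]) auto
  then have "(\<lambda>x. inverse (f x)) \<in> regular_on X {x \<in> U. f x \<noteq> 0}" by (intro reg_inverse o) auto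
  then show ?thesis by (rule regular_atI[OF o, rotated]) (use U assms in auto)
qed

lemma at_powi:
  assumes "f \<in> \<O> P" "f P \<noteq> 0"
  shows "(\<lambda>x. f x powi n) \<in> \<O> P"
proof (cases "n \<ge> 0")
  case True
  then show ?thesis using at_power[OF assms(1), of "nat n"] by (simp add: power_int_def)
next
  case False
  then show ?thesis using at_power[OF at_inverse[OF assms], of "nat (- n)"] by (simp add: power_int_def)
qed

lemma at_near_nonzero:
  assumes "f \<in> \<O> P" "f P \<noteq> 0"
  shows "eventually (\<lambda>x. f x \<noteq> 0) (near P)"
proof -
  obtain U where U: "op U" "P \<in> U" "f \<in> regular_on X U" using assms(1) by (rule regular_atE)
  show ?thesis
    by (rule eventually_nearI[OF reg_nonvanishing_open[OF U(1,3)]]) (use U assms in auto)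
qed

lemma at_generic_nonzero:
  assumes "f \<in> \<O> P" "\<not> gen_eq X f (\<lambda>_. 0)"
  shows "eventually (\<lambda>x. f x \<noteq> 0) generic"
  using assms(1) by (rule regular_atE) (rule reg_generic_nonzero[OF _ _ _ assms(2)], auto)

lemma gen_eq_imp_near:
  assumes "f \<in> \<O> P" "g \<in> \<O> P" "gen_eq X f g"
  shows "eventually (\<lambda>x. f x = g x) (near P)"
proof -
  obtain U where U: "op U" "P \<in> U" "f \<in> regular_on X U" "g \<in> regular_on X U"
    using assms(1,2) by (rule regular_at2E)
  show ?thesis by (rule eventually_nearI[OF U(1,2)]) (rule reg_eqI[OF U(1,3,4) assms(3)])
qed

lemma gen_eq_imp_at:
  assumes "f \<in> \<O> P" "g \<in> \<O> P" "gen_eq X f g"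
  shows "f P = g P"
  by (rule near_imp_at[OF regular_at_point[OF assms(1)] gen_eq_imp_near[OF assms]])

lemma at_chart_poly: "chart X U n \<phi> \<Longrightarrow> F \<in> poly_funs n \<Longrightarrow> Q \<in> U \<Longrightarrow> (\<lambda>x. F (\<phi> x)) \<in> \<O> Q"
  using chartD(1,6) regular_atI by blast

lemma at_chart_fraction:
  assumes c: "chart X U n \<phi>" and P: "P \<in> U" and f: "f \<in> \<O> P"
  obtains F G where "F \<in> poly_funs n" "G \<in> poly_funs n" "G (\<phi> P) \<noteq> 0"
    "eventually (\<lambda>x. x \<in> U \<and> G (\<phi> x) \<noteq> 0 \<and> f x = F (\<phi> x) / G (\<phi> x)) (near P)"
proof -
  obtain V where V: "op V" "P \<in> V" "f \<in> regular_on X V" using f by (rule regular_atE)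
  have o: "op (V \<inter> U)" using V chartD(1)[OF c] by blast
  have "f \<in> regular_on X (V \<inter> U)" by (rule reg_restrict[OF V(1) o _ V(3)]) auto
  from chartE[OF c o _ this, of P]
  obtain W F G where W: "op W" "P \<in> W" "W \<subseteq> V \<inter> U" and F: "F \<in> poly_funs n" and G: "G \<in> poly_funs n"
    and nz: "\<And>y. y \<in> W \<Longrightarrow> G (\<phi> y) \<noteq> 0" and eq: "\<And>y. y \<in> W \<Longrightarrow> f y = F (\<phi> y) / G (\<phi> y)"
    using V P by (metis IntI inf_le2)
  show ?thesis
    by (rule that[OF F G nz[OF W(2)]], rule eventually_nearI[OF W(1,2)]) (use W nz eq in auto)
qed

text \<open>
  This replaces Nakayama's lemma. A matrix \<open>1 - S\<close>, where the entries of \<open>S\<close> vanish at \<open>P\<close>, is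
  invertible near \<open>P\<close>, so the system \<open>w = a \<tau> + S w\<close> determines \<open>w\<close> as a regular multiple of \<open>\<tau>\<close>.
  The inverse is found by eliminating one unknown at a time, dividing by a diagonal entry with value
  \<open>1\<close> at \<open>P\<close>. The unknowns are numbers attached to a single point \<open>Q\<close>, because in one application
  they are the values of a tangent vector, whose regular dependence on \<open>Q\<close> is yet to be shown.
\<close>

lemma solve_near:
  fixes m n :: nat
  assumes "P \<in> points X" "m \<le> n"
    and "\<And>i. i < n \<Longrightarrow> a i \<in> \<O> P" "\<And>i j. i < n \<Longrightarrow> j < m \<Longrightarrow> s i j \<in> \<O> P"
    and "\<And>i j. i < n \<Longrightarrow> j < m \<Longrightarrow> s i j P = 0"
  shows "\<exists>h. (\<forall>i<n. h i \<in> \<O> P) \<and>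
    eventually (\<lambda>Q. \<forall>w \<tau>. (\<forall>i<n. w i = a i Q * \<tau> + (\<Sum>j<m. s i j Q * w j)) \<longrightarrow> (\<forall>i<n. w i = h i Q * \<tau>)) (near P)"
  using assms(2-)
proof (induction m arbitrary: a s)
  case 0
  then show ?case by (intro exI[of _ a]) auto
next
  case (Suc m)
  define e where "e = (\<lambda>x. inverse (1 - s m m x))"
  define a' where "a' i = (\<lambda>x. a i x + s i m x * (e x * a m x))" for i
  define s' where "s' i j = (\<lambda>x. s i j x + s i m x * (e x * s m j x))" for i j
  have m: "m < n" using Suc.prems(1) by simp
  have d: "(\<lambda>x. 1 - s m m x) \<in> \<O> P" "1 - s m m P \<noteq> 0"
    using Suc.prems m by (auto intro!: at_diff at_const[OF assms(1)])
  have e: "e \<in> \<O> P" unfolding e_def using d by (rule at_inverse)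
  have "\<exists>h. (\<forall>i<n. h i \<in> \<O> P) \<and>
    eventually (\<lambda>Q. \<forall>w \<tau>. (\<forall>i<n. w i = a' i Q * \<tau> + (\<Sum>j<m. s' i j Q * w j)) \<longrightarrow> (\<forall>i<n. w i = h i Q * \<tau>)) (near P)"
  proof (rule Suc.IH)
    show "m \<le> n" using m by simp
    show "a' i \<in> \<O> P" if "i < n" for i
      unfolding a'_def using that m Suc.prems by (intro at_add at_mult e) auto
    show "s' i j \<in> \<O> P" if "i < n" "j < m" for i j
      unfolding s'_def using that m Suc.prems by (intro at_add at_mult e) auto
    show "s' i j P = 0" if "i < n" "j < m" for i j
      unfolding s'_def using that m Suc.prems(4) by simp
  qed
  then obtain h where h: "\<forall>i<n. h i \<in> \<O> P"
    "eventually (\<lambda>Q. \<forall>w \<tau>. (\<forall>i<n. w i = a' i Q * \<tau> + (\<Sum>j<m. s' i j Q * w j)) \<longrightarrow> (\<forall>i<n. w i = h i Q * \<tau>)) (near P)"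
    by blast
  show ?case
  proof (intro exI[of _ h] conjI h(1))
    show "eventually (\<lambda>Q. \<forall>w \<tau>. (\<forall>i<n. w i = a i Q * \<tau> + (\<Sum>j<Suc m. s i j Q * w j)) \<longrightarrow>
        (\<forall>i<n. w i = h i Q * \<tau>)) (near P)"
      using h(2) at_near_nonzero[OF d]
    proof eventually_elim
      case (elim Q)
      show ?case
      proof (intro allI impI)
        fix w \<tau> i
        assume w: "\<forall>i<n. w i = a i Q * \<tau> + (\<Sum>j<Suc m. s i j Q * w j)" and i: "i < n"
        have "w m * (1 - s m m Q) = a m Q * \<tau> + (\<Sum>j<m. s m j Q * w j)"
          using w[rule_format, OF m] by (simp add: algebra_simps)
        then have wm: "w m = e Q * (a m Q * \<tau> + (\<Sum>j<m. s m j Q * w j))"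
          using elim(2) by (simp add: e_def field_simps)
        have "w i = a' i Q * \<tau> + (\<Sum>j<m. s' i j Q * w j)" if "i < n" for i
        proof -
          have "w i = a i Q * \<tau> + (\<Sum>j<m. s i j Q * w j) + s i m Q * w m"
            using w[rule_format, OF that] by simp
          also have "\<dots> = a' i Q * \<tau> + (\<Sum>j<m. s' i j Q * w j)"
            unfolding wm a'_def s'_def by (simp add: algebra_simps sum.distrib sum_distrib_left)
          finally show ?thesis .
        qed
        then show "w i = h i Q * \<tau>" using elim(1) i by blast
      qed
    qed
  qed
qed

subsection \<open>Tangent vectors\<close>

lemma tangentD:
  assumes "v \<in> tangent_space X P"
  shows "f \<notin> \<O> P \<Longrightarrow> v f = 0"
    "f \<in> \<O> P \<Longrightarrow> v (\<lambda>x. c * f x) = c * v f"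
    "f \<in> \<O> P \<Longrightarrow> g \<in> \<O> P \<Longrightarrow> v (\<lambda>x. f x + g x) = v f + v g"
    "f \<in> \<O> P \<Longrightarrow> g \<in> \<O> P \<Longrightarrow> v (\<lambda>x. f x * g x) = f P * v g + g P * v f"
  using assms by (auto simp: tangent_space_def)

lemma tangent_const:
  assumes v: "v \<in> tangent_space X P" and P: "P \<in> points X"
  shows "v (\<lambda>_. c) = 0"
proof -
  have "v (\<lambda>x. 1 * 1) = 1 * v (\<lambda>_. 1) + 1 * v (\<lambda>_. 1)"
    using tangentD(4)[OF v at_const[OF P] at_const[OF P], of 1 1] by simp
  then have "v (\<lambda>_. 1) = v (\<lambda>_. 1) + v (\<lambda>_. 1)" by (simp only: mult_1_left)
  then have "v (\<lambda>_. 1) = 0" by (metis add_cancel_right_right)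
  then show ?thesis using tangentD(2)[OF v at_const[OF P], of c 1] by simp
qed

lemma tangent_diff:
  assumes v: "v \<in> tangent_space X P" and "f \<in> \<O> P" "g \<in> \<O> P"
  shows "v (\<lambda>x. f x - g x) = v f - v g"
  using tangentD(3)[OF v assms(2) at_cmult[OF assms(3)], of "-1"] tangentD(2)[OF v assms(3), of "-1"]
  by simp

text \<open>
  The function which is \<open>0\<close> near \<open>P\<close> and \<open>1\<close> elsewhere is regular at \<open>P\<close>, and multiplication by it
  does not change \<open>f - g\<close>, so the product rule gives \<open>v (f - g) = 0\<close>.
\<close>

lemma tangent_near_cong:
  assumes v: "v \<in> tangent_space X P" and f: "f \<in> \<O> P" and g: "g \<in> \<O> P"
    and eq: "eventually (\<lambda>x. f x = g x) (near P)"
  shows "v f = v g"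
proof -
  have P: "P \<in> points X" using regular_at_point[OF f] .
  obtain U where U: "op U" "P \<in> U" "\<forall>x\<in>U. f x = g x" using eq eventually_near[OF P] by blast
  define \<chi> :: "'a \<Rightarrow> 'k" where "\<chi> x = (if x \<in> U then 0 else 1)" for x
  have \<chi>: "\<chi> \<in> \<O> P"
    by (rule regular_atI[OF U(1,2) reg_cong[OF U(1) reg_const[OF U(1), of 0]]]) (simp add: \<chi>_def)
  have "v (\<lambda>x. \<chi> x * (f x - g x)) = \<chi> P * v (\<lambda>x. f x - g x) + (f P - g P) * v \<chi>"
    using tangentD(4)[OF v \<chi> at_diff[OF f g]] .
  also have "\<dots> = 0" using U by (simp add: \<chi>_def)
  also have "(\<lambda>x. \<chi> x * (f x - g x)) = (\<lambda>x. f x - g x)" using U(3) by (auto simp: \<chi>_def)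
  finally show ?thesis using tangent_diff[OF v f g] by simp
qed

lemma tangent_poly:
  assumes "chart X U n \<phi>" "F \<in> poly_funs n"
  shows "\<exists>D. (\<forall>i<n. D i \<in> poly_funs n) \<and>
    (\<forall>Q\<in>U. \<forall>v\<in>tangent_space X Q. v (\<lambda>x. F (\<phi> x)) = (\<Sum>i<n. D i (\<phi> Q) * v (\<lambda>x. \<phi> x i)))"
proof -
  have pt: "Q \<in> points X" if "Q \<in> U" for Q using chartD(1)[OF assms(1)] openin_subset that by blast
  have at: "(\<lambda>x. F (\<phi> x)) \<in> \<O> Q" if "F \<in> poly_funs n" "Q \<in> U" for F Q
    using chartD(1,6)[OF assms(1)] that regular_atI by blast
  show ?thesis using assms(2)
  proof induction
    case (const c)
    show ?case
      by (rule exI[of _ "\<lambda>_ _. 0"]) (auto intro: poly_funs.const simp: tangent_const[OF _ pt])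
  next
    case (coord i)
    show ?case
    proof (rule exI[of _ "\<lambda>j _. if j = i then 1 else 0"], intro conjI ballI allI impI)
      fix Q v assume "Q \<in> U" "v \<in> tangent_space X Q"
      have "(\<Sum>j<n. (if j = i then 1 else 0) * v (\<lambda>x. \<phi> x j)) = (\<Sum>j<n. if j = i then v (\<lambda>x. \<phi> x j) else 0)"
        by (intro sum.cong) auto
      then show "v (\<lambda>x. \<phi> x i) = (\<Sum>j<n. (if j = i then 1 else 0) * v (\<lambda>x. \<phi> x j))"
        using coord by (simp add: sum.delta)
    qed (rule poly_funs.const)
  next
    case (add F G)
    then obtain D E where D: "\<forall>i<n. D i \<in> poly_funs n"
        "\<forall>Q\<in>U. \<forall>v\<in>tangent_space X Q. v (\<lambda>x. F (\<phi> x)) = (\<Sum>i<n. D i (\<phi> Q) * v (\<lambda>x. \<phi> x i))"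
      and E: "\<forall>i<n. E i \<in> poly_funs n"
        "\<forall>Q\<in>U. \<forall>v\<in>tangent_space X Q. v (\<lambda>x. G (\<phi> x)) = (\<Sum>i<n. E i (\<phi> Q) * v (\<lambda>x. \<phi> x i))" by blast
    show ?case
    proof (rule exI[of _ "\<lambda>i a. D i a + E i a"], intro conjI ballI allI impI)
      fix Q v assume *: "Q \<in> U" "v \<in> tangent_space X Q"
      show "v (\<lambda>x. F (\<phi> x) + G (\<phi> x)) = (\<Sum>i<n. (D i (\<phi> Q) + E i (\<phi> Q)) * v (\<lambda>x. \<phi> x i))"
        unfolding tangentD(3)[OF *(2) at[OF add.hyps(1) *(1)] at[OF add.hyps(2) *(1)]]
        using D(2) E(2) * by (simp add: sum.distrib distrib_right)
    qed (use D E in \<open>auto intro: poly_funs.add\<close>)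
  next
    case (mult F G)
    then obtain D E where D: "\<forall>i<n. D i \<in> poly_funs n"
        "\<forall>Q\<in>U. \<forall>v\<in>tangent_space X Q. v (\<lambda>x. F (\<phi> x)) = (\<Sum>i<n. D i (\<phi> Q) * v (\<lambda>x. \<phi> x i))"
      and E: "\<forall>i<n. E i \<in> poly_funs n"
        "\<forall>Q\<in>U. \<forall>v\<in>tangent_space X Q. v (\<lambda>x. G (\<phi> x)) = (\<Sum>i<n. E i (\<phi> Q) * v (\<lambda>x. \<phi> x i))" by blast
    show ?case
    proof (rule exI[of _ "\<lambda>i a. F a * E i a + G a * D i a"], intro conjI ballI allI impI)
      fix Q v assume *: "Q \<in> U" "v \<in> tangent_space X Q"
      show "v (\<lambda>x. F (\<phi> x) * G (\<phi> x)) =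
          (\<Sum>i<n. (F (\<phi> Q) * E i (\<phi> Q) + G (\<phi> Q) * D i (\<phi> Q)) * v (\<lambda>x. \<phi> x i))"
        unfolding tangentD(4)[OF *(2) at[OF mult.hyps(1) *(1)] at[OF mult.hyps(2) *(1)]]
          D(2)[rule_format, OF *] E(2)[rule_format, OF *]
        by (simp add: sum.distrib distrib_right sum_distrib_left mult.assoc)
    next
      show "(\<lambda>a. F a * E i a + G a * D i a) \<in> poly_funs n" if "i < n" for i
        by (intro poly_funs.add poly_funs.mult D(1)[rule_format] E(1)[rule_format] mult.hyps that)
    qed
  qed
qed

text \<open>
  By the quotient rule, the coefficients are themselves fractions in the coordinates. That they are
  regular, and the same for all points near \<open>P\<close>, is what later makes a vector field regular.
\<close>

lemma tangent_coordinates: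
  assumes c: "chart X U n \<phi>" and P: "P \<in> U" and f: "f \<in> \<O> P"
  shows "\<exists>d. (\<forall>i<n. d i \<in> \<O> P) \<and>
    eventually (\<lambda>Q. \<forall>v\<in>tangent_space X Q. v f = (\<Sum>i<n. d i Q * v (\<lambda>x. \<phi> x i))) (near P)"
proof -
  obtain F G where F: "F \<in> poly_funs n" and G: "G \<in> poly_funs n" and nz: "G (\<phi> P) \<noteq> 0"
    and eq: "eventually (\<lambda>x. x \<in> U \<and> G (\<phi> x) \<noteq> 0 \<and> f x = F (\<phi> x) / G (\<phi> x)) (near P)"
    using at_chart_fraction[OF c P f] .
  obtain D where D: "\<And>i. i < n \<Longrightarrow> D i \<in> poly_funs n"
    "\<And>Q v. Q \<in> U \<Longrightarrow> v \<in> tangent_space X Q \<Longrightarrow> v (\<lambda>x. F (\<phi> x)) = (\<Sum>i<n. D i (\<phi> Q) * v (\<lambda>x. \<phi> x i))"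
    using tangent_poly[OF c F] by blast
  obtain E where E: "\<And>i. i < n \<Longrightarrow> E i \<in> poly_funs n"
    "\<And>Q v. Q \<in> U \<Longrightarrow> v \<in> tangent_space X Q \<Longrightarrow> v (\<lambda>x. G (\<phi> x)) = (\<Sum>i<n. E i (\<phi> Q) * v (\<lambda>x. \<phi> x i))"
    using tangent_poly[OF c G] by blast
  note at' = at_chart_poly[OF c]
  define d where "d i = (\<lambda>x. (D i (\<phi> x) - f x * E i (\<phi> x)) * inverse (G (\<phi> x)))" for i
  have d: "d i \<in> \<O> P" if "i < n" for i
    unfolding d_def
    by (rule at_mult[OF at_diff[OF at'[OF D(1)[OF that] P] at_mult[OF f at'[OF E(1)[OF that] P]]]
          at_inverse[OF at'[OF G P] nz]])
  have "eventually (\<lambda>Q. \<forall>v\<in>tangent_space X Q. v f = (\<Sum>i<n. d i Q * v (\<lambda>x. \<phi> x i))) (near P)"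
    using eventually_near_near[OF regular_at_point[OF f] eq] eq regular_at_near_regular[OF f]
  proof eventually_elim
    case (elim Q)
    show ?case
    proof
      fix v assume v: "v \<in> tangent_space X Q"
      have Q: "Q \<in> U" and GQ: "G (\<phi> Q) \<noteq> 0" using elim(2) by auto
      have ev: "eventually (\<lambda>x. f x * G (\<phi> x) = F (\<phi> x)) (near Q)"
        using elim(1) by (auto elim: eventually_mono)
      have "v (\<lambda>x. f x * G (\<phi> x)) = v (\<lambda>x. F (\<phi> x))"
        by (rule tangent_near_cong[OF v at_mult[OF elim(3) at'[OF G Q]] at'[OF F Q] ev])
      then have "f Q * v (\<lambda>x. G (\<phi> x)) + G (\<phi> Q) * v f = v (\<lambda>x. F (\<phi> x))"
        using tangentD(4)[OF v elim(3) at'[OF G Q]] by simp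
      then have "v f = (v (\<lambda>x. F (\<phi> x)) - f Q * v (\<lambda>x. G (\<phi> x))) * inverse (G (\<phi> Q))"
        using GQ by (simp add: field_simps)
      also have "\<dots> = (\<Sum>i<n. d i Q * v (\<lambda>x. \<phi> x i))"
        unfolding D(2)[OF Q v] E(2)[OF Q v] d_def
        by (simp add: sum_distrib_left sum_distrib_right sum_subtractf algebra_simps)
      finally show "v f = (\<Sum>i<n. d i Q * v (\<lambda>x. \<phi> x i))" .
    qed
  qed
  then show ?thesis using d by (intro exI[of _ d]) simp
qed

text \<open>A Taylor expansion of first order, with the remainder absorbed into the coefficients.\<close>

lemma poly_funs_expand:
  fixes F :: "(nat \<Rightarrow> 'k) \<Rightarrow> 'k"
  assumes "F \<in> poly_funs n"
  shows "\<exists>D. (\<forall>i<n. D i \<in> poly_funs n) \<and> (\<forall>x. F x = F a + (\<Sum>i<n. (x i - a i) * D i x))"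
  using assms
proof induction
  case (const c)
  show ?case by (rule exI[of _ "\<lambda>_ _. 0"]) (auto intro: poly_funs.const)
next
  case (coord i)
  show ?case
  proof (rule exI[of _ "\<lambda>j _. if j = i then 1 else 0"], intro conjI allI impI)
    fix x
    have "(\<Sum>j<n. (x j - a j) * (if j = i then 1 else 0)) = (\<Sum>j<n. if j = i then x j - a j else 0)"
      by (intro sum.cong) auto
    then show "x i = a i + (\<Sum>j<n. (x j - a j) * (if j = i then 1 else 0))"
      using coord by (simp add: sum.delta)
  qed (rule poly_funs.const)
next
  case (add F G)
  then obtain D E where D: "\<forall>i<n. D i \<in> poly_funs n" "\<forall>x. F x = F a + (\<Sum>i<n. (x i - a i) * D i x)"
    and E: "\<forall>i<n. E i \<in> poly_funs n" "\<forall>x. G x = G a + (\<Sum>i<n. (x i - a i) * E i x)" by blast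
  show ?case
  proof (rule exI[of _ "\<lambda>i x. D i x + E i x"], intro conjI allI impI)
    fix x
    show "F x + G x = F a + G a + (\<Sum>i<n. (x i - a i) * (D i x + E i x))"
      using D(2)[rule_format, of x] E(2)[rule_format, of x] by (simp add: sum.distrib distrib_left)
  qed (use D E in \<open>auto intro: poly_funs.add\<close>)
next
  case (mult F G)
  then obtain D E where D: "\<forall>i<n. D i \<in> poly_funs n" "\<forall>x. F x = F a + (\<Sum>i<n. (x i - a i) * D i x)"
    and E: "\<forall>i<n. E i \<in> poly_funs n" "\<forall>x. G x = G a + (\<Sum>i<n. (x i - a i) * E i x)" by blast
  show ?case
  proof (rule exI[of _ "\<lambda>i x. D i x * G x + F a * E i x"], intro conjI allI impI)
    fix x
    have "F a * G a + (\<Sum>i<n. (x i - a i) * (D i x * G x + F a * E i x)) =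
        F a * (G a + (\<Sum>i<n. (x i - a i) * E i x)) + (\<Sum>i<n. (x i - a i) * D i x) * G x"
      by (simp add: sum.distrib sum_subtractf algebra_simps sum_distrib_left sum_distrib_right)
    also have "\<dots> = F a * G x + (F x - F a) * G x"
      using D(2)[rule_format, of x] E(2)[rule_format, of x] by (simp add: algebra_simps)
    also have "\<dots> = F x * G x" by (simp add: algebra_simps)
    finally show "F x * G x = F a * G a + (\<Sum>i<n. (x i - a i) * (D i x * G x + F a * E i x))" by simp
  next
    show "(\<lambda>x. D i x * G x + F a * E i x) \<in> poly_funs n" if "i < n" for i
      by (intro poly_funs.add poly_funs.mult poly_funs.const D(1)[rule_format] E(1)[rule_format] mult.hyps that)
  qed
qed

lemma maximal_ideal_generators:
  assumes c: "chart X U n \<phi>" and P: "P \<in> U" and f: "f \<in> \<O> P" "f P = 0"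
  shows "\<exists>q. (\<forall>i<n. q i \<in> \<O> P) \<and>
    eventually (\<lambda>x. f x = (\<Sum>i<n. q i x * (\<phi> x i - \<phi> P i))) (near P)"
proof -
  obtain F G where F: "F \<in> poly_funs n" and G: "G \<in> poly_funs n" and nz: "G (\<phi> P) \<noteq> 0"
    and eq: "eventually (\<lambda>x. x \<in> U \<and> G (\<phi> x) \<noteq> 0 \<and> f x = F (\<phi> x) / G (\<phi> x)) (near P)"
    using at_chart_fraction[OF c P f(1)] .
  obtain D where D: "\<And>i. i < n \<Longrightarrow> D i \<in> poly_funs n"
    "\<And>x. F x = F (\<phi> P) + (\<Sum>i<n. (x i - \<phi> P i) * D i x)"
    using poly_funs_expand[OF F, of "\<phi> P"] by blast
  have F0: "F (\<phi> P) = 0" using near_imp_at[OF regular_at_point[OF f(1)] eq] f(2) by auto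
  note at = at_chart_poly[OF c _ P]
  show ?thesis
  proof (rule exI[of _ "\<lambda>i x. D i (\<phi> x) * inverse (G (\<phi> x))"], intro conjI allI impI)
    show "(\<lambda>x. D i (\<phi> x) * inverse (G (\<phi> x))) \<in> \<O> P" if "i < n" for i
      using at[OF D(1)[OF that]] at_inverse[OF at[OF G] nz] by (rule at_mult)
    show "eventually (\<lambda>x. f x = (\<Sum>i<n. D i (\<phi> x) * inverse (G (\<phi> x)) * (\<phi> x i - \<phi> P i))) (near P)"
      using eq
    proof eventually_elim
      case (elim x)
      then show ?case
        using D(2)[of "\<phi> x"] F0 by (simp add: divide_inverse sum_distrib_left mult_ac)
    qed
  qed
qed

end


section \<open>Smooth curves: uniformizers and orders\<close>

locale smooth_curve = irreducible_prevariety X for X :: "('a, 'k::field) fun_space" +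
  assumes tangent_dim: "P \<in> points X \<Longrightarrow> fdim (tangent_space X P) = 1"
begin

lemma tangent_line:
  assumes P: "P \<in> points X"
  obtains v f where "v \<in> tangent_space X P" "f \<in> \<O> P" "v f \<noteq> 0"
    "\<And>w. w \<in> tangent_space X P \<Longrightarrow> \<exists>c. \<forall>g. w g = c * v g"
proof -
  interpret vs: vector_space "fun_scale :: 'k \<Rightarrow> (('a \<Rightarrow> 'k) \<Rightarrow> 'k) \<Rightarrow> ('a \<Rightarrow> 'k) \<Rightarrow> 'k"
    by (rule vector_space_fun_scale)
  obtain B where B: "B \<subseteq> tangent_space X P" "vs.independent B" "tangent_space X P \<subseteq> vs.span B"
    "card B = vs.dim (tangent_space X P)" by (rule vs.basis_exists)
  then have "card B = 1" using tangent_dim[OF P] by simp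
  then obtain v where v: "B = {v}" by (auto simp: card_1_singleton_iff)
  then have vT: "v \<in> tangent_space X P" using B by auto
  have "v \<noteq> 0" using B(2) v vs.dependent_zero by auto
  then obtain f where f: "v f \<noteq> 0" by (auto simp: fun_eq_iff)
  then have fP: "f \<in> \<O> P" using tangentD(1)[OF vT] by blast
  have "\<exists>c. \<forall>g. w g = c * v g" if "w \<in> tangent_space X P" for w
    using that B(3) v by (auto simp: vs.span_singleton)
  then show ?thesis by (rule that[OF vT fP f])
qed

text \<open>
  A linear form on the functions which vanishes on the constants and on the square of the maximal
  ideal is a tangent vector, and for a function in the maximal ideal but outside its square there is
  such a form which does not vanish on it.
\<close>

lemma tangent_separates:
  assumes P: "P \<in> points X" and v: "\<And>w. w \<in> tangent_space X P \<Longrightarrow> \<exists>c. \<forall>g. w g = c * v g"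
    and s: "s \<in> \<O> P" "s P = 0" "v s = 0"
  shows "\<exists>(m::nat) g h. (\<forall>i<m. g i \<in> \<O> P \<and> g i P = 0 \<and> h i \<in> \<O> P \<and> h i P = 0) \<and>
    (\<forall>x. s x = (\<Sum>i<m. g i x * h i x))"
proof (rule ccontr)
  assume neg: "\<not> ?thesis"
  \<comment> \<open>\<open>M\<close> consists of the sums of a constant and an element of the square of the maximal ideal.\<close>
  define M where "M = {f. \<exists>c (m::nat) g h.
     (\<forall>i<m. g i \<in> \<O> P \<and> g i P = 0 \<and> h i \<in> \<O> P \<and> h i P = 0) \<and>
     (\<forall>x. f x = c + (\<Sum>i<m. g i x * h i x))}"
  have MI: "f \<in> M" if "\<And>i. i < m \<Longrightarrow> g i \<in> \<O> P \<and> g i P = 0 \<and> h i \<in> \<O> P \<and> h i P = 0"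
    "\<And>x. f x = c + (\<Sum>i<m. g i x * h i x)" for f c g h and m :: nat
    unfolding M_def using that by blast
  interpret vs: vector_space "fun_scale :: 'k \<Rightarrow> ('a \<Rightarrow> 'k) \<Rightarrow> 'a \<Rightarrow> 'k"
    by (rule vector_space_fun_scale)
  interpret vp: vector_space_pair "fun_scale :: 'k \<Rightarrow> ('a \<Rightarrow> 'k) \<Rightarrow> 'a \<Rightarrow> 'k" "(*) :: 'k \<Rightarrow> 'k \<Rightarrow> 'k"
    by unfold_locales (auto simp: algebra_simps)
  have M_add: "(\<lambda>x. f x + f' x) \<in> M" if f: "f \<in> M" and f': "f' \<in> M" for f f'
  proof -
    obtain c g h and m :: nat where 1: "\<forall>i<m. g i \<in> \<O> P \<and> g i P = 0 \<and> h i \<in> \<O> P \<and> h i P = 0"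
      "\<forall>x. f x = c + (\<Sum>i<m. g i x * h i x)" using f unfolding M_def by blast
    obtain c' g' h' and m' :: nat where 2: "\<forall>i<m'. g' i \<in> \<O> P \<and> g' i P = 0 \<and> h' i \<in> \<O> P \<and> h' i P = 0"
      "\<forall>x. f' x = c' + (\<Sum>i<m'. g' i x * h' i x)" using f' unfolding M_def by blast
    have split: "(\<Sum>i<m + m'. F i) = (\<Sum>i<m. F i) + (\<Sum>i<m'. F (m + i))" for F :: "nat \<Rightarrow> 'k"
    proof -
      have "(\<Sum>i<m + m'. F i) = (\<Sum>i<m. F i) + (\<Sum>i\<in>{m..<m + m'}. F i)"
        by (metis atLeast0LessThan le_add1 sum.atLeastLessThan_concat zero_le)
      also have "(\<Sum>i\<in>{m..<m + m'}. F i) = (\<Sum>i<m'. F (m + i))"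
        using sum.shift_bounds_nat_ivl[of F 0 m m'] by (simp add: atLeast0LessThan add.commute)
      finally show ?thesis .
    qed
    show ?thesis
      by (rule MI[of "m + m'" "\<lambda>i. if i < m then g i else g' (i - m)" "\<lambda>i. if i < m then h i else h' (i - m)" _ "c + c'"])
        (use 1 2 in \<open>auto simp: split\<close>)
  qed
  have M_scale: "(\<lambda>x. a * f x) \<in> M" if f: "f \<in> M" for f a
  proof -
    obtain c g h and m :: nat where 1: "\<forall>i<m. g i \<in> \<O> P \<and> g i P = 0 \<and> h i \<in> \<O> P \<and> h i P = 0"
      "\<forall>x. f x = c + (\<Sum>i<m. g i x * h i x)" using f unfolding M_def by blast
    show ?thesis
      by (rule MI[of m "\<lambda>i x. a * g i x" h _ "a * c"])
        (use 1(1) in \<open>simp add: at_cmult\<close>, simp only: 1(2)[rule_format] distrib_left sum_distrib_left mult.assoc)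
  qed
  have M_const: "(\<lambda>_. c) \<in> M" for c by (rule MI[of 0 _ _ _ c]) auto
  have M_prod: "(\<lambda>x. g x * h x) \<in> M"
    if "g \<in> \<O> P" "g P = 0" "h \<in> \<O> P" "h P = 0" for g h
    by (rule MI[of 1 "\<lambda>_. g" "\<lambda>_. h" _ 0]) (use that in auto)
  have sub: "vs.subspace M"
    unfolding vs.subspace_def using M_const[of 0] M_add M_scale by (auto simp: zero_fun_def plus_fun_def)
  have "s \<notin> M"
  proof
    assume "s \<in> M"
    then obtain c g h and m :: nat where 1: "\<forall>i<m. g i \<in> \<O> P \<and> g i P = 0 \<and> h i \<in> \<O> P \<and> h i P = 0"
      "\<forall>x. s x = c + (\<Sum>i<m. g i x * h i x)" unfolding M_def by blast
    then have "c = 0" using s(2) by simp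
    then have "\<forall>x. s x = (\<Sum>i<m. g i x * h i x)" using 1(2) by simp
    with 1(1) neg show False by blast
  qed
  obtain B where B: "B \<subseteq> M" "vs.independent B" "M \<subseteq> vs.span B" by (rule vs.basis_exists)
  have spB: "vs.span B = M" using B sub by (metis vs.span_minimal subset_antisym)
  then have indep: "vs.independent (insert s B)" using \<open>s \<notin> M\<close> B(2) vs.independent_insertI by blast
  obtain l where lin: "Vector_Spaces.linear fun_scale (*) l"
    and lB: "\<forall>x\<in>insert s B. l x = (if x = s then 1 else 0 :: 'k)"
    using vp.linear_independent_extend[OF indep, of "\<lambda>x. if x = s then 1 else 0"] by blast
  have l_add: "l (\<lambda>x. f x + g x) = l f + l g" for f g
    using vp.linear_add[OF lin, of f g] by (simp add: plus_fun_def)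
  have l_scale: "l (\<lambda>x. c * f x) = c * l f" for f c
    using vp.linear_scale[OF lin, of c f] by simp
  have "l x = 0" if "x \<in> B" for x
    using lB that \<open>s \<notin> M\<close> B(1) by auto
  then have l_M: "l f = 0" if "f \<in> M" for f
    using vp.linear_eq_0_on_span[OF lin, of B f] that spB by blast
  define w where "w f = (if f \<in> \<O> P then l f else 0)" for f
  have "w \<in> tangent_space X P"
    unfolding tangent_space_def
  proof (intro CollectI conjI allI ballI impI)
    fix f assume "f \<notin> \<O> P" then show "w f = 0" by (simp add: w_def)
  next
    fix c f assume "f \<in> \<O> P"
    then show "w (\<lambda>x. c * f x) = c * w f" by (simp add: w_def at_cmult l_scale)
  next
    fix f g assume f: "f \<in> \<O> P" and g: "g \<in> \<O> P"
    show "w (\<lambda>x. f x + g x) = w f + w g" using f g by (simp add: w_def at_add l_add)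
    have "(\<lambda>x. (f x - f P) * (g x - g P)) \<in> M"
      by (rule M_prod) (auto intro!: at_diff f g at_const P)
    then have "0 = l (\<lambda>x. (f x - f P) * (g x - g P))" using l_M by simp
    also have "(\<lambda>x. (f x - f P) * (g x - g P)) =
        (\<lambda>x. (f x * g x + (- f P) * g x) + ((- g P) * f x + f P * g P))"
      by (auto simp: algebra_simps)
    also have "l \<dots> = (l (\<lambda>x. f x * g x) + (- f P) * l g) + ((- g P) * l f + l (\<lambda>_. f P * g P))"
      unfolding l_add l_scale ..
    also have "l (\<lambda>_. f P * g P) = 0" by (rule l_M[OF M_const])
    finally have "l (\<lambda>x. f x * g x) = f P * l g + g P * l f" by (simp add: algebra_simps)
    then show "w (\<lambda>x. f x * g x) = f P * w g + g P * w f" using f g by (simp add: w_def at_mult)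
  qed
  from v[OF this] have "w s = 0" using s(3) by auto
  moreover have "w s = 1" using lB s(1) by (simp add: w_def)
  ultimately show False by simp
qed

lemma uniformizerD:
  assumes "uniformizer X P t"
  shows "t \<in> \<O> P" "t P = 0" "P \<in> points X"
    "s \<in> \<O> P \<Longrightarrow> s P = 0 \<Longrightarrow> \<exists>h\<in>\<O> P. gen_eq X s (\<lambda>x. h x * t x)"
proof -
  show t: "t \<in> \<O> P" "t P = 0" using assms by (auto simp: uniformizer_def)
  then show "P \<in> points X" using regular_at_point by blast
  assume "s \<in> \<O> P" "s P = 0"
  then obtain h U where "h \<in> \<O> P" "op U" "P \<in> U" "\<forall>x\<in>U. s x = h x * t x"
    using assms unfolding uniformizer_def by meson
  then show "\<exists>h\<in>\<O> P. gen_eq X s (\<lambda>x. h x * t x)" unfolding gen_eq_def by blast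
qed

lemma uniformizerI:
  assumes "t \<in> \<O> P" "t P = 0"
    "\<And>s. s \<in> \<O> P \<Longrightarrow> s P = 0 \<Longrightarrow> \<exists>h\<in>\<O> P. gen_eq X s (\<lambda>x. h x * t x)"
  shows "uniformizer X P t"
  unfolding uniformizer_def
proof (intro conjI ballI impI assms(1,2))
  fix s assume s: "s \<in> \<O> P" "s P = 0"
  then obtain h where h: "h \<in> \<O> P" "gen_eq X s (\<lambda>x. h x * t x)" using assms(3) by blast
  have "eventually (\<lambda>x. s x = h x * t x) (near P)"
    by (rule gen_eq_imp_near[OF s(1) at_mult[OF h(1) assms(1)] h(2)])
  then show "\<exists>h\<in>\<O> P. \<exists>U. op U \<and> P \<in> U \<and> (\<forall>x\<in>U. s x = h x * t x)"
    using h(1) eventually_near[OF regular_at_point[OF s(1)]] by blast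
qed

text \<open>
  A function whose differential at \<open>P\<close> spans the cotangent space generates the maximal ideal: modulo
  its multiples, the generators of this ideal are combinations of themselves with coefficients in the
  maximal ideal, as in Nakayama's lemma.
\<close>

lemma uniformizer_exists:
  assumes P: "P \<in> points X"
  obtains t v where "uniformizer X P t" "v \<in> tangent_space X P" "v t = 1"
proof -
  obtain v f where v: "v \<in> tangent_space X P" and f: "f \<in> \<O> P" "v f \<noteq> 0"
    and span: "\<And>w. w \<in> tangent_space X P \<Longrightarrow> \<exists>c. \<forall>g. w g = c * v g"
    using tangent_line[OF P] by blast
  define t where "t x = inverse (v f) * (f x - f P)" for x
  have t: "t \<in> \<O> P" "t P = 0"
    unfolding t_def by (auto intro!: at_cmult at_diff f(1) at_const P)
  have vt: "v t = 1"
    unfolding t_def tangentD(2)[OF v at_diff[OF f(1) at_const[OF P]]] tangent_diff[OF v f(1) at_const[OF P]]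
    using f(2) by (simp add: tangent_const[OF v P])
  obtain U n \<phi> where U: "P \<in> U" "chart X U n \<phi>" using prevariety_chart[OF prevar P] by blast
  define y where "y i x = \<phi> x i - \<phi> P i" for i :: nat and x
  have y: "y i \<in> \<O> P" "y i P = 0" if "i < n" for i
    unfolding y_def using at_diff[OF at_chart_poly[OF U(2) poly_funs.coord[OF that] U(1)] at_const[OF P]] by auto
  have gen: "\<exists>q. (\<forall>j<n. q j \<in> \<O> P) \<and> eventually (\<lambda>x. g x = (\<Sum>j<n. q j x * y j x)) (near P)"
    if "g \<in> \<O> P" "g P = 0" for g
    using maximal_ideal_generators[OF U(2,1) that] unfolding y_def .
  have "\<exists>s. (\<forall>j<n. s j \<in> \<O> P \<and> s j P = 0) \<and>
      eventually (\<lambda>x. y i x = v (y i) * t x + (\<Sum>j<n. s j x * y j x)) (near P)" if i: "i < n" for i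
  proof -
    define z where "z x = y i x - v (y i) * t x" for x
    have z: "z \<in> \<O> P" "z P = 0"
      unfolding z_def using y[OF i] t by (auto intro: at_diff at_cmult)
    have "v z = 0"
      unfolding z_def tangent_diff[OF v y(1)[OF i] at_cmult[OF t(1)]] tangentD(2)[OF v t(1)] vt by simp
    from tangent_separates[OF P span z this] obtain g h and m :: nat
      where gh: "\<forall>l<m. g l \<in> \<O> P \<and> g l P = 0 \<and> h l \<in> \<O> P \<and> h l P = 0"
      and zx: "\<forall>x. z x = (\<Sum>l<m. g l x * h l x)" by blast
    have "\<forall>l. \<exists>q. l < m \<longrightarrow> (\<forall>j<n. q j \<in> \<O> P) \<and> eventually (\<lambda>x. g l x = (\<Sum>j<n. q j x * y j x)) (near P)"
      using gen gh by blast
    from choice[OF this] obtain q where q': "\<forall>l. l < m \<longrightarrow> (\<forall>j<n. q l j \<in> \<O> P) \<and>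
      eventually (\<lambda>x. g l x = (\<Sum>j<n. q l j x * y j x)) (near P)" ..
    then have q: "\<And>l j. l < m \<Longrightarrow> j < n \<Longrightarrow> q l j \<in> \<O> P"
      "\<And>l. l < m \<Longrightarrow> eventually (\<lambda>x. g l x = (\<Sum>j<n. q l j x * y j x)) (near P)" by simp_all
    have "eventually (\<lambda>x. \<forall>l\<in>{..<m}. g l x = (\<Sum>j<n. q l j x * y j x)) (near P)"
      using q(2) by (intro eventually_ball_finite) auto
    then have ev: "eventually (\<lambda>x. y i x = v (y i) * t x + (\<Sum>j<n. (\<Sum>l<m. q l j x * h l x) * y j x)) (near P)"
    proof eventually_elim
      case (elim x)
      have "z x = (\<Sum>l<m. (\<Sum>j<n. q l j x * y j x) * h l x)"
        using zx elim by (simp cong: sum.cong_simp)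
      also have "\<dots> = (\<Sum>l<m. \<Sum>j<n. q l j x * h l x * y j x)"
        by (simp add: sum_distrib_right sum_distrib_left mult_ac)
      also have "\<dots> = (\<Sum>j<n. (\<Sum>l<m. q l j x * h l x) * y j x)"
        by (subst sum.swap) (simp add: sum_distrib_right)
      finally show ?case unfolding z_def by (simp add: algebra_simps)
    qed
    show ?thesis
    proof (intro exI conjI allI impI)
      fix j assume j: "j < n"
      show "(\<lambda>x. \<Sum>l<m. q l j x * h l x) \<in> \<O> P"
        using q(1) gh j by (intro at_sum P at_mult) auto
      show "(\<Sum>l<m. q l j P * h l P) = 0" using gh by simp
    qed (rule ev)
  qed
  then have "\<forall>i. \<exists>s. i < n \<longrightarrow> (\<forall>j<n. s j \<in> \<O> P \<and> s j P = 0) \<and>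
      eventually (\<lambda>x. y i x = v (y i) * t x + (\<Sum>j<n. s j x * y j x)) (near P)" by blast
  from choice[OF this] obtain s where "\<forall>i. i < n \<longrightarrow> (\<forall>j<n. s i j \<in> \<O> P \<and> s i j P = 0) \<and>
      eventually (\<lambda>x. y i x = v (y i) * t x + (\<Sum>j<n. s i j x * y j x)) (near P)" ..
  then have s: "\<And>i j. i < n \<Longrightarrow> j < n \<Longrightarrow> s i j \<in> \<O> P \<and> s i j P = 0"
    "\<And>i. i < n \<Longrightarrow> eventually (\<lambda>x. y i x = v (y i) * t x + (\<Sum>j<n. s i j x * y j x)) (near P)" by simp_all
  have "\<exists>h. (\<forall>i<n. h i \<in> \<O> P) \<and>
    eventually (\<lambda>Q. \<forall>w \<tau>. (\<forall>i<n. w i = v (y i) * \<tau> + (\<Sum>j<n. s i j Q * w j)) \<longrightarrow> (\<forall>i<n. w i = h i Q * \<tau>)) (near P)"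
    by (rule solve_near[where a="\<lambda>i _. v (y i)", OF P order_refl]) (use s(1) at_const[OF P] in auto)
  then obtain h where h: "\<And>i. i < n \<Longrightarrow> h i \<in> \<O> P"
    "eventually (\<lambda>Q. \<forall>w \<tau>. (\<forall>i<n. w i = v (y i) * \<tau> + (\<Sum>j<n. s i j Q * w j)) \<longrightarrow> (\<forall>i<n. w i = h i Q * \<tau>)) (near P)"
    by blast
  have "eventually (\<lambda>x. \<forall>i\<in>{..<n}. y i x = v (y i) * t x + (\<Sum>j<n. s i j x * y j x)) (near P)"
    using s(2) by (intro eventually_ball_finite) auto
  then have yh: "eventually (\<lambda>x. \<forall>i<n. y i x = h i x * t x) (near P)"
    using h(2)
  proof eventually_elim
    case (elim x)
    from elim(2)[rule_format, of "\<lambda>i. y i x" "t x"] elim(1) show ?case by simp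
  qed
  have "uniformizer X P t"
  proof (rule uniformizerI[OF t])
    fix g assume g: "g \<in> \<O> P" "g P = 0"
    obtain q where q: "\<forall>j<n. q j \<in> \<O> P"
      "eventually (\<lambda>x. g x = (\<Sum>j<n. q j x * y j x)) (near P)" using gen[OF g] by blast
    have "eventually (\<lambda>x. g x = (\<Sum>j<n. q j x * h j x) * t x) (near P)"
      using q(2) yh by eventually_elim (simp add: sum_distrib_right mult.assoc cong: sum.cong_simp)
    then have "gen_eq X g (\<lambda>x. (\<Sum>j<n. q j x * h j x) * t x)"
      unfolding gen_eq_iff by (rule near_imp_generic[OF P])
    moreover have "(\<lambda>x. \<Sum>j<n. q j x * h j x) \<in> \<O> P"
      using q(1) h(1) by (intro at_sum P at_mult) auto
    ultimately show "\<exists>h\<in>\<O> P. gen_eq X g (\<lambda>x. h x * t x)"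
      by (rule bexI[of _ "\<lambda>x. \<Sum>j<n. q j x * h j x"])
  qed
  then show ?thesis using v vt by (rule that)
qed

lemma uniformizer_nonzero:
  assumes "uniformizer X P t"
  shows "eventually (\<lambda>x. t x \<noteq> 0) generic"
proof (rule at_generic_nonzero)
  note t = uniformizerD[OF assms]
  show "t \<in> \<O> P" by (rule t)
  show "\<not> gen_eq X t (\<lambda>_. 0)"
  proof
    assume "gen_eq X t (\<lambda>_. 0)"
    then have t0: "eventually (\<lambda>x. t x = 0) generic" by (simp add: gen_eq_iff)
    obtain t' v where t': "uniformizer X P t'" "v \<in> tangent_space X P" "v t' = 1"
      using uniformizer_exists[OF t(3)] .
    note t'P = uniformizerD[OF t'(1)]
    obtain h where "gen_eq X t' (\<lambda>x. h x * t x)" using t(4)[OF t'P(1,2)] by blast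
    then have "eventually (\<lambda>x. t' x = h x * t x) generic" by (simp add: gen_eq_iff)
    then have "gen_eq X t' (\<lambda>_. 0)"
      using t0 unfolding gen_eq_iff by eventually_elim simp
    then have "v t' = v (\<lambda>_. 0)"
      by (intro tangent_near_cong[OF t'(2) t'P(1) at_const] gen_eq_imp_near t'P at_const)
    then show False using t'(3) tangent_const[OF t'(2) t(3)] by simp
  qed
qed

text \<open>
  Krull's intersection theorem. If \<open>f = g\<^sub>m t\<^sup>m\<close> for all \<open>m\<close>, then some \<open>g\<^sub>m\<close> is a
  combination of the earlier \<open>g\<^sub>j\<close> because the ring of polynomials is noetherian. The latter are
  multiples of \<open>t g\<^sub>m\<close>, hence \<open>g\<^sub>m = 0\<close>.
\<close>

lemma at_factor_power:
  assumes t: "uniformizer X P t" and f: "f \<in> \<O> P" "\<not> gen_eq X f (\<lambda>_. 0)"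
  shows "\<exists>n u. u \<in> \<O> P \<and> u P \<noteq> 0 \<and> gen_eq X f (\<lambda>x. u x * t x ^ n)"
proof (rule ccontr)
  assume neg: "\<not> ?thesis"
  note tP = uniformizerD[OF t]
  note P = tP(3)
  define A where "A n g \<longleftrightarrow> g \<in> \<O> P \<and> gen_eq X f (\<lambda>x. g x * t x ^ n)" for n g
  have "\<exists>g. \<forall>n. A n (g n) \<and> gen_eq X (g n) (\<lambda>x. g (Suc n) x * t x)"
  proof (rule dependent_nat_choice[where P=A and Q="\<lambda>n g g'. gen_eq X g (\<lambda>x. g' x * t x)"])
    show "\<exists>g. A 0 g" using f(1) by (intro exI[of _ f]) (simp add: A_def gen_eq_iff)
    fix g n assume g: "A n g"
    then have "g P = 0" using neg unfolding A_def by blast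
    then obtain h where h: "h \<in> \<O> P" "gen_eq X g (\<lambda>x. h x * t x)"
      using tP(4)[of g] g unfolding A_def by blast
    from g have "eventually (\<lambda>x. f x = g x * t x ^ n) generic" by (simp add: A_def gen_eq_iff)
    then have "eventually (\<lambda>x. f x = h x * t x ^ Suc n) generic"
      using h(2) unfolding gen_eq_iff by eventually_elim simp
    then show "\<exists>g'. A (Suc n) g' \<and> gen_eq X g (\<lambda>x. g' x * t x)"
      using h by (intro exI[of _ h]) (simp add: A_def gen_eq_iff)
  qed
  then obtain g where g: "\<And>n. g n \<in> \<O> P" "\<And>n. eventually (\<lambda>x. f x = g n x * t x ^ n) generic"
    "\<And>n. eventually (\<lambda>x. g n x = g (Suc n) x * t x) generic" by (auto simp: A_def gen_eq_iff)
  have gm: "eventually (\<lambda>x. g j x = g (j + i) x * t x ^ i) generic" for i j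
  proof (induction i)
    case (Suc i)
    then show ?case using g(3)[of "j + i"] by eventually_elim simp
  qed simp
  obtain U n \<phi> where U: "P \<in> U" "chart X U n \<phi>" using prevariety_chart[OF prevar P] by blast
  note at = at_chart_poly[OF U(2) _ U(1)]
  have "\<forall>m. \<exists>F G. F \<in> poly_funs n \<and> G \<in> poly_funs n \<and> G (\<phi> P) \<noteq> 0 \<and>
     eventually (\<lambda>x. F (\<phi> x) = G (\<phi> x) * g m x) generic"
  proof
    fix m
    obtain F G where FG: "F \<in> poly_funs n" "G \<in> poly_funs n" "G (\<phi> P) \<noteq> 0"
      and ev: "eventually (\<lambda>x. x \<in> U \<and> G (\<phi> x) \<noteq> 0 \<and> g m x = F (\<phi> x) / G (\<phi> x)) (near P)"
      using at_chart_fraction[OF U(2,1) g(1)] .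
    from near_imp_generic[OF P ev] have "eventually (\<lambda>x. F (\<phi> x) = G (\<phi> x) * g m x) generic"
      by eventually_elim simp
    with FG show "\<exists>F G. F \<in> poly_funs n \<and> G \<in> poly_funs n \<and> G (\<phi> P) \<noteq> 0 \<and>
      eventually (\<lambda>x. F (\<phi> x) = G (\<phi> x) * g m x) generic" by blast
  qed
  then obtain F G where F: "\<And>m. F m \<in> poly_funs n" and G: "\<And>m. G m \<in> poly_funs n" "\<And>m. G m (\<phi> P) \<noteq> 0"
    and FG: "\<And>m. eventually (\<lambda>x. F m (\<phi> x) = G m (\<phi> x) * g m x) generic" by metis
  obtain m where m: "F m \<in> ideal_of (poly_funs n) (F ` {..<m})"
    using noetherian_poly_funs F unfolding noetherian_def by blast
  have "\<exists>c\<in>\<O> P. eventually (\<lambda>x. z (\<phi> x) = c x * t x * g m x) generic"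
    if "z \<in> ideal_of (poly_funs n) (F ` {..<m})" for z
    using that
  proof induction
    case zero
    show ?case by (rule bexI[of _ "\<lambda>_. 0"]) (auto intro: at_const P)
  next
    case (step z r y)
    then obtain c where c: "c \<in> \<O> P" "eventually (\<lambda>x. z (\<phi> x) = c x * t x * g m x) generic" by blast
    obtain j where j: "j < m" "y = F j" using step by blast
    define c' where "c' x = c x + r (\<phi> x) * G j (\<phi> x) * t x ^ (m - Suc j)" for x
    have "c' \<in> \<O> P"
      unfolding c'_def by (intro at_add c at_mult at at_power tP step(2) G)
    moreover have "eventually (\<lambda>x. (z + r * y) (\<phi> x) = c' x * t x * g m x) generic"
      using c(2) FG[of j] gm[of j "m - j"]
    proof eventually_elim
      case (elim x)
      have "t x ^ (m - j) = t x ^ (m - Suc j) * t x"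
        using j(1) by (metis Suc_diff_Suc power_Suc2)
      then have "F j (\<phi> x) = G j (\<phi> x) * (g m x * (t x ^ (m - Suc j) * t x))"
        using elim(2,3) j(1) by simp
      then show ?case by (simp add: elim(1) c'_def j(2) algebra_simps)
    qed
    ultimately show ?case by blast
  qed
  from this[OF m] obtain c where c: "c \<in> \<O> P" "eventually (\<lambda>x. F m (\<phi> x) = c x * t x * g m x) generic"
    by blast
  \<comment> \<open>The relation found reads \<open>(G\<^sub>m - c t) g\<^sub>m = 0\<close>, and the first factor is a unit at \<open>P\<close>.\<close>
  define e where "e x = G m (\<phi> x) - c x * t x" for x
  have e: "e \<in> \<O> P" "e P \<noteq> 0"
    unfolding e_def using tP G by (auto intro!: at_diff at_mult at c)
  have "eventually (\<lambda>x. f x = 0) generic"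
    using c(2) FG[of m] near_imp_generic[OF P at_near_nonzero[OF e]] g(2)[of m]
    by eventually_elim (auto simp: e_def algebra_simps)
  then show False using f(2) by (simp add: gen_eq_iff)
qed


subsection \<open>Orders\<close>

text \<open>
  The relation behind \<^const>\<open>ord_at\<close>. Its rules for products and inverses come before existence,
  which is deduced from them by writing a rational function as a fraction.
\<close>

definition has_order :: "'a \<Rightarrow> ('a \<Rightarrow> 'k) \<Rightarrow> int \<Rightarrow> bool" where
  "has_order P f n \<longleftrightarrow> (\<exists>t u. uniformizer X P t \<and> u \<in> \<O> P \<and> u P \<noteq> 0 \<and>
     gen_eq X f (\<lambda>x. u x * t x powi n))"

lemma uniformizer_unit:
  assumes "uniformizer X P t" "uniformizer X P t'"
  obtains e where "e \<in> \<O> P" "e P \<noteq> 0" "eventually (\<lambda>x. t' x = e x * t x) generic"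
proof -
  note t = uniformizerD[OF assms(1)] and t' = uniformizerD[OF assms(2)]
  obtain e where e: "e \<in> \<O> P" "eventually (\<lambda>x. t' x = e x * t x) generic"
    using t(4)[OF t'(1,2)] by (auto simp: gen_eq_iff)
  obtain e' where e': "e' \<in> \<O> P" "eventually (\<lambda>x. t x = e' x * t' x) generic"
    using t'(4)[OF t(1,2)] by (auto simp: gen_eq_iff)
  have "gen_eq X (\<lambda>x. e x * e' x) (\<lambda>_. 1)"
    unfolding gen_eq_iff using e(2) e'(2) uniformizer_nonzero[OF assms(1)]
    by eventually_elim (metis mult.assoc mult.commute mult_cancel_right1)
  then have "e P * e' P = 1" by (rule gen_eq_imp_at[OF at_mult[OF e(1) e'(1)] at_const[OF t(3)]])
  then show ?thesis using that[OF e(1) _ e(2)] by force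
qed

lemma has_orderE:
  assumes "has_order P f n" "uniformizer X P t"
  obtains u where "u \<in> \<O> P" "u P \<noteq> 0" "eventually (\<lambda>x. f x = u x * t x powi n) generic"
proof -
  obtain t' u where t': "uniformizer X P t'" and u: "u \<in> \<O> P" "u P \<noteq> 0"
    "eventually (\<lambda>x. f x = u x * t' x powi n) generic"
    using assms(1) by (auto simp: has_order_def gen_eq_iff)
  obtain e where e: "e \<in> \<O> P" "e P \<noteq> 0" "eventually (\<lambda>x. t' x = e x * t x) generic"
    using uniformizer_unit[OF assms(2) t'] .
  show ?thesis
  proof (rule that)
    show "(\<lambda>x. u x * e x powi n) \<in> \<O> P" by (intro at_mult u at_powi e)
    show "u P * e P powi n \<noteq> 0" using u e by simp
    show "eventually (\<lambda>x. f x = u x * e x powi n * t x powi n) generic"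
      using u(3) e(3) by eventually_elim (simp add: power_int_mult_distrib)
  qed
qed

lemma has_orderI:
  "uniformizer X P t \<Longrightarrow> u \<in> \<O> P \<Longrightarrow> u P \<noteq> 0 \<Longrightarrow>
    eventually (\<lambda>x. f x = u x * t x powi n) generic \<Longrightarrow> has_order P f n"
  by (auto simp: has_order_def gen_eq_iff)

text \<open>Otherwise a unit at \<open>P\<close> would be divisible by \<open>t\<close>, and would vanish at \<open>P\<close>.\<close>

lemma has_order_le:
  assumes "has_order P f n" "has_order P f m"
  shows "m \<le> n"
proof (rule ccontr)
  assume "\<not> m \<le> n"
  define k where "k = nat (m - n)"
  have k: "k > 0" "m = n + int k" using \<open>\<not> m \<le> n\<close> by (auto simp: k_def)
  obtain t where t: "uniformizer X P t" using assms(1) by (auto simp: has_order_def)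
  note tP = uniformizerD[OF t]
  obtain u where u: "u \<in> \<O> P" "u P \<noteq> 0" "eventually (\<lambda>x. f x = u x * t x powi n) generic"
    using has_orderE[OF assms(1) t] .
  obtain w where w: "w \<in> \<O> P" "w P \<noteq> 0" "eventually (\<lambda>x. f x = w x * t x powi m) generic"
    using has_orderE[OF assms(2) t] .
  have "gen_eq X u (\<lambda>x. w x * t x ^ k)"
    unfolding gen_eq_iff using u(3) w(3) uniformizer_nonzero[OF t]
    by eventually_elim (auto simp: k(2) power_int_add)
  then have "u P = w P * t P ^ k" by (rule gen_eq_imp_at[OF u(1) at_mult[OF w(1) at_power[OF tP(1)]]])
  then show False using u(2) tP(2) k(1) by (simp add: power_0_left)
qed

lemma has_order_unique: "has_order P f n \<Longrightarrow> has_order P f m \<Longrightarrow> n = m"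
  by (meson antisym has_order_le)

lemma ord_at_eq: "has_order P f n \<Longrightarrow> ord_at X P f = n"
  unfolding ord_at_def has_order_def[symmetric]
  by (rule the_equality) (auto intro: has_order_unique)

lemma has_order_cong:
  assumes "eventually (\<lambda>x. f x = g x) generic" "has_order P g n"
  shows "has_order P f n"
proof -
  obtain t where t: "uniformizer X P t" using assms(2) by (auto simp: has_order_def)
  obtain u where u: "u \<in> \<O> P" "u P \<noteq> 0" "eventually (\<lambda>x. g x = u x * t x powi n) generic"
    using has_orderE[OF assms(2) t] .
  show ?thesis
    by (rule has_orderI[OF t u(1,2)]) (use u(3) assms(1) in \<open>eventually_elim, simp\<close>)
qed

lemma has_order_mult:
  assumes "has_order P f n" "has_order P g m"
  shows "has_order P (\<lambda>x. f x * g x) (n + m)"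
proof -
  obtain t where t: "uniformizer X P t" using assms(1) by (auto simp: has_order_def)
  obtain u where u: "u \<in> \<O> P" "u P \<noteq> 0" "eventually (\<lambda>x. f x = u x * t x powi n) generic"
    using has_orderE[OF assms(1) t] .
  obtain w where w: "w \<in> \<O> P" "w P \<noteq> 0" "eventually (\<lambda>x. g x = w x * t x powi m) generic"
    using has_orderE[OF assms(2) t] .
  have "eventually (\<lambda>x. f x * g x = u x * w x * t x powi (n + m)) generic"
    using u(3) w(3) uniformizer_nonzero[OF t]
    by eventually_elim (simp add: power_int_add mult_ac)
  then show ?thesis using u w by (intro has_orderI[OF t at_mult[OF u(1) w(1)]]) auto
qed

lemma has_order_inverse:
  assumes "has_order P f n"
  shows "has_order P (\<lambda>x. inverse (f x)) (- n)"
proof -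
  obtain t where t: "uniformizer X P t" using assms(1) by (auto simp: has_order_def)
  obtain u where u: "u \<in> \<O> P" "u P \<noteq> 0" "eventually (\<lambda>x. f x = u x * t x powi n) generic"
    using has_orderE[OF assms(1) t] .
  have "eventually (\<lambda>x. inverse (f x) = inverse (u x) * t x powi (- n)) generic"
    using u(3) by eventually_elim (simp add: power_int_minus)
  then show ?thesis using u by (intro has_orderI[OF t at_inverse[OF u(1,2)]]) auto
qed

lemma has_order_unit:
  assumes "f \<in> \<O> P" "f P \<noteq> 0"
  shows "has_order P f 0"
proof -
  obtain t v where "uniformizer X P t" using uniformizer_exists[OF regular_at_point[OF assms(1)]] by blast
  then show ?thesis by (rule has_orderI[OF _ assms]) simp
qed

lemma has_order_regular:
  assumes "f \<in> \<O> P" "\<not> gen_eq X f (\<lambda>_. 0)"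
  shows "\<exists>n. has_order P f (int n)"
proof -
  obtain t v where t: "uniformizer X P t" using uniformizer_exists[OF regular_at_point[OF assms(1)]] by blast
  obtain n u where "u \<in> \<O> P" "u P \<noteq> 0" "gen_eq X f (\<lambda>x. u x * t x ^ n)"
    using at_factor_power[OF t assms] by blast
  then have "has_order P f (int n)"
    by (intro has_orderI[OF t]) (auto simp: gen_eq_iff)
  then show ?thesis by blast
qed

text \<open>
  A chart around \<open>P\<close> meets the open set where \<open>f\<close> is regular. At a common point \<open>f\<close> is a fraction
  in the coordinates, and numerator and denominator are regular on the whole chart.
\<close>

lemma rational_fraction:
  assumes P: "P \<in> points X" and f: "f \<in> rational_funs X" "\<not> gen_eq X f (\<lambda>_. 0)"
  obtains a b where "a \<in> \<O> P" "b \<in> \<O> P" "\<not> gen_eq X a (\<lambda>_. 0)" "\<not> gen_eq X b (\<lambda>_. 0)"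
    "eventually (\<lambda>x. f x = a x * inverse (b x)) generic"
proof -
  obtain U n \<phi> where U: "P \<in> U" "chart X U n \<phi>" using prevariety_chart[OF prevar P] by blast
  obtain V where V: "op V" "V \<noteq> {}" "f \<in> regular_on X V" using f(1) by (auto simp: rational_funs_def)
  obtain Q where Q: "Q \<in> V" "Q \<in> U" using open_meet[OF V(1) chartD(1)[OF U(2)]] V U by blast
  have fQ: "f \<in> \<O> Q" by (rule regular_atI[OF V(1) Q(1) V(3)])
  obtain F G where F: "F \<in> poly_funs n" and G: "G \<in> poly_funs n"
    and near: "eventually (\<lambda>x. x \<in> U \<and> G (\<phi> x) \<noteq> 0 \<and> f x = F (\<phi> x) / G (\<phi> x)) (near Q)"
    using at_chart_fraction[OF U(2) Q(2) fQ] .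
  note ev = near_imp_generic[OF regular_at_point[OF fQ] near]
  show ?thesis
  proof (rule that[OF at_chart_poly[OF U(2) F U(1)] at_chart_poly[OF U(2) G U(1)]])
    show "eventually (\<lambda>x. f x = F (\<phi> x) * inverse (G (\<phi> x))) generic"
      using ev by eventually_elim (simp add: divide_inverse)
    show "\<not> gen_eq X (\<lambda>x. F (\<phi> x)) (\<lambda>_. 0)"
    proof
      assume "gen_eq X (\<lambda>x. F (\<phi> x)) (\<lambda>_. 0)"
      then have "gen_eq X f (\<lambda>_. 0)"
        unfolding gen_eq_iff using ev by eventually_elim simp
      then show False using f(2) by blast
    qed
    show "\<not> gen_eq X (\<lambda>x. G (\<phi> x)) (\<lambda>_. 0)"
    proof
      assume "gen_eq X (\<lambda>x. G (\<phi> x)) (\<lambda>_. 0)"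
      then have "eventually (\<lambda>x. False) generic"
        unfolding gen_eq_iff using ev by eventually_elim simp
      then show False using generic_not_bot by (simp add: trivial_limit_def)
    qed
  qed
qed

lemma has_order_exists:
  assumes P: "P \<in> points X" and f: "f \<in> rational_funs X" "\<not> gen_eq X f (\<lambda>_. 0)"
  shows "has_order P f (ord_at X P f)"
proof -
  obtain a b where ab: "a \<in> \<O> P" "b \<in> \<O> P" "\<not> gen_eq X a (\<lambda>_. 0)" "\<not> gen_eq X b (\<lambda>_. 0)"
    "eventually (\<lambda>x. f x = a x * inverse (b x)) generic" using rational_fraction[OF assms] .
  obtain n m where "has_order P a (int n)" "has_order P b (int m)"
    using has_order_regular ab by blast
  then have "has_order P f (int n + - int m)"
    by (intro has_order_cong[OF ab(5)] has_order_mult has_order_inverse)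
  from this ord_at_eq[OF this] show ?thesis by simp
qed

lemma has_order_nonzero:
  assumes "has_order P f n"
  shows "eventually (\<lambda>x. f x \<noteq> 0) generic"
proof -
  obtain t where t: "uniformizer X P t" using assms(1) by (auto simp: has_order_def)
  obtain u where u: "u \<in> \<O> P" "u P \<noteq> 0" "eventually (\<lambda>x. f x = u x * t x powi n) generic"
    using has_orderE[OF assms(1) t] .
  show ?thesis
    using u(3) near_imp_generic[OF regular_at_point[OF u(1)] at_near_nonzero[OF u(1,2)]] uniformizer_nonzero[OF t]
    by eventually_elim simp
qed

lemma has_order_not_zero:
  assumes "has_order P f n"
  shows "\<not> gen_eq X f (\<lambda>_. 0)"
proof
  assume "gen_eq X f (\<lambda>_. 0)"
  then have "eventually (\<lambda>x. False) generic"
    using has_order_nonzero[OF assms] unfolding gen_eq_iff by eventually_elim simp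
  then show False using generic_not_bot by (simp add: trivial_limit_def)
qed

end


section \<open>Vector fields\<close>

text \<open>
  A regular vector field dual to the differential of \<open>t\<close> serves as the derivation \<open>d/dt\<close>. As it
  consists of tangent vectors at points, the rules of differentiation hold by definition, and no
  derivation has to be extended to the function field.
\<close>

locale vector_field = smooth_curve X for X :: "('a, 'k::field) fun_space" +
  fixes b :: 'a and t :: "'a \<Rightarrow> 'k" and U :: "'a set" and \<delta> :: "('a \<Rightarrow> 'k) \<Rightarrow> 'a \<Rightarrow> 'k"
  assumes t_uniformizer: "uniformizer X b t"
    and U_open: "op U" and b_in_U: "b \<in> U"
    and tangent: "Q \<in> U \<Longrightarrow> (\<lambda>f. \<delta> f Q) \<in> tangent_space X Q"
    and t_regular: "Q \<in> U \<Longrightarrow> t \<in> \<O> Q"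
    and deriv_t: "Q \<in> U \<Longrightarrow> \<delta> t Q = 1"
    and deriv_regular: "Q \<in> U \<Longrightarrow> f \<in> \<O> Q \<Longrightarrow> \<delta> f \<in> \<O> Q"

context smooth_curve
begin

text \<open>
  In terms of coordinates \<open>\<phi>\<^sub>i\<close> near \<open>b\<close> one has \<open>\<phi>\<^sub>i - \<phi>\<^sub>i b = h\<^sub>i t\<close>, and application of a tangent
  vector \<open>v\<close> at a nearby point gives \<open>v \<phi>\<^sub>i = h\<^sub>i v t + t v h\<^sub>i\<close>. Here \<open>v h\<^sub>i\<close> is a combination
  of the \<open>v \<phi>\<^sub>j\<close>, so this is a linear system with solution \<open>v \<phi>\<^sub>i = \<eta>\<^sub>i v t\<close>, where \<open>\<eta>\<^sub>i\<close> is
  regular near \<open>b\<close>. Hence \<open>v t \<noteq> 0\<close> for \<open>v \<noteq> 0\<close>, and the tangent vectors normalised by \<open>v t = 1\<close>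
  depend on the point in a regular way.
\<close>

lemma vector_field_exists:
  assumes t: "uniformizer X b t"
  obtains U \<delta> where "vector_field X b t U \<delta>"
proof -
  note tb = uniformizerD[OF t]
  note b = tb(3)
  obtain A n \<phi> where A: "b \<in> A" "chart X A n \<phi>" using prevariety_chart[OF prevar b] by blast
  have Aop: "op A" by (rule chartD(1)[OF A(2)])
  have near_A: "eventually (\<lambda>Q. Q \<in> A) (near b)" by (rule eventually_nearI[OF Aop A(1)])
  have coord: "(\<lambda>x. \<phi> x i) \<in> \<O> Q" if "i < n" "Q \<in> A" for i Q
    by (rule at_chart_poly[OF A(2) poly_funs.coord[OF that(1)] that(2)])
  have "\<forall>i. \<exists>h. i < n \<longrightarrow> h \<in> \<O> b \<and> eventually (\<lambda>x. \<phi> x i - \<phi> b i = h x * t x) (near b)"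
  proof (intro allI)
    fix i
    show "\<exists>h. i < n \<longrightarrow> h \<in> \<O> b \<and> eventually (\<lambda>x. \<phi> x i - \<phi> b i = h x * t x) (near b)"
    proof (cases "i < n")
      case True
      have y: "(\<lambda>x. \<phi> x i - \<phi> b i) \<in> \<O> b" using coord[OF True A(1)] at_const[OF b] by (rule at_diff)
      obtain h where h: "h \<in> \<O> b" "gen_eq X (\<lambda>x. \<phi> x i - \<phi> b i) (\<lambda>x. h x * t x)"
        using tb(4)[OF y] by auto
      from gen_eq_imp_near[OF y at_mult[OF h(1) tb(1)] h(2)] h(1) show ?thesis by blast
    qed simp
  qed
  from choice[OF this] obtain h where h: "\<And>i. i < n \<Longrightarrow> h i \<in> \<O> b"
    "\<And>i. i < n \<Longrightarrow> eventually (\<lambda>x. \<phi> x i - \<phi> b i = h i x * t x) (near b)" by auto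
  have "\<forall>i. \<exists>d. i < n \<longrightarrow> (\<forall>j<n. d j \<in> \<O> b) \<and>
    eventually (\<lambda>Q. \<forall>v\<in>tangent_space X Q. v (h i) = (\<Sum>j<n. d j Q * v (\<lambda>x. \<phi> x j))) (near b)"
    using tangent_coordinates[OF A(2,1) h(1)] by blast
  from choice[OF this] obtain d where d: "\<And>i j. i < n \<Longrightarrow> j < n \<Longrightarrow> d i j \<in> \<O> b"
    "\<And>i. i < n \<Longrightarrow> eventually (\<lambda>Q. \<forall>v\<in>tangent_space X Q. v (h i) = (\<Sum>j<n. d i j Q * v (\<lambda>x. \<phi> x j))) (near b)"
    by auto
  have "\<exists>\<eta>. (\<forall>i<n. \<eta> i \<in> \<O> b) \<and>
    eventually (\<lambda>Q. \<forall>w \<tau>. (\<forall>i<n. w i = h i Q * \<tau> + (\<Sum>j<n. (t Q * d i j Q) * w j)) \<longrightarrow> (\<forall>i<n. w i = \<eta> i Q * \<tau>)) (near b)"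
    by (rule solve_near[where s="\<lambda>i j x. t x * d i j x", OF b order_refl])
      (use h d tb in \<open>auto intro: at_mult\<close>)
  then obtain \<eta> where \<eta>: "\<And>i. i < n \<Longrightarrow> \<eta> i \<in> \<O> b"
    "eventually (\<lambda>Q. \<forall>w \<tau>. (\<forall>i<n. w i = h i Q * \<tau> + (\<Sum>j<n. (t Q * d i j Q) * w j)) \<longrightarrow> (\<forall>i<n. w i = \<eta> i Q * \<tau>)) (near b)"
    by blast
  have "eventually (\<lambda>Q. \<forall>i\<in>{..<n}. h i \<in> \<O> Q \<and> \<eta> i \<in> \<O> Q \<and>
      (Q \<in> points X \<and> eventually (\<lambda>x. \<phi> x i - \<phi> b i = h i x * t x) (near Q)) \<and>
      (\<forall>v\<in>tangent_space X Q. v (h i) = (\<Sum>j<n. d i j Q * v (\<lambda>x. \<phi> x j)))) (near b)"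
    using h d(2) \<eta>(1)
    by (intro eventually_ball_finite ballI eventually_conj regular_at_near_regular eventually_near_near[OF b]) auto
  then have "eventually (\<lambda>Q. Q \<in> A \<and> t \<in> \<O> Q \<and> (\<forall>i<n. \<eta> i \<in> \<O> Q) \<and>
      (\<forall>v\<in>tangent_space X Q. \<forall>i<n. v (\<lambda>x. \<phi> x i) = \<eta> i Q * v t)) (near b)"
    using \<eta>(2) regular_at_near_regular[OF tb(1)] near_A
  proof eventually_elim
    case (elim Q)
    have "\<forall>i<n. v (\<lambda>x. \<phi> x i) = \<eta> i Q * v t" if v: "v \<in> tangent_space X Q" for v
    proof -
      have "v (\<lambda>x. \<phi> x i) = h i Q * v t + (\<Sum>j<n. (t Q * d i j Q) * v (\<lambda>x. \<phi> x j))" if i: "i < n" for i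
      proof -
        have Q: "Q \<in> points X" using regular_at_point[OF elim(3)] .
        have hi: "h i \<in> \<O> Q" using elim(1) i by blast
        have ev: "eventually (\<lambda>x. \<phi> x i - \<phi> b i = h i x * t x) (near Q)" using elim(1) i by blast
        have "v (\<lambda>x. \<phi> x i) = v (\<lambda>x. \<phi> x i - \<phi> b i)"
          unfolding tangent_diff[OF v coord[OF i elim(4)] at_const[OF Q]] by (simp add: tangent_const[OF v Q])
        also have "\<dots> = v (\<lambda>x. h i x * t x)"
          by (rule tangent_near_cong[OF v at_diff[OF coord[OF i elim(4)] at_const[OF Q]] at_mult[OF hi elim(3)] ev])
        also have "\<dots> = h i Q * v t + t Q * v (h i)" by (rule tangentD(4)[OF v hi elim(3)])
        also have "v (h i) = (\<Sum>j<n. d i j Q * v (\<lambda>x. \<phi> x j))" using elim(1) i v by blast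
        finally show ?thesis by (simp add: sum_distrib_left mult.assoc)
      qed
      with elim(2)[rule_format, of "\<lambda>i. v (\<lambda>x. \<phi> x i)" "v t"] show ?thesis by simp
    qed
    then show ?case using elim(1,3,4) by simp
  qed
  then obtain U where U: "op U" "b \<in> U"
    and U': "\<forall>Q\<in>U. Q \<in> A \<and> t \<in> \<O> Q \<and> (\<forall>i<n. \<eta> i \<in> \<O> Q) \<and>
      (\<forall>v\<in>tangent_space X Q. \<forall>i<n. v (\<lambda>x. \<phi> x i) = \<eta> i Q * v t)"
    unfolding eventually_near[OF b] by blast
  have "\<exists>v. v \<in> tangent_space X Q \<and> v t = 1" if Q: "Q \<in> U" for Q
  proof -
    have QP: "Q \<in> points X" using Q U(1) openin_subset by blast
    obtain v f where v: "v \<in> tangent_space X Q" and f: "f \<in> \<O> Q" "v f \<noteq> 0"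
      by (rule tangent_line[OF QP]) (rule that)
    obtain e where "eventually (\<lambda>Q. \<forall>v\<in>tangent_space X Q. v f = (\<Sum>i<n. e i Q * v (\<lambda>x. \<phi> x i))) (near Q)"
      using tangent_coordinates[OF A(2) _ f(1)] U' Q by blast
    from near_imp_at[OF QP this] v have "v f = (\<Sum>i<n. e i Q * v (\<lambda>x. \<phi> x i))" by blast
    also have "\<dots> = (\<Sum>i<n. e i Q * (\<eta> i Q * v t))" using U' Q v by simp
    finally have vt: "v t \<noteq> 0" using f(2) by auto
    have "(\<lambda>f. inverse (v t) * v f) \<in> tangent_space X Q"
      using v by (simp add: tangent_space_def algebra_simps)
    then show ?thesis using vt by (intro exI[of _ "\<lambda>f. inverse (v t) * v f"]) simp
  qed
  then have "\<forall>Q. \<exists>v. Q \<in> U \<longrightarrow> v \<in> tangent_space X Q \<and> v t = 1" by blast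
  from choice[OF this] obtain v where v: "\<And>Q. Q \<in> U \<Longrightarrow> v Q \<in> tangent_space X Q" "\<And>Q. Q \<in> U \<Longrightarrow> v Q t = 1"
    by blast
  have "vector_field X b t U (\<lambda>f Q. v Q f)"
  proof unfold_locales
    fix Q f assume Q: "Q \<in> U" and f: "f \<in> \<O> Q"
    have QP: "Q \<in> points X" using regular_at_point[OF f] .
    have near_U: "eventually (\<lambda>Q. Q \<in> U) (near Q)" by (rule eventually_nearI[OF U(1) Q])
    obtain e where e: "\<forall>i<n. e i \<in> \<O> Q"
      "eventually (\<lambda>Q. \<forall>v\<in>tangent_space X Q. v f = (\<Sum>i<n. e i Q * v (\<lambda>x. \<phi> x i))) (near Q)"
      using tangent_coordinates[OF A(2) _ f(1)] U' Q by blast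
    show "(\<lambda>Q. v Q f) \<in> \<O> Q"
    proof (rule regular_at_near_cong)
      show "(\<lambda>x. \<Sum>i<n. e i x * \<eta> i x) \<in> \<O> Q"
        using e(1) U' Q by (intro at_sum QP at_mult) auto
      show "eventually (\<lambda>Q. v Q f = (\<Sum>i<n. e i Q * \<eta> i Q)) (near Q)"
        using e(2) near_U
      proof eventually_elim
        case (elim R)
        note vR = v[OF elim(2)]
        have "\<forall>i<n. v R (\<lambda>x. \<phi> x i) = \<eta> i R * v R t" using U' elim(2) vR(1) by blast
        then have "\<forall>i<n. v R (\<lambda>x. \<phi> x i) = \<eta> i R" using vR(2) by simp
        moreover have "v R f = (\<Sum>i<n. e i R * v R (\<lambda>x. \<phi> x i))" using elim(1) vR(1) by blast
        ultimately show ?case by simp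
      qed
    qed
  qed (use t U U' v in auto)
  then show ?thesis by (rule that)
qed

subsection \<open>Vanishing to a given order\<close>

definition vanishes :: "'a \<Rightarrow> nat \<Rightarrow> ('a \<Rightarrow> 'k) \<Rightarrow> bool" where
  "vanishes Q n f \<longleftrightarrow> (\<exists>\<tau> h. uniformizer X Q \<tau> \<and> h \<in> \<O> Q \<and> eventually (\<lambda>x. f x = h x * \<tau> x ^ n) generic)"

lemma vanishes_cong:
  assumes "vanishes Q n f" "eventually (\<lambda>x. g x = f x) generic"
  shows "vanishes Q n g"
proof -
  obtain \<tau> h where *: "uniformizer X Q \<tau>" "h \<in> \<O> Q" "eventually (\<lambda>x. f x = h x * \<tau> x ^ n) generic"
    using assms(1) by (auto simp: vanishes_def)
  from *(3) assms(2) have "eventually (\<lambda>x. g x = h x * \<tau> x ^ n) generic" by eventually_elim simp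
  then show ?thesis using * unfolding vanishes_def by blast
qed

lemma vanishes_mult:
  assumes "vanishes Q n f" "g \<in> \<O> Q"
  shows "vanishes Q n (\<lambda>x. f x * g x)"
proof -
  obtain \<tau> h where *: "uniformizer X Q \<tau>" "h \<in> \<O> Q" "eventually (\<lambda>x. f x = h x * \<tau> x ^ n) generic"
    using assms(1) by (auto simp: vanishes_def)
  from *(3) have "eventually (\<lambda>x. f x * g x = (h x * g x) * \<tau> x ^ n) generic"
    by eventually_elim (simp add: mult_ac)
  then show ?thesis using *(1) at_mult[OF *(2) assms(2)] unfolding vanishes_def
    by (intro exI[of _ \<tau>] exI[of _ "\<lambda>x. h x * g x"]) simp
qed

lemma vanishes_at:
  assumes "vanishes Q (Suc n) f" "f \<in> \<O> Q"
  shows "f Q = 0"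
proof -
  obtain \<tau> h where *: "uniformizer X Q \<tau>" "h \<in> \<O> Q" "gen_eq X f (\<lambda>x. h x * \<tau> x ^ Suc n)"
    using assms(1) by (auto simp: vanishes_def gen_eq_iff)
  note tau = uniformizerD[OF *(1)]
  have "f Q = h Q * \<tau> Q ^ Suc n"
    by (rule gen_eq_imp_at[OF assms(2) at_mult[OF *(2) at_power[OF tau(1)]] *(3)])
  then show ?thesis using tau(2) by simp
qed

lemma vanishes_of_order:
  assumes "has_order Q f n" "n \<ge> int m"
  shows "vanishes Q m f"
proof -
  define k where "k = nat (n - int m)"
  have n: "n = int (k + m)" using assms(2) by (simp add: k_def)
  obtain \<tau> u where *: "uniformizer X Q \<tau>" "u \<in> \<O> Q" "eventually (\<lambda>x. f x = u x * \<tau> x powi n) generic"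
    using assms(1) by (auto simp: has_order_def gen_eq_iff)
  from *(3) have "eventually (\<lambda>x. f x = (u x * \<tau> x ^ k) * \<tau> x ^ m) generic"
    by eventually_elim (simp only: n power_int_of_nat power_add mult.assoc)
  moreover have "(\<lambda>x. u x * \<tau> x ^ k) \<in> \<O> Q"
    using * uniformizerD(1) by (intro at_mult at_power) auto
  ultimately show ?thesis using *(1) unfolding vanishes_def
    by (intro exI[of _ \<tau>] exI[of _ "\<lambda>x. u x * \<tau> x ^ k"]) simp
qed

end

context vector_field
begin

lemma U_points: "Q \<in> U \<Longrightarrow> Q \<in> points X"
  using openin_subset[OF U_open] by blast

lemma near_U: "Q \<in> U \<Longrightarrow> eventually (\<lambda>x. x \<in> U) (near Q)"
  by (rule eventually_nearI[OF U_open])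

lemma generic_U: "eventually (\<lambda>x. x \<in> U) generic"
  using b_in_U by (intro generic_openI[OF U_open]) auto

lemmas deriv_add = tangentD(3)[OF tangent] and deriv_mult = tangentD(4)[OF tangent]
  and deriv_scale = tangentD(2)[OF tangent]

lemma deriv_const: "Q \<in> U \<Longrightarrow> \<delta> (\<lambda>_. c) Q = 0"
  by (rule tangent_const[OF tangent U_points])

lemma deriv_cong:
  "Q \<in> U \<Longrightarrow> f \<in> \<O> Q \<Longrightarrow> g \<in> \<O> Q \<Longrightarrow> eventually (\<lambda>x. f x = g x) (near Q) \<Longrightarrow> \<delta> f Q = \<delta> g Q"
  by (rule tangent_near_cong[OF tangent])

lemma deriv_sum:
  assumes "Q \<in> U" "\<And>i. i \<in> I \<Longrightarrow> f i \<in> \<O> Q"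
  shows "\<delta> (\<lambda>x. \<Sum>i\<in>I. f i x) Q = (\<Sum>i\<in>I. \<delta> (f i) Q)"
  using assms(2)
proof (induction I rule: infinite_finite_induct)
  case (insert i I)
  have "(\<lambda>x. \<Sum>i\<in>I. f i x) \<in> \<O> Q" using insert by (intro at_sum[OF U_points[OF assms(1)]]) auto
  then show ?case using insert by (simp add: deriv_add[OF assms(1)])
qed (simp_all add: deriv_const assms)

lemma deriv_power:
  assumes "Q \<in> U" "f \<in> \<O> Q"
  shows "\<delta> (\<lambda>x. f x ^ Suc n) Q = of_nat (Suc n) * f Q ^ n * \<delta> f Q"
proof (induction n)
  case (Suc n)
  have "\<delta> (\<lambda>x. f x ^ Suc (Suc n)) Q = \<delta> (\<lambda>x. f x * f x ^ Suc n) Q" by simp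
  also have "\<dots> = f Q * \<delta> (\<lambda>x. f x ^ Suc n) Q + f Q ^ Suc n * \<delta> f Q"
    by (rule deriv_mult[OF assms at_power[OF assms(2)]])
  finally show ?case using Suc by (simp add: algebra_simps)
qed simp

lemma deriv_inverse:
  assumes "Q \<in> U" "f \<in> \<O> Q" "f Q \<noteq> 0"
  shows "\<delta> (\<lambda>x. inverse (f x)) Q = - \<delta> f Q * inverse (f Q) ^ 2"
proof -
  note i = at_inverse[OF assms(2,3)]
  have "0 = \<delta> (\<lambda>_. 1) Q" by (simp add: deriv_const[OF assms(1)])
  also have "\<dots> = \<delta> (\<lambda>x. f x * inverse (f x)) Q"
    by (rule deriv_cong[OF assms(1) at_const[OF U_points[OF assms(1)]] at_mult[OF assms(2) i]])
      (use at_near_nonzero[OF assms(2,3)] in \<open>eventually_elim, simp\<close>)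
  also have "\<dots> = f Q * \<delta> (\<lambda>x. inverse (f x)) Q + inverse (f Q) * \<delta> f Q"
    by (rule deriv_mult[OF assms(1,2) i])
  finally have "f Q * \<delta> (\<lambda>x. inverse (f x)) Q = - (inverse (f Q) * \<delta> f Q)"
    by (simp add: eq_neg_iff_add_eq_0)
  moreover have "\<delta> (\<lambda>x. inverse (f x)) Q = inverse (f Q) * (f Q * \<delta> (\<lambda>x. inverse (f x)) Q)"
    using assms(3) by (simp flip: mult.assoc)
  ultimately show ?thesis by (simp add: power2_eq_square mult_ac)
qed

lemma deriv_powi:
  assumes "Q \<in> U" "t Q \<noteq> 0"
  shows "\<delta> (\<lambda>x. t x powi e) Q = of_int e * t Q powi (e - 1)"
proof (cases e "0::int" rule: linorder_cases)
  case less
  define n where "n = nat (- e) - 1"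
  have e: "e = - int (Suc n)" using less by (simp add: n_def)
  note tQ = t_regular[OF assms(1)]
  have "\<delta> (\<lambda>x. t x powi e) Q = \<delta> (\<lambda>x. inverse (t x ^ Suc n)) Q"
    unfolding e power_int_minus power_int_of_nat ..
  also have "\<dots> = - (of_nat (Suc n) * t Q ^ n * 1) * inverse (t Q ^ Suc n) ^ 2"
    using assms(2) by (subst deriv_inverse[OF assms(1) at_power[OF tQ]])
      (simp_all only: deriv_power[OF assms(1) tQ] deriv_t[OF assms(1)] power_eq_0_iff simp_thms)
  also have "\<dots> = of_int e * t Q powi (e - 1)"
  proof -
    have "e - 1 = - int (Suc (Suc n))" by (simp add: e)
    then have *: "t Q powi (e - 1) = inverse (t Q ^ Suc (Suc n))"
      by (simp only: power_int_minus power_int_of_nat)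
    have **: "(of_int e :: 'k) = - of_nat (Suc n)" unfolding e by (simp only: of_int_minus of_int_of_nat_eq)
    show ?thesis unfolding * ** using assms(2) by (simp add: power2_eq_square field_simps)
  qed
  finally show ?thesis .
next
  case equal
  then show ?thesis using assms by (simp add: deriv_const)
next
  case greater
  define n where "n = nat e - 1"
  have e: "e = int (Suc n)" using greater by (simp add: n_def)
  have "\<delta> (\<lambda>x. t x powi e) Q = \<delta> (\<lambda>x. t x ^ Suc n) Q"
    unfolding e power_int_of_nat ..
  also have "\<dots> = of_nat (Suc n) * t Q ^ n * 1"
    unfolding deriv_power[OF assms(1) t_regular[OF assms(1)]] deriv_t[OF assms(1)] ..
  also have "t Q ^ n = t Q powi (e - 1)" unfolding e by simp
  finally show ?thesis by (simp add: e)
qed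

lemma vanishes_deriv:
  assumes Q: "Q \<in> U" and f: "f \<in> \<O> Q" and v: "vanishes Q (Suc n) f"
  shows "vanishes Q n (\<delta> f)"
proof -
  obtain \<tau> h where *: "uniformizer X Q \<tau>" "h \<in> \<O> Q" "gen_eq X f (\<lambda>x. h x * \<tau> x ^ Suc n)"
    using v by (auto simp: vanishes_def gen_eq_iff)
  note tau = uniformizerD[OF *(1)]
  note QP = tau(3)
  define h' where "h' x = h x * (of_nat (Suc n) * \<delta> \<tau> x) + \<tau> x * \<delta> h x" for x
  have h': "h' \<in> \<O> Q"
    unfolding h'_def by (intro at_add at_mult at_const * tau QP deriv_regular Q)
  have ev: "eventually (\<lambda>x. f x = h x * \<tau> x ^ Suc n) (near Q)"
    by (rule gen_eq_imp_near[OF f at_mult[OF *(2) at_power[OF tau(1)]] *(3)])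
  have "eventually (\<lambda>R. \<delta> f R = h' R * \<tau> R ^ n) (near Q)"
    using eventually_near_near[OF QP ev] near_U[OF Q] regular_at_near_regular[OF *(2)]
      regular_at_near_regular[OF tau(1)] regular_at_near_regular[OF f]
  proof eventually_elim
    case (elim R)
    have "\<delta> f R = \<delta> (\<lambda>x. h x * \<tau> x ^ Suc n) R"
      by (rule deriv_cong) (use elim in \<open>auto intro: at_mult at_power simp del: power_Suc\<close>)
    also have "\<dots> = h R * (of_nat (Suc n) * \<tau> R ^ n * \<delta> \<tau> R) + \<tau> R ^ Suc n * \<delta> h R"
      unfolding deriv_mult[OF elim(2,3) at_power[OF elim(4)]] deriv_power[OF elim(2,4)] ..
    finally show ?case by (simp add: h'_def algebra_simps)
  qed
  from near_imp_generic[OF QP this] show ?thesis using *(1) h' unfolding vanishes_def by blast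
qed

text \<open>
  The derivative of \<open>u t\<^sup>e\<close> is \<open>(e u + t u') t\<^sup>e\<^sup>-\<^sup>1\<close>, and the first factor has the value \<open>e u b\<close>
  at \<open>b\<close>.
\<close>

lemma has_order_deriv:
  assumes W: "op W" "W \<noteq> {}" "f \<in> regular_on X W" and ord: "has_order b f e" and e: "of_int e \<noteq> (0::'k)"
  shows "has_order b (\<delta> f) (e - 1)"
proof -
  note tb = uniformizerD[OF t_uniformizer]
  obtain u where u: "u \<in> \<O> b" "u b \<noteq> 0" "eventually (\<lambda>x. f x = u x * t x powi e) generic"
    using has_orderE[OF ord t_uniformizer] .
  define u' where "u' x = of_int e * u x + t x * \<delta> u x" for x
  have u': "u' \<in> \<O> b" "u' b \<noteq> 0"
    unfolding u'_def using u tb e by (auto intro!: at_add at_cmult at_mult deriv_regular b_in_U)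
  have "eventually (\<lambda>x. \<delta> f x = u' x * t x powi (e - 1)) generic"
    using eventually_generic_near[OF u(3)] generic_openI[OF W(1,2)] generic_U
      near_imp_generic[OF tb(3) regular_at_near_regular[OF u(1)]] uniformizer_nonzero[OF t_uniformizer]
  proof eventually_elim
    case (elim Q)
    note tQ = t_regular[OF elim(3)]
    note pQ = at_powi[OF tQ elim(5), of e]
    have "\<delta> f Q = \<delta> (\<lambda>x. u x * t x powi e) Q"
      by (rule deriv_cong[OF elim(3) regular_atI[OF W(1) elim(2) W(3)] at_mult[OF elim(4) pQ]]) (use elim(1) in blast)
    also have "\<dots> = u Q * (of_int e * t Q powi (e - 1)) + t Q powi e * \<delta> u Q"
      unfolding deriv_mult[OF elim(3,4) pQ] deriv_powi[OF elim(3,5)] ..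
    also have "t Q powi e = t Q * t Q powi (e - 1)"
      using elim(5) by (simp add: power_int_diff)
    finally show ?case by (simp add: u'_def algebra_simps)
  qed
  then show ?thesis by (rule has_orderI[OF t_uniformizer u'])
qed

text \<open>
  Division by one member of the family turns this member into the constant \<open>1\<close>, and differentiation
  removes it. The remaining members have orders at \<open>b\<close> which are again distinct in the ground field,
  while the order of vanishing of a combination at a general point has dropped by one, so induction
  applies. In other words, the Wronskian of the family is nonzero, since its leading coefficient at
  \<open>b\<close> is a Vandermonde determinant in the orders; the induction avoids determinants.
\<close>

theorem generic_vanishing:
  assumes "finite I" "op W" "W \<noteq> {}" "W \<subseteq> U"
    and "\<And>i. i \<in> I \<Longrightarrow> f i \<in> regular_on X W" "\<And>i. i \<in> I \<Longrightarrow> has_order b (f i) (e i)"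
    and "\<And>i j. i \<in> I \<Longrightarrow> j \<in> I \<Longrightarrow> i \<noteq> j \<Longrightarrow> of_int (e i - e j) \<noteq> (0::'k)"
  shows "\<exists>W'. op W' \<and> W' \<noteq> {} \<and> W' \<subseteq> W \<and>
    (\<forall>Q\<in>W'. \<forall>c. vanishes Q (card I) (\<lambda>x. \<Sum>i\<in>I. c i * f i x) \<longrightarrow> (\<forall>i\<in>I. c i = 0))"
  using assms
proof (induction I arbitrary: W f e rule: finite_induct)
  case empty
  then show ?case by (intro exI[of _ W]) auto
next
  case (insert k I)
  note W = insert.prems(1-3) and f = insert.prems(4) and ord = insert.prems(5) and dist = insert.prems(6)
  define W1 where "W1 = {x \<in> W. f k x \<noteq> 0}"
  have o1: "op W1" unfolding W1_def by (rule reg_nonvanishing_open[OF W(1) f]) simp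
  have W1W: "W1 \<subseteq> W" by (auto simp: W1_def)
  have ne1: "W1 \<noteq> {}"
    using has_order_not_zero[OF ord[of k]] W unfolding W1_def gen_eq_def by auto
  have fW1: "f i \<in> regular_on X W1" if "i \<in> insert k I" for i
    by (rule reg_restrict[OF W(1) o1 W1W f[OF that]])
  define g where "g i x = f i x * inverse (f k x)" for i x
  have inv: "(\<lambda>x. inverse (f k x)) \<in> regular_on X W1"
    by (rule reg_inverse[OF o1 fW1]) (auto simp: W1_def)
  have g: "g i \<in> regular_on X W1" if "i \<in> I" for i
    unfolding g_def by (rule reg_mult[OF o1 fW1 inv]) (use that in auto)
  have ordg: "has_order b (g i) (e i + - e k)" if "i \<in> I" for i
    unfolding g_def by (intro has_order_mult has_order_inverse ord) (use that in auto)
  have ordD: "has_order b (\<delta> (g i)) (e i - e k - 1)" if "i \<in> I" for i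
    using has_order_deriv[OF o1 ne1 g[OF that] ordg[OF that]] dist[of i k] that insert.hyps by auto
  have D: "\<delta> (g i) \<in> regular_on X W1" if "i \<in> I" for i
    by (rule reg_of_at[OF o1], rule deriv_regular)
      (use W1W W(3) regular_atI[OF o1 _ g[OF that]] in auto)
  have "\<exists>W'. op W' \<and> W' \<noteq> {} \<and> W' \<subseteq> W1 \<and>
    (\<forall>Q\<in>W'. \<forall>c. vanishes Q (card I) (\<lambda>x. \<Sum>i\<in>I. c i * \<delta> (g i) x) \<longrightarrow> (\<forall>i\<in>I. c i = 0))"
    by (rule insert.IH[where e="\<lambda>i. e i - e k - 1", OF o1 ne1 _ D ordD])
      (use W1W W(3) dist in \<open>auto\<close>)
  then obtain W' where W': "op W'" "W' \<noteq> {}" "W' \<subseteq> W1"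
    and van: "\<And>Q c. Q \<in> W' \<Longrightarrow> vanishes Q (card I) (\<lambda>x. \<Sum>i\<in>I. c i * \<delta> (g i) x) \<Longrightarrow> \<forall>i\<in>I. c i = 0" by blast
  have "\<forall>i\<in>insert k I. c i = 0"
    if Q: "Q \<in> W'" and v: "vanishes Q (card (insert k I)) (\<lambda>x. \<Sum>i\<in>insert k I. c i * f i x)" for Q c
  proof -
    have QW: "Q \<in> W1" "Q \<in> U" using Q W'(3) W1W W(3) by auto
    note QP = U_points[OF QW(2)]
    have at: "f i \<in> \<O> Q" if "i \<in> insert k I" for i using regular_atI[OF o1 QW(1) fW1[OF that]] .
    have gat: "g i \<in> \<O> R" if "i \<in> I" "R \<in> W1" for i R using regular_atI[OF o1 that(2) g[OF that(1)]] .
    define F where "F x = c k + (\<Sum>i\<in>I. c i * g i x)" for x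
    have F: "F \<in> \<O> Q"
      unfolding F_def by (intro at_add at_const at_sum QP at_cmult gat QW)
    have v': "vanishes Q (Suc (card I)) F"
    proof (rule vanishes_cong)
      show "vanishes Q (Suc (card I)) (\<lambda>x. (\<Sum>i\<in>insert k I. c i * f i x) * inverse (f k x))"
        using vanishes_mult[OF v regular_atI[OF o1 QW(1) inv]] insert.hyps by simp
      show "eventually (\<lambda>x. F x = (\<Sum>i\<in>insert k I. c i * f i x) * inverse (f k x)) generic"
        using generic_openI[OF o1 ne1]
      proof eventually_elim
        case (elim x)
        then have "f k x \<noteq> 0" by (simp add: W1_def)
        then show ?case
          using insert.hyps by (simp add: F_def g_def distrib_right sum_distrib_right mult.assoc)
      qed
    qed
    have "vanishes Q (card I) (\<lambda>x. \<Sum>i\<in>I. c i * \<delta> (g i) x)"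
    proof (rule vanishes_cong[OF vanishes_deriv[OF QW(2) F v']])
      show "eventually (\<lambda>x. (\<Sum>i\<in>I. c i * \<delta> (g i) x) = \<delta> F x) generic"
        using generic_openI[OF o1 ne1]
      proof eventually_elim
        case (elim x)
        then have x: "x \<in> U" using W1W W(3) by auto
        have s: "(\<lambda>x. \<Sum>i\<in>I. c i * g i x) \<in> \<O> x"
          using elim by (intro at_sum U_points x at_cmult gat)
        have "\<delta> F x = (\<Sum>i\<in>I. \<delta> (\<lambda>x. c i * g i x) x)"
          unfolding F_def deriv_add[OF x at_const[OF U_points[OF x]] s] deriv_const[OF x]
          using elim by (subst deriv_sum[OF x]) (auto intro: at_cmult gat)
        also have "\<dots> = (\<Sum>i\<in>I. c i * \<delta> (g i) x)"
          by (intro sum.cong refl deriv_scale[OF x] gat elim)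
        finally show ?case by simp
      qed
    qed
    then have c: "\<forall>i\<in>I. c i = 0" by (rule van[OF Q])
    have "F Q = 0" by (rule vanishes_at[OF v' F])
    then show ?thesis using c by (simp add: F_def)
  qed
  then show ?case using W' W1W by (intro exI[of _ W']) auto
qed

end


section \<open>Functions with a single pole on a proper curve\<close>

context irreducible_prevariety
begin

lemma open_minus_point: "op (points X - {b})"
proof (subst openin_subopen, rule ballI)
  fix x assume x: "x \<in> points X - {b}"
  obtain U n \<phi> where U: "x \<in> U" "chart X U n \<phi>" using prevariety_chart[OF prevar, of x] x by blast
  note c = chartD[OF U(2)]
  have UX: "U \<subseteq> points X" using openin_subset[OF c(1)] .
  show "\<exists>T. op T \<and> x \<in> T \<and> T \<subseteq> points X - {b}"
  proof (cases "b \<in> U")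
    case False
    then show ?thesis using U(1) c(1) UX by blast
  next
    case True
    have "\<phi> x \<noteq> \<phi> b" using inj_onD[OF c(2) _ U(1) True] x by auto
    then obtain i where i: "i < n" "\<phi> x i \<noteq> \<phi> b i"
      using c(3)[OF U(1)] c(3)[OF True] unfolding affine_space_def
      by (metis PiE_ext lessThan_iff)
    have "(\<lambda>a. a i + - \<phi> b i) \<in> poly_funs n"
      by (rule poly_funs.add[OF poly_funs.coord[OF i(1)] poly_funs.const])
    from c(4)[OF this] have "op {y \<in> U. \<phi> y i + - \<phi> b i \<noteq> 0}" .
    then show ?thesis using U(1) UX i(2) by (intro exI[of _ "{y \<in> U. \<phi> y i + - \<phi> b i \<noteq> 0}"]) auto
  qed
qed

end

context smooth_curve
begin

lemma minus_point_nonempty: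
  assumes "b \<in> points X"
  shows "points X - {b} \<noteq> {}"
proof -
  obtain t v where t: "uniformizer X b t" using uniformizer_exists[OF assms] by blast
  obtain V where V: "op V" "V \<noteq> {}" "\<forall>x\<in>V. t x \<noteq> 0"
    using uniformizer_nonzero[OF t] unfolding eventually_generic by blast
  then obtain x where "x \<in> V" by blast
  then have "x \<in> points X" "x \<noteq> b" using V openin_subset[OF V(1)] uniformizerD(2)[OF t] by auto
  then show ?thesis by blast
qed

text \<open>The constant \<open>c\<close> is the quotient of the leading coefficients at \<open>P\<close>.\<close>

lemma has_order_diff:
  assumes f: "has_order P f n" and g: "has_order P g n"
  obtains c where "gen_eq X (\<lambda>x. f x - c * g x) (\<lambda>_. 0) \<or> (\<exists>m>n. has_order P (\<lambda>x. f x - c * g x) m)"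
proof -
  obtain t where t: "uniformizer X P t" using f by (auto simp: has_order_def)
  note tP = uniformizerD[OF t]
  obtain u where u: "u \<in> \<O> P" "u P \<noteq> 0" "eventually (\<lambda>x. f x = u x * t x powi n) generic"
    using has_orderE[OF f t] .
  obtain w where w: "w \<in> \<O> P" "w P \<noteq> 0" "eventually (\<lambda>x. g x = w x * t x powi n) generic"
    using has_orderE[OF g t] .
  define c where "c = u P / w P"
  define s where "s x = u x - c * w x" for x
  have s: "s \<in> \<O> P" "s P = 0"
    unfolding s_def by (intro at_diff at_cmult u w) (use w(2) in \<open>simp add: c_def\<close>)
  obtain h where h: "h \<in> \<O> P" "eventually (\<lambda>x. s x = h x * t x) generic"
    using tP(4)[OF s] by (auto simp: gen_eq_iff)
  have eq: "eventually (\<lambda>x. f x - c * g x = h x * t x powi (1 + n)) generic"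
    using u(3) w(3) h(2) uniformizer_nonzero[OF t]
  proof eventually_elim
    case (elim x)
    have "f x - c * g x = s x * t x powi n" using elim by (simp add: s_def algebra_simps)
    then show ?case using elim by (simp add: power_int_add mult.assoc)
  qed
  show ?thesis
  proof (rule that)
    show "gen_eq X (\<lambda>x. f x - c * g x) (\<lambda>_. 0) \<or> (\<exists>m>n. has_order P (\<lambda>x. f x - c * g x) m)"
    proof (cases "gen_eq X h (\<lambda>_. 0)")
      case True
      then have "eventually (\<lambda>x. h x = 0) generic" by (simp add: gen_eq_iff)
      then have "gen_eq X (\<lambda>x. f x - c * g x) (\<lambda>_. 0)"
        using eq unfolding gen_eq_iff by eventually_elim simp
      then show ?thesis ..
    next
      case False
      then obtain k where k: "has_order P h (int k)" using has_order_regular[OF h(1)] by blast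
      have "has_order P (\<lambda>x. t x powi (1 + n)) (1 + n)"
        by (rule has_orderI[OF t at_const[OF tP(3), of 1]]) auto
      from has_order_cong[OF eq has_order_mult[OF k this]]
      have "has_order P (\<lambda>x. f x - c * g x) (int k + (1 + n))" .
      then show ?thesis by (intro disjI2 exI[of _ "int k + (1 + n)"]) auto
    qed
  qed
qed

end

locale proper_curve = smooth_curve X for X :: "('a, 'k::field) fun_space" +
  assumes proper: "proper_variety X"
begin

text \<open>
  The projection of the closed set \<open>{(x, y). f x * y = 1}\<close> to the affine line is closed and does not
  contain \<open>0\<close>, hence it is finite. So \<open>f\<close> takes only finitely many values.
\<close>

theorem global_regular_constant:
  assumes f: "f \<in> regular_on X (points X)"
  shows "\<exists>c. \<forall>x\<in>points X. f x = c"
proof -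
  define Y :: "(nat \<Rightarrow> 'k, 'k) fun_space" where "Y = affine_alg_set 1 (affine_space 1)"
  have cl: "closedin (zariski 1) (affine_space 1 :: (nat \<Rightarrow> 'k) set)"
    using closedin_topspace[of "zariski 1 :: (nat \<Rightarrow> 'k) topology"] by simp
  have varY: "variety Y" unfolding Y_def by (rule variety_affine_alg_set[OF cl])
  have shY: "sheaf_of_functions Y" unfolding Y_def by (rule sheaf_of_functions_affine_alg_set)
  have ptY: "points Y = affine_space 1" unfolding Y_def by (rule topspace_affine_alg_set) simp
  have topY: "top_of Y = zariski 1"
    unfolding Y_def affine_alg_set_def using subtopology_topspace[of "zariski 1 :: (nat \<Rightarrow> 'k) topology"] by simp
  have oY: "openin (top_of Y) (points Y)" by simp
  have oX: "op (points X)" by simp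
  have coord: "(\<lambda>a. a 0) \<in> regular_on Y (points Y)"
    unfolding Y_def
    by (rule affine_alg_set_regular_frac[of _ _ _ "\<lambda>a. a 0" "\<lambda>_. 1"])
      (use oY in \<open>auto intro: poly_funs.intros simp: Y_def affine_alg_set_def\<close>)
  define C where "C = {(x, y). x \<in> points X \<and> y \<in> points Y \<and> f x * y 0 = 1}"
  \<comment> \<open>The sum is \<open>f x * y 0 - 1\<close>, in the form in which the product topology is generated.\<close>
  define E where "E = {(x, y). x \<in> points X \<and> y \<in> points Y \<and>
      (\<Sum>i<(2::nat). (if i = 0 then f else (\<lambda>_. -1)) x * (if i = 0 then (\<lambda>a. a 0) else (\<lambda>_. 1)) y) \<noteq> 0}"
  have "openin (zariski_prod X Y) E"
    unfolding E_def using f coord reg_const[OF oX] sheaf_ring(1)[OF shY oY]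
    by (intro openin_zariski_prod_nonvanishing oX oY) auto
  moreover have "points X \<times> points Y - C = E"
    unfolding C_def E_def by (auto simp: numeral_2_eq_2)
  moreover have "C \<subseteq> points X \<times> points Y" unfolding C_def by blast
  ultimately have "closedin (zariski_prod X Y) C"
    unfolding closedin_def topspace_zariski_prod[OF sh shY] by simp
  then have cC: "closedin (top_of Y) (snd ` C)"
    using proper varY unfolding proper_variety_def closed_map_def by blast
  define z :: "nat \<Rightarrow> 'k" where "z = (\<lambda>i\<in>{..<1}. 0)"
  have z: "z \<in> points Y - snd ` C"
    unfolding ptY by (auto simp: z_def affine_space_def C_def)
  have "openin (zariski 1) (points Y - snd ` C)"
    using cC unfolding topY[symmetric] by blast
  from zariski_basis[OF this z] obtain F
    where F: "F \<in> poly_funs 1" "F z \<noteq> 0" "{x \<in> affine_space 1. F x \<noteq> 0} \<subseteq> points Y - snd ` C"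
    by (elim bexE conjE)
  have "snd ` C \<subseteq> {x \<in> affine_space 1. F x = 0}"
  proof
    fix y assume y: "y \<in> snd ` C"
    then obtain x where "(x, y) \<in> C" by auto
    then have "y \<in> points Y" by (simp add: C_def)
    then have "y \<in> affine_space 1" using ptY by simp
    then show "y \<in> {x \<in> affine_space 1. F x = 0}" using subsetD[OF F(3), of y] y by blast
  qed
  then have "finite (snd ` C)" by (rule finite_subset[OF _ finite_zeros_affine_line[OF F(1,2)]])
  define V where "V = insert 0 ((\<lambda>y. inverse (y 0)) ` snd ` C)"
  have fin: "finite V" unfolding V_def using \<open>finite (snd ` C)\<close> by blast
  have val: "f x \<in> V" if x: "x \<in> points X" for x
  proof (cases "f x = 0")
    case False
    define y :: "nat \<Rightarrow> 'k" where "y = (\<lambda>i\<in>{..<1}. inverse (f x))"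
    have "(x, y) \<in> C" using False x by (simp add: C_def y_def ptY affine_space_def)
    then have "y \<in> snd ` C" by force
    then have "inverse (y 0) \<in> V" unfolding V_def by blast
    then show ?thesis by (simp add: y_def)
  qed (simp add: V_def)
  have "\<exists>c\<in>V. \<not> eventually (\<lambda>x. f x \<noteq> c) generic"
  proof (rule ccontr)
    assume "\<not> ?thesis"
    then have "eventually (\<lambda>x. \<forall>c\<in>V. f x \<noteq> c) generic"
      by (intro eventually_ball_finite[OF fin]) blast
    moreover have "eventually (\<lambda>x. x \<in> points X) generic"
      using points_nonempty by (intro generic_openI oX)
    ultimately have "eventually (\<lambda>x. False) generic" by eventually_elim (use val in blast)
    then show False using generic_not_bot by (simp add: trivial_limit_def)
  qed
  then obtain c where c: "\<not> eventually (\<lambda>x. f x \<noteq> c) generic" by blast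
  have "op {x \<in> points X. f x - c \<noteq> 0}"
    by (intro reg_nonvanishing_open reg_diff f reg_const oX)
  then have "{x \<in> points X. f x - c \<noteq> 0} = {}"
    using c unfolding eventually_generic by auto
  then show ?thesis by auto
qed

end

locale pointed_curve = proper_curve X for X :: "('a, 'k::field) fun_space" +
  fixes b :: 'a
  assumes base_point: "b \<in> points X"
begin

abbreviation "X' \<equiv> points X - {b}"

lemma reg_X'_zero:
  assumes "f \<in> regular_on X X'" "\<And>x. x \<notin> X' \<Longrightarrow> f x = 0" "gen_eq X f (\<lambda>_. 0)"
  shows "f = (\<lambda>_. 0)"
proof
  fix x
  show "f x = 0"
    by (cases "x \<in> X'")
      (use assms reg_eqI[OF open_minus_point assms(1) reg_const[OF open_minus_point] assms(3)] in auto)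
qed

lemma pole_space_iff:
  "f \<in> pole_space X b N \<longleftrightarrow> f \<in> regular_on X X' \<and> (\<forall>x. x \<notin> X' \<longrightarrow> f x = 0) \<and>
     (f = (\<lambda>_. 0) \<or> (\<exists>n \<ge> - int N. has_order b f n))"
proof -
  have *: "(gen_eq X f (\<lambda>_. 0) \<or> ord_at X b f \<ge> - int N) \<longleftrightarrow> (f = (\<lambda>_. 0) \<or> (\<exists>n \<ge> - int N. has_order b f n))"
    if f: "f \<in> regular_on X X'" and "\<forall>x. x \<notin> X' \<longrightarrow> f x = 0"
  proof (cases "gen_eq X f (\<lambda>_. 0)")
    case True
    have "f = (\<lambda>_. 0)" by (rule reg_X'_zero[OF f _ True]) (use that(2) in blast)
    then show ?thesis using True by simp
  next
    case False
    have "f \<in> rational_funs X"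
      unfolding rational_funs_def using f open_minus_point minus_point_nonempty[OF base_point] by blast
    from has_order_exists[OF base_point this False]
    have "has_order b f n \<longleftrightarrow> n = ord_at X b f" for n using has_order_unique by blast
    moreover have "f \<noteq> (\<lambda>_. 0)" using False by (auto simp: gen_eq_iff)
    ultimately show ?thesis using False by auto
  qed
  then show ?thesis unfolding pole_space_def by blast
qed

text \<open>
  A function of positive order at \<open>b\<close> is regular there if it is given the value \<open>0\<close>, which is the
  value that the functions in \<^const>\<open>pole_space\<close> have at \<open>b\<close> by normalisation. Then it is regular
  everywhere, hence constant, hence zero.
\<close>

lemma order_nonpos:
  assumes f: "f \<in> pole_space X b N" and ord: "has_order b f n"
  shows "n \<le> 0"
proof (rule ccontr)
  assume "\<not> n \<le> 0"
  have reg: "f \<in> regular_on X X'" and zero: "\<And>x. x \<notin> X' \<Longrightarrow> f x = 0"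
    using f by (auto simp: pole_space_iff)
  obtain t v where t: "uniformizer X b t" using uniformizer_exists[OF base_point] by blast
  note tb = uniformizerD[OF t]
  obtain u where u: "u \<in> \<O> b" "u b \<noteq> 0" "eventually (\<lambda>x. f x = u x * t x powi n) generic"
    using has_orderE[OF ord t] .
  define g where "g x = u x * t x ^ nat n" for x
  have g: "g \<in> \<O> b" unfolding g_def by (intro at_mult at_power u tb)
  have gb: "g b = 0" using \<open>\<not> n \<le> 0\<close> tb(2) by (simp add: g_def)
  have fg: "gen_eq X f g"
    using u(3) \<open>\<not> n \<le> 0\<close> by (simp add: gen_eq_iff g_def power_int_def)
  obtain V where V: "op V" "b \<in> V" "g \<in> regular_on X V" using g by (rule regular_atE)
  have o: "op (V \<inter> X')" using V(1) open_minus_point by blast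
  have "f x = g x" if "x \<in> V" for x
  proof (cases "x = b")
    case True
    then show ?thesis using gb zero by simp
  next
    case False
    then have "x \<in> V \<inter> X'" using that openin_subset[OF V(1)] by blast
    then show ?thesis
      using reg_eqI[OF o reg_restrict[OF open_minus_point o _ reg] reg_restrict[OF V(1) o _ V(3)] fg] by blast
  qed
  then have "f \<in> regular_on X V" by (rule reg_cong[OF V(1,3)])
  then have fb: "f \<in> \<O> b" by (rule regular_atI[OF V(1,2)])
  have "f \<in> regular_on X (points X)"
  proof (rule reg_of_at)
    fix Q assume "Q \<in> points X"
    then show "f \<in> \<O> Q"
      using fb regular_atI[OF open_minus_point _ reg, of Q] by (cases "Q = b") auto
  qed simp
  then obtain c where "\<forall>x\<in>points X. f x = c" using global_regular_constant by blast
  then have "\<forall>x\<in>points X. f x = 0" using zero[of b] base_point by simp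
  then have "gen_eq X f (\<lambda>_. 0)"
    unfolding gen_eq_def using points_nonempty openin_topspace by blast
  then show False using has_order_not_zero[OF ord] by blast
qed

lemma pole_space_diff:
  assumes f: "f \<in> pole_space X b N" "has_order b f n" and g: "g \<in> pole_space X b N" "has_order b g n"
  obtains c where "(\<lambda>x. f x - c * g x) \<in> pole_space X b N"
    "(\<lambda>x. f x - c * g x) = (\<lambda>_. 0) \<or> (\<exists>m>n. has_order b (\<lambda>x. f x - c * g x) m)"
proof -
  obtain c where c: "gen_eq X (\<lambda>x. f x - c * g x) (\<lambda>_. 0) \<or> (\<exists>m>n. has_order b (\<lambda>x. f x - c * g x) m)"
    using has_order_diff[OF f(2) g(2)] .
  have reg: "(\<lambda>x. f x - c * g x) \<in> regular_on X X'"
    using f(1) g(1) by (intro reg_diff reg_mult reg_const open_minus_point) (auto simp: pole_space_iff)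
  have zero: "f x - c * g x = 0" if "x \<notin> X'" for x
    using f(1) g(1) that by (simp add: pole_space_iff)
  have 2: "(\<lambda>x. f x - c * g x) = (\<lambda>_. 0) \<or> (\<exists>m>n. has_order b (\<lambda>x. f x - c * g x) m)"
  proof (cases "gen_eq X (\<lambda>x. f x - c * g x) (\<lambda>_. 0)")
    case True
    then show ?thesis using reg_X'_zero[OF reg zero True] by simp
  next
    case False
    then show ?thesis using c by simp
  qed
  have "n \<ge> - int N"
    using f(1) has_order_unique[OF f(2)] has_order_not_zero[OF f(2)]
    unfolding pole_space_iff gen_eq_iff by auto
  then have "(\<lambda>x. f x - c * g x) \<in> pole_space X b N"
    unfolding pole_space_iff
  proof (intro conjI allI impI reg zero)
    show "(\<lambda>x. f x - c * g x) = (\<lambda>_. 0) \<or> (\<exists>m\<ge>- int N. has_order b (\<lambda>x. f x - c * g x) m)"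
      using 2
    proof (elim disjE exE conjE)
      fix m assume "m > n" "has_order b (\<lambda>x. f x - c * g x) m"
      then show ?thesis using \<open>n \<ge> - int N\<close> by (intro disjI2 exI[of _ m]) simp
    qed simp
  qed
  then show ?thesis using 2 by (rule that)
qed

text \<open>
  Subtracting multiples lowers pole orders, so one function for each pole order that occurs gives a
  spanning family. All these pole orders lie between \<open>0\<close> and \<open>N\<close>. Their differences are therefore
  nonzero in the ground field, and the result on generic vanishing applies. It also shows that the
  family is linearly independent, so that the number of its members is the dimension.
\<close>

theorem generic_osculation:
  assumes char: "\<And>n. 0 < n \<Longrightarrow> n \<le> N \<Longrightarrow> of_nat n \<noteq> (0::'k)"
  obtains Q where "Q \<in> points X" "Q \<noteq> b"
    "\<And>f. f \<in> pole_space X b N \<Longrightarrow> vanishes Q (pole_dim X b N) f \<Longrightarrow> f = (\<lambda>_. 0)"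
proof -
  let ?V = "pole_space X b N"
  define S where "S = {n. \<exists>f\<in>?V. has_order b f n}"
  have S: "- int N \<le> n \<and> n \<le> 0" if n: "n \<in> S" for n
  proof -
    obtain f where f: "f \<in> ?V" "has_order b f n" using n by (auto simp: S_def)
    have "f \<noteq> (\<lambda>_. 0)" using has_order_not_zero[OF f(2)] by (auto simp: gen_eq_iff)
    moreover obtain m where "m \<ge> - int N" "has_order b f m" using calculation f(1) unfolding pole_space_iff by blast
    ultimately show ?thesis using order_nonpos[OF f] has_order_unique[OF f(2)] by blast
  qed
  have "S \<subseteq> {- int N..0}" using S by auto
  then have finS: "finite S" by (rule finite_subset) simp
  have "\<forall>n. \<exists>f. n \<in> S \<longrightarrow> f \<in> ?V \<and> has_order b f n" by (auto simp: S_def)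
  from choice[OF this] obtain F where F: "\<And>n. n \<in> S \<Longrightarrow> F n \<in> ?V" "\<And>n. n \<in> S \<Longrightarrow> has_order b (F n) n" by blast
  define B where "B = F ` S"
  have finB: "finite B" unfolding B_def using finS by simp
  interpret vs: vector_space "fun_scale :: 'k \<Rightarrow> ('a \<Rightarrow> 'k) \<Rightarrow> 'a \<Rightarrow> 'k"
    by (rule vector_space_fun_scale)
  have span_step: "f \<in> vs.span B" if "f \<in> ?V" "has_order b f n" "n \<ge> - int k" for f n k
    using that
  proof (induction k arbitrary: f n rule: less_induct)
    case (less k)
    have n: "n \<in> S" using less.prems by (auto simp: S_def)
    obtain c where c: "(\<lambda>x. f x - c * F n x) \<in> ?V"
      "(\<lambda>x. f x - c * F n x) = (\<lambda>_. 0) \<or> (\<exists>m>n. has_order b (\<lambda>x. f x - c * F n x) m)"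
      using pole_space_diff[OF less.prems(1,2) F(1)[OF n] F(2)[OF n]] .
    have "(\<lambda>x. f x - c * F n x) \<in> vs.span B"
    proof (cases "(\<lambda>x. f x - c * F n x) = (\<lambda>_. 0)")
      case True
      then show ?thesis using vs.span_zero[of B] by (simp add: zero_fun_def)
    next
      case False
      then obtain m where m: "m > n" "has_order b (\<lambda>x. f x - c * F n x) m" using c(2) by blast
      have "m \<le> 0" by (rule order_nonpos[OF c(1) m(2)])
      then show ?thesis
        using less.IH[of "nat (- m)", OF _ c(1) m(2)] m(1) less.prems(3) by simp
    qed
    moreover have "(\<lambda>x. c * F n x) \<in> vs.span B"
      by (intro vs.span_scale vs.span_base) (use n in \<open>auto simp: B_def\<close>)
    ultimately have "(\<lambda>x. f x - c * F n x) + (\<lambda>x. c * F n x) \<in> vs.span B" by (rule vs.span_add)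
    then show ?case by (simp add: plus_fun_def)
  qed
  have span: "f \<in> vs.span B" if f: "f \<in> ?V" for f
  proof (cases "f = (\<lambda>_. 0)")
    case True
    then show ?thesis using vs.span_zero[of B] by (simp add: zero_fun_def)
  next
    case False
    then show ?thesis using f span_step[OF f] by (auto simp: pole_space_iff)
  qed
  obtain t v where t: "uniformizer X b t" using uniformizer_exists[OF base_point] by blast
  obtain U \<delta> where vf: "vector_field X b t U \<delta>" using vector_field_exists[OF t] .
  interpret vf: vector_field X b t U \<delta> by (rule vf)
  define W where "W = U \<inter> X'"
  have oW: "op W" unfolding W_def using vf.U_open open_minus_point by blast
  have neW: "W \<noteq> {}" unfolding W_def
    using open_meet[OF vf.U_open open_minus_point] vf.b_in_U minus_point_nonempty[OF base_point] by blast
  have ordB: "has_order b f (ord_at X b f) \<and> ord_at X b f \<in> S \<and> f = F (ord_at X b f)" if f: "f \<in> B" for f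
  proof -
    obtain n where "n \<in> S" "f = F n" using f by (auto simp: B_def)
    then show ?thesis using F(2)[of n] ord_at_eq[OF F(2)[of n]] by simp
  qed
  have dist: "of_int (ord_at X b f - ord_at X b g) \<noteq> (0::'k)" if "f \<in> B" "g \<in> B" "f \<noteq> g" for f g
  proof -
    define d where "d = ord_at X b f - ord_at X b g"
    have ne: "d \<noteq> 0" using ordB[OF that(1)] ordB[OF that(2)] that(3) by (auto simp: d_def)
    have le: "\<bar>d\<bar> \<le> int N" using S[of "ord_at X b f"] S[of "ord_at X b g"] ordB[OF that(1)] ordB[OF that(2)]
      by (auto simp: d_def)
    have "of_nat (nat \<bar>d\<bar>) \<noteq> (0::'k)" using ne le by (intro char) auto
    then have "of_int d \<noteq> (0::'k)" by (cases "d \<ge> 0") (auto simp: of_nat_nat abs_if)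
    then show ?thesis by (simp add: d_def)
  qed
  have "\<exists>W'. op W' \<and> W' \<noteq> {} \<and> W' \<subseteq> W \<and>
    (\<forall>Q\<in>W'. \<forall>c. vanishes Q (card B) (\<lambda>x. \<Sum>f\<in>B. c f * f x) \<longrightarrow> (\<forall>f\<in>B. c f = 0))"
  proof (rule vf.generic_vanishing[OF finB oW neW _ _ _ dist])
    show "W \<subseteq> U" by (simp add: W_def)
    fix f assume f: "f \<in> B"
    then show "has_order b f (ord_at X b f)" using ordB by blast
    have "f \<in> regular_on X X'" using f F(1) by (auto simp: B_def pole_space_iff)
    then show "f \<in> regular_on X W" by (rule reg_restrict[OF open_minus_point oW, rotated]) (auto simp: W_def)
  qed
  then obtain W' where W': "op W'" "W' \<noteq> {}" "W' \<subseteq> W"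
    and van: "\<And>Q c. Q \<in> W' \<Longrightarrow> vanishes Q (card B) (\<lambda>x. \<Sum>f\<in>B. c f * f x) \<Longrightarrow> \<forall>f\<in>B. c f = 0" by blast
  obtain Q where Q: "Q \<in> W'" using W'(2) by blast
  then have QX: "Q \<in> points X" "Q \<noteq> b" using W'(3) by (auto simp: W_def)
  obtain \<tau> v' where tau: "uniformizer X Q \<tau>" using uniformizer_exists[OF QX(1)] by blast
  have van0: "vanishes Q k (\<lambda>_. 0)" for k
    unfolding vanishes_def using tau at_const[OF QX(1), of 0] by (intro exI[of _ \<tau>] exI[of _ "\<lambda>_. 0"]) simp
  have sum_fun: "(\<Sum>f\<in>B. fun_scale (c f) f) = (\<lambda>x. \<Sum>f\<in>B. c f * f x)" for c :: "('a \<Rightarrow> 'k) \<Rightarrow> 'k"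
  proof
    fix x
    show "(\<Sum>f\<in>B. fun_scale (c f) f) x = (\<Sum>f\<in>B. c f * f x)"
      using finB by (induction B rule: finite_induct) auto
  qed
  have indep: "vs.independent B"
  proof
    assume "vs.dependent B"
    then obtain c where c: "\<exists>f\<in>B. c f \<noteq> 0" "(\<Sum>f\<in>B. fun_scale (c f) f) = 0"
      unfolding vs.dependent_finite[OF finB] by blast
    then have "(\<lambda>x. \<Sum>f\<in>B. c f * f x) = (\<lambda>_. 0)" unfolding sum_fun by (simp add: zero_fun_def)
    then have "\<forall>f\<in>B. c f = 0" using van[OF Q, of c] van0 by simp
    then show False using c(1) by blast
  qed
  have "vs.dim ?V = card B"
  proof (rule vs.dim_unique)
    show "B \<subseteq> ?V" using F(1) by (auto simp: B_def)
  qed (use span indep in auto)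
  then have dim: "pole_dim X b N = card B" by (simp add: pole_dim_def)
  show ?thesis
  proof (rule that[OF QX])
    fix f assume f: "f \<in> ?V" and v: "vanishes Q (pole_dim X b N) f"
    obtain c where c: "f = (\<Sum>f\<in>B. fun_scale (c f) f)"
      using span[OF f] unfolding vs.span_finite[OF finB] by blast
    have "\<forall>f\<in>B. c f = 0" using van[OF Q, of c] v unfolding dim c sum_fun .
    then show "f = (\<lambda>_. 0)" unfolding c sum_fun by simp
  qed
qed

end


section \<open>Divisor classes\<close>

lemma hom_finprod_interval:
  assumes G: "comm_group G" and K: "comm_group K" and h: "h \<in> hom G K"
    and x: "\<And>i. x i \<in> carrier G"
  shows "finprod K (\<lambda>i. h (x i)) {1..(n::nat)} = h (finprod G x {1..n})"
proof -
  interpret G: comm_group G by (rule G)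
  interpret K: comm_group K by (rule K)
  have hc: "h y \<in> carrier K" if "y \<in> carrier G" for y using h that by (auto simp: hom_def)
  show ?thesis
  proof (induction n)
    case 0
    show ?case using hom_one[OF h G.is_group K.is_group] by simp
  next
    case (Suc n)
    have ins: "{1..Suc n} = insert (Suc n) {1..n}" by auto
    have "finprod K (\<lambda>i. h (x i)) {1..Suc n} = h (x (Suc n)) \<otimes>\<^bsub>K\<^esub> finprod K (\<lambda>i. h (x i)) {1..n}"
      unfolding ins by (rule K.finprod_insert) (auto intro: hc x)
    also have "\<dots> = h (x (Suc n) \<otimes>\<^bsub>G\<^esub> finprod G x {1..n})"
      unfolding Suc.IH by (rule hom_mult[OF h, symmetric]) (auto intro!: x G.finprod_closed)
    also have "x (Suc n) \<otimes>\<^bsub>G\<^esub> finprod G x {1..n} = finprod G x {1..Suc n}"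
      unfolding ins by (rule G.finprod_insert[symmetric]) (auto intro: x)
    finally show ?case .
  qed
qed

lemma Div0_iff:
  "D \<in> carrier (Div0 X) \<longleftrightarrow> finite {P. D P \<noteq> 0} \<and> {P. D P \<noteq> 0} \<subseteq> points X \<and> (\<Sum>P | D P \<noteq> 0. D P) = 0"
  by (simp add: Div0_def)

lemma Div0I:
  assumes "finite A" "A \<subseteq> points X" "\<And>P. P \<notin> A \<Longrightarrow> D P = 0" "(\<Sum>P\<in>A. D P) = 0"
  shows "D \<in> carrier (Div0 X)"
proof -
  have sub: "{P. D P \<noteq> 0} \<subseteq> A" using assms(3) by blast
  have "(\<Sum>P | D P \<noteq> 0. D P) = (\<Sum>P\<in>A. D P)"
    by (rule sum.mono_neutral_left[OF assms(1) sub]) auto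
  then show ?thesis unfolding Div0_iff using assms sub finite_subset by auto
qed

lemma Div0_simps: "D \<otimes>\<^bsub>Div0 X\<^esub> E = D + E" "\<one>\<^bsub>Div0 X\<^esub> = 0"
  by (simp_all add: Div0_def)

lemma Div0_minus: "D \<in> carrier (Div0 X) \<Longrightarrow> - D \<in> carrier (Div0 X)"
  by (simp add: Div0_iff sum_negf)

lemma comm_group_Div0: "comm_group (Div0 X)"
proof (rule comm_groupI)
  fix D E assume D: "D \<in> carrier (Div0 X)" and E: "E \<in> carrier (Div0 X)"
  let ?A = "{P. D P \<noteq> 0} \<union> {P. E P \<noteq> 0}"
  have fin: "finite ?A" using D E by (simp add: Div0_iff)
  have "(\<Sum>P\<in>?A. D P) = (\<Sum>P | D P \<noteq> 0. D P)" "(\<Sum>P\<in>?A. E P) = (\<Sum>P | E P \<noteq> 0. E P)"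
    by (rule sum.mono_neutral_right[OF fin], auto)+
  then have "(\<Sum>P\<in>?A. (D + E) P) = 0" using D E by (simp add: sum.distrib Div0_iff)
  then show "D \<otimes>\<^bsub>Div0 X\<^esub> E \<in> carrier (Div0 X)"
    unfolding Div0_simps using fin D E by (intro Div0I[of ?A]) (auto simp: Div0_iff)
  show "D \<otimes>\<^bsub>Div0 X\<^esub> E = E \<otimes>\<^bsub>Div0 X\<^esub> D" unfolding Div0_simps by (rule add.commute)
next
  fix D assume D: "D \<in> carrier (Div0 X)"
  then show "\<exists>E\<in>carrier (Div0 X). E \<otimes>\<^bsub>Div0 X\<^esub> D = \<one>\<^bsub>Div0 X\<^esub>"
    using Div0_minus[OF D] by (intro bexI[of _ "- D"]) (simp_all add: Div0_simps)
qed (auto simp: Div0_simps add.assoc Div0_iff)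

lemma Div0_inv:
  assumes "D \<in> carrier (Div0 X)"
  shows "inv\<^bsub>Div0 X\<^esub> D = - D"
proof -
  interpret comm_group "Div0 X" by (rule comm_group_Div0)
  show ?thesis by (rule inv_equality[OF _ assms Div0_minus[OF assms]]) (simp add: Div0_simps)
qed

lemma Div0_pow: "(D [^]\<^bsub>Div0 X\<^esub> (n::nat)) P = int n * D P"
proof (induction n)
  case 0
  show ?case by (simp add: Div0_simps nat_pow_def)
next
  case (Suc n)
  have "D [^]\<^bsub>Div0 X\<^esub> Suc n = D [^]\<^bsub>Div0 X\<^esub> n \<otimes>\<^bsub>Div0 X\<^esub> D" by (simp add: nat_pow_def)
  then show ?case using Suc by (simp add: Div0_simps algebra_simps)
qed

lemma Div0_finprod:
  assumes "\<And>i. D i \<in> carrier (Div0 X)"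
  shows "finprod (Div0 X) D {1..(n::nat)} P = (\<Sum>i=1..n. D i P)"
proof (induction n)
  case 0
  interpret comm_group "Div0 X" by (rule comm_group_Div0)
  show ?case by (simp add: Div0_simps)
next
  case (Suc n)
  interpret comm_group "Div0 X" by (rule comm_group_Div0)
  have ins: "{1..Suc n} = insert (Suc n) {1..n}" by auto
  have "finprod (Div0 X) D {1..Suc n} = D (Suc n) \<otimes>\<^bsub>Div0 X\<^esub> finprod (Div0 X) D {1..n}"
    unfolding ins by (rule finprod_insert) (auto intro: assms)
  then show ?case using Suc by (simp add: Div0_simps)
qed

lemma point_divisor_diff_Div0:
  assumes "P \<in> points X" "b \<in> points X"
  shows "point_divisor P - point_divisor b \<in> carrier (Div0 X)"
proof (rule Div0I[of "{P, b}"])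
  show "(\<Sum>Q\<in>{P, b}. (point_divisor P - point_divisor b) Q) = 0"
    by (cases "P = b") (auto simp: point_divisor_def)
qed (use assms in \<open>auto simp: point_divisor_def\<close>)

context smooth_curve
begin

abbreviation "principal_Div0 \<equiv> principal_divisors X \<inter> carrier (Div0 X)"

lemma principal_divisorsI:
  assumes "f \<in> rational_funs X" "\<not> gen_eq X f (\<lambda>_. 0)" "\<And>P. P \<in> points X \<Longrightarrow> has_order P f (D P)"
    "\<And>P. P \<notin> points X \<Longrightarrow> D P = 0"
  shows "D \<in> principal_divisors X"
proof -
  have "D = (\<lambda>P. if P \<in> points X then ord_at X P f else 0)"
    using ord_at_eq[OF assms(3)] assms(4) by (auto simp: fun_eq_iff)
  then show ?thesis unfolding principal_divisors_def using assms(1,2) by blast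
qed

lemma principal_divisorsE:
  assumes "D \<in> principal_divisors X"
  obtains f where "f \<in> rational_funs X" "\<not> gen_eq X f (\<lambda>_. 0)" "\<And>P. P \<in> points X \<Longrightarrow> has_order P f (D P)"
    "\<And>P. P \<notin> points X \<Longrightarrow> D P = 0"
proof -
  obtain f where f: "D = (\<lambda>P. if P \<in> points X then ord_at X P f else 0)" "f \<in> rational_funs X"
    "\<not> gen_eq X f (\<lambda>_. 0)" using assms unfolding principal_divisors_def by blast
  show ?thesis by (rule that[OF f(2,3)]) (use has_order_exists[OF _ f(2,3)] in \<open>auto simp: f(1)\<close>)
qed

lemma rational_mult:
  assumes "f \<in> rational_funs X" "g \<in> rational_funs X"
  shows "(\<lambda>x. f x * g x) \<in> rational_funs X"
proof -
  obtain U V where U: "op U" "U \<noteq> {}" "f \<in> regular_on X U" and V: "op V" "V \<noteq> {}" "g \<in> regular_on X V"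
    using assms by (auto simp: rational_funs_def)
  have o: "op (U \<inter> V)" using U V by blast
  have "(\<lambda>x. f x * g x) \<in> regular_on X (U \<inter> V)"
    by (intro reg_mult o reg_restrict[OF U(1) o _ U(3)] reg_restrict[OF V(1) o _ V(3)]) auto
  then show ?thesis unfolding rational_funs_def using o open_meet[OF U(1) V(1) U(2) V(2)] by blast
qed

lemma rational_inverse:
  assumes "f \<in> rational_funs X" "\<not> gen_eq X f (\<lambda>_. 0)"
  shows "(\<lambda>x. inverse (f x)) \<in> rational_funs X"
proof -
  obtain U where U: "op U" "U \<noteq> {}" "f \<in> regular_on X U" using assms by (auto simp: rational_funs_def)
  let ?V = "{x \<in> U. f x \<noteq> 0}"
  have o: "op ?V" by (rule reg_nonvanishing_open[OF U(1,3)])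
  have ne: "?V \<noteq> {}" using assms(2) U unfolding gen_eq_def by auto
  have "(\<lambda>x. inverse (f x)) \<in> regular_on X ?V"
    by (intro reg_inverse o reg_restrict[OF U(1) o _ U(3)]) auto
  then show ?thesis unfolding rational_funs_def using o ne by blast
qed

lemma subgroup_principal: "subgroup principal_Div0 (Div0 X)"
proof -
  interpret comm_group "Div0 X" by (rule comm_group_Div0)
  show ?thesis
  proof (rule subgroupI)
    have one: "(\<lambda>_. 1) \<in> rational_funs X"
      unfolding rational_funs_def using points_nonempty reg_const[OF openin_topspace] openin_topspace by blast
    have ord1: "has_order P (\<lambda>_. 1) 0" if "P \<in> points X" for P
      by (rule has_order_unit[OF at_const[OF that]]) simp
    obtain P where "P \<in> points X" using points_nonempty by blast
    from has_order_not_zero[OF ord1[OF this]] have "0 \<in> principal_divisors X"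
      by (intro principal_divisorsI[OF one]) (auto simp: ord1)
    then show "principal_Div0 \<noteq> {}" using one_closed by (auto simp: Div0_simps)
  next
    fix D assume D: "D \<in> principal_Div0"
    then obtain f where f: "f \<in> rational_funs X" "\<not> gen_eq X f (\<lambda>_. 0)" "\<And>P. P \<in> points X \<Longrightarrow> has_order P f (D P)"
      "\<And>P. P \<notin> points X \<Longrightarrow> D P = 0" by (auto elim: principal_divisorsE)
    obtain P where P: "P \<in> points X" using points_nonempty by blast
    have "- D \<in> principal_divisors X"
      using has_order_not_zero[OF has_order_inverse[OF f(3)[OF P]]] f
      by (intro principal_divisorsI[OF rational_inverse[OF f(1,2)]]) (auto intro: has_order_inverse)
    then show "inv\<^bsub>Div0 X\<^esub> D \<in> principal_Div0" using D Div0_minus by (auto simp: Div0_inv)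
  next
    fix D E assume D: "D \<in> principal_Div0" and E: "E \<in> principal_Div0"
    obtain f where f: "f \<in> rational_funs X" "\<not> gen_eq X f (\<lambda>_. 0)" "\<And>P. P \<in> points X \<Longrightarrow> has_order P f (D P)"
      "\<And>P. P \<notin> points X \<Longrightarrow> D P = 0" using D by (auto elim: principal_divisorsE)
    obtain g where g: "g \<in> rational_funs X" "\<not> gen_eq X g (\<lambda>_. 0)" "\<And>P. P \<in> points X \<Longrightarrow> has_order P g (E P)"
      "\<And>P. P \<notin> points X \<Longrightarrow> E P = 0" using E by (auto elim: principal_divisorsE)
    obtain P where P: "P \<in> points X" using points_nonempty by blast
    have "D + E \<in> principal_divisors X"
      using has_order_not_zero[OF has_order_mult[OF f(3)[OF P] g(3)[OF P]]] f g
      by (intro principal_divisorsI[OF rational_mult[OF f(1) g(1)]]) (auto intro: has_order_mult)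
    then show "D \<otimes>\<^bsub>Div0 X\<^esub> E \<in> principal_Div0" using D E m_closed[of D E] by (auto simp: Div0_simps)
  qed auto
qed

text \<open>
  The hypothesis says that the divisor \<open>m [Q] + [\<xi>\<^sub>1] + \<dots> + [\<xi>\<^sub>r] - (m + r) [b]\<close> is principal for
  some points \<open>\<xi>\<^sub>i\<close>. These points may coincide with \<open>Q\<close> or \<open>b\<close>, which is why only inequalities
  result.
\<close>

lemma function_of_inverse_classes:
  assumes b: "b \<in> points X" and Q: "Q \<in> points X" "Q \<noteq> b"
    and mem: "jac_emb X b Q [^]\<^bsub>Jac X\<^esub> int m \<in> W_minus X b r"
  obtains f where "f \<in> rational_funs X" "\<not> gen_eq X f (\<lambda>_. 0)"
    "\<And>P. P \<in> points X - {b} \<Longrightarrow> ord_at X P f \<ge> 0" "ord_at X b f \<ge> - int (m + r)" "ord_at X Q f \<ge> int m"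
proof -
  interpret D: comm_group "Div0 X" by (rule comm_group_Div0)
  note H = subgroup_principal
  define \<pi> where "\<pi> D = principal_Div0 #>\<^bsub>Div0 X\<^esub> D" for D
  have J: "Jac X = Div0 X Mod principal_Div0" by (simp add: Jac_def)
  have cg: "comm_group (Jac X)" unfolding J by (rule D.abelian_FactGroup[OF H])
  interpret J: comm_group "Jac X" by (rule cg)
  have hom: "\<pi> \<in> hom (Div0 X) (Jac X)"
    unfolding J \<pi>_def using H by (intro normal.r_coset_hom_Mod) (simp add: D.normal_iff_subgroup)
  \<comment> \<open>The value \<open>0\<close> outside the curve makes \<open>d\<close> a total map into the group of divisors.\<close>
  define d where "d P = (if P \<in> points X then point_divisor P - point_divisor b else 0)" for P
  have d: "d P \<in> carrier (Div0 X)" for P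
    using point_divisor_diff_Div0[OF _ b] D.one_closed by (simp add: d_def Div0_simps)
  have emb: "jac_emb X b P = \<pi> (d P)" if "P \<in> points X" for P
    using that by (simp add: jac_emb_def \<pi>_def d_def)
  from mem obtain \<xi> where \<xi>: "\<forall>i\<in>{1..r}. \<xi> i \<in> points X"
    and eq: "jac_emb X b Q [^]\<^bsub>Jac X\<^esub> int m = inv\<^bsub>Jac X\<^esub> finprod (Jac X) (\<lambda>i. jac_emb X b (\<xi> i)) {1..r}"
    unfolding W_minus_def W_locus_def by blast
  define S where "S = finprod (Div0 X) (\<lambda>i. d (\<xi> i)) {1..r}"
  have S: "S \<in> carrier (Div0 X)" unfolding S_def by (rule D.finprod_closed) (auto intro: d)
  have \<pi>c: "\<pi> D \<in> carrier (Jac X)" if "D \<in> carrier (Div0 X)" for D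
    using hom that by (auto simp: hom_def)
  have "finprod (Jac X) (\<lambda>i. jac_emb X b (\<xi> i)) {1..r} = finprod (Jac X) (\<lambda>i. \<pi> (d (\<xi> i))) {1..r}"
  proof (rule J.finprod_cong'[OF refl])
    show "(\<lambda>i. \<pi> (d (\<xi> i))) \<in> {1..r} \<rightarrow> carrier (Jac X)" by (intro Pi_I \<pi>c d)
    show "jac_emb X b (\<xi> i) = \<pi> (d (\<xi> i))" if "i \<in> {1..r}" for i
      by (rule emb) (use \<xi> that in blast)
  qed
  also have "\<dots> = \<pi> S" unfolding S_def by (rule hom_finprod_interval[OF D.comm_group_axioms cg hom d])
  finally have fin: "finprod (Jac X) (\<lambda>i. jac_emb X b (\<xi> i)) {1..r} = \<pi> S" .
  define M where "M = d Q [^]\<^bsub>Div0 X\<^esub> m"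
  have M: "M \<in> carrier (Div0 X)" unfolding M_def by (rule D.nat_pow_closed[OF d])
  have pow: "jac_emb X b Q [^]\<^bsub>Jac X\<^esub> int m = \<pi> M"
    unfolding emb[OF Q(1)] int_pow_int M_def
    by (rule hom_nat_pow[OF hom d D.is_group J.is_group, symmetric])
  have "\<pi> (M \<otimes>\<^bsub>Div0 X\<^esub> S) = \<pi> M \<otimes>\<^bsub>Jac X\<^esub> \<pi> S" by (rule hom_mult[OF hom M S])
  also have "\<dots> = inv\<^bsub>Jac X\<^esub> \<pi> S \<otimes>\<^bsub>Jac X\<^esub> \<pi> S" using eq unfolding pow fin by simp
  also have "\<dots> = \<one>\<^bsub>Jac X\<^esub>" by (rule J.l_inv[OF \<pi>c[OF S]])
  also have "\<dots> = principal_Div0" by (simp add: J)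
  finally have "principal_Div0 #>\<^bsub>Div0 X\<^esub> (M \<otimes>\<^bsub>Div0 X\<^esub> S) = principal_Div0" by (simp add: \<pi>_def)
  from D.coset_join1[OF this D.m_closed[OF M S] H] have "M + S \<in> principal_divisors X"
    by (simp add: Div0_simps)
  then obtain f where f: "f \<in> rational_funs X" "\<not> gen_eq X f (\<lambda>_. 0)"
    "\<And>P. P \<in> points X \<Longrightarrow> has_order P f ((M + S) P)" by (rule principal_divisorsE) (rule that)
  have MS: "(M + S) P = int m * (point_divisor Q P - point_divisor b P) +
      (\<Sum>i=1..r. point_divisor (\<xi> i) P - point_divisor b P)" for P
  proof -
    have "S P = (\<Sum>i=1..r. d (\<xi> i) P)" unfolding S_def by (rule Div0_finprod[OF d])
    also have "\<dots> = (\<Sum>i=1..r. point_divisor (\<xi> i) P - point_divisor b P)"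
      using \<xi> by (intro sum.cong) (auto simp: d_def)
    finally show ?thesis using Q(1) by (simp add: M_def Div0_pow) (simp add: d_def)
  qed
  have ord: "ord_at X P f = (M + S) P" if "P \<in> points X" for P by (rule ord_at_eq[OF f(3)[OF that]])
  have other: "(M + S) P = int m * point_divisor Q P + (\<Sum>i=1..r. point_divisor (\<xi> i) P)" if "P \<noteq> b" for P
    unfolding MS using that by (simp add: point_divisor_def)
  have nonneg: "(\<Sum>i=1..r. point_divisor (\<xi> i) P) \<ge> 0" for P
    by (rule sum_nonneg) (simp add: point_divisor_def)
  show ?thesis
  proof (rule that[OF f(1,2)])
    fix P assume P: "P \<in> points X - {b}"
    then show "ord_at X P f \<ge> 0"
      using ord[of P] other[of P] nonneg[of P] by (auto simp: point_divisor_def)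
  next
    have "(\<Sum>i=1..r. - 1 :: int) \<le> (\<Sum>i=1..r. point_divisor (\<xi> i) b - point_divisor b b)"
      by (rule sum_mono) (simp add: point_divisor_def)
    then show "ord_at X b f \<ge> - int (m + r)"
      unfolding ord[OF b] MS using Q(2) by (simp add: point_divisor_def)
  next
    show "ord_at X Q f \<ge> int m"
      using other[OF Q(2)] nonneg[of Q] by (simp add: ord[OF Q(1)] point_divisor_def)
  qed
qed

end

context pointed_curve
begin

text \<open>
  At each point outside \<open>b\<close> the function agrees generically with one that is regular there. Two of
  these local representatives agree wherever both are regular, so their values at their own base
  points define a function which is regular outside \<open>b\<close>.
\<close>

lemma pole_space_representative:
  assumes f: "f \<in> rational_funs X" "\<not> gen_eq X f (\<lambda>_. 0)"
    and ord: "\<And>P. P \<in> X' \<Longrightarrow> ord_at X P f \<ge> 0" "ord_at X b f \<ge> - int N"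
  obtains g where "g \<in> pole_space X b N" "eventually (\<lambda>x. g x = f x) generic"
proof -
  have "\<exists>g. P \<in> X' \<longrightarrow> g \<in> \<O> P \<and> eventually (\<lambda>x. g x = f x) generic" for P
  proof (cases "P \<in> X'")
    case True
    then have P: "P \<in> points X" by simp
    obtain t v where t: "uniformizer X P t" using uniformizer_exists[OF P] by blast
    obtain u where u: "u \<in> \<O> P" "u P \<noteq> 0" "eventually (\<lambda>x. f x = u x * t x powi ord_at X P f) generic"
      using has_orderE[OF has_order_exists[OF P f] t] .
    have "(\<lambda>x. u x * t x ^ nat (ord_at X P f)) \<in> \<O> P"
      by (intro at_mult at_power u uniformizerD(1)[OF t])
    moreover have "eventually (\<lambda>x. u x * t x ^ nat (ord_at X P f) = f x) generic"
      using u(3) by eventually_elim (use ord(1)[OF True] in \<open>simp add: power_int_def\<close>)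
    ultimately show ?thesis by blast
  qed blast
  then have "\<forall>P. \<exists>g. P \<in> X' \<longrightarrow> g \<in> \<O> P \<and> eventually (\<lambda>x. g x = f x) generic" by blast
  from choice[OF this] obtain G where G: "\<And>P. P \<in> X' \<Longrightarrow> G P \<in> \<O> P"
    "\<And>P. P \<in> X' \<Longrightarrow> eventually (\<lambda>x. G P x = f x) generic" by blast
  define g where "g x = (if x \<in> X' then G x x else 0)" for x
  have near: "eventually (\<lambda>x. g x = G P x) (near P)" if P: "P \<in> X'" for P
  proof -
    have "eventually (\<lambda>x. x \<in> X') (near P)" by (rule eventually_nearI[OF open_minus_point P])
    then show ?thesis using regular_at_near_regular[OF G(1)[OF P]]
    proof eventually_elim
      case (elim x)
      have "gen_eq X (G x) (G P)"
        unfolding gen_eq_iff using G(2)[OF P] G(2)[OF elim(1)] by eventually_elim simp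
      from gen_eq_imp_at[OF G(1)[OF elim(1)] elim(2) this] elim(1) show ?case by (simp add: g_def)
    qed
  qed
  have reg: "g \<in> regular_on X X'"
    by (rule reg_of_at[OF open_minus_point]) (rule regular_at_near_cong[OF G(1) near])
  obtain P where P: "P \<in> X'" using minus_point_nonempty[OF base_point] by blast
  have gf: "eventually (\<lambda>x. g x = f x) generic"
    using G(2)[OF P] near_imp_generic[OF _ near[OF P]] P by (auto elim: eventually_elim2)
  have "has_order b g (ord_at X b f)"
    by (rule has_order_cong[OF gf has_order_exists[OF base_point f]])
  then have "g \<in> pole_space X b N"
    unfolding pole_space_iff using reg ord(2) by (auto simp: g_def)
  then show ?thesis using gf by (rule that)
qed

text \<open>
  At the point \<open>Q\<close> given by the result on osculation, no nonzero function with a pole of order at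
  most \<open>m + r\<close> vanishes to order \<open>m\<close>, but membership in \<open>W\<^sub>r\<^sup>-\<close> would provide one.
\<close>

theorem mult_image_not_subset:
  assumes char: "\<And>n. 0 < n \<Longrightarrow> n \<le> m + r \<Longrightarrow> of_nat n \<noteq> (0::'k)"
    and m: "pole_dim X b (m + r) \<le> m"
  shows "\<not> mult_image X b (int m) \<subseteq> W_minus X b r"
proof
  assume sub: "mult_image X b (int m) \<subseteq> W_minus X b r"
  obtain Q where Q: "Q \<in> points X" "Q \<noteq> b"
    and van: "\<And>f. f \<in> pole_space X b (m + r) \<Longrightarrow> vanishes Q (pole_dim X b (m + r)) f \<Longrightarrow> f = (\<lambda>_. 0)"
    using generic_osculation[OF char] by metis
  have "jac_emb X b Q [^]\<^bsub>Jac X\<^esub> int m \<in> W_minus X b r"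
    using sub Q(1) unfolding mult_image_def by blast
  then obtain f where f: "f \<in> rational_funs X" "\<not> gen_eq X f (\<lambda>_. 0)"
    "\<And>P. P \<in> X' \<Longrightarrow> ord_at X P f \<ge> 0" "ord_at X b f \<ge> - int (m + r)" "ord_at X Q f \<ge> int m"
    using function_of_inverse_classes[OF base_point Q] by metis
  obtain g where g: "g \<in> pole_space X b (m + r)" "eventually (\<lambda>x. g x = f x) generic"
    using pole_space_representative[OF f(1-4)] .
  have gQ: "has_order Q g (ord_at X Q f)" by (rule has_order_cong[OF g(2) has_order_exists[OF Q(1) f(1,2)]])
  have "vanishes Q (pole_dim X b (m + r)) g"
    by (rule vanishes_of_order[OF gQ]) (use m f(5) in linarith)
  then have "g = (\<lambda>_. 0)" by (rule van[OF g(1)])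
  then show False using has_order_not_zero[OF gQ] by (simp add: gen_eq_iff)
qed

end

lemma smooth_proper_curve_pointed:
  assumes "smooth_proper_curve X" "b \<in> points X"
  shows "pointed_curve X b"
proof -
  have *: "proper_variety X" "irreducible_subset (top_of X) (points X)"
    "\<And>P. P \<in> points X \<Longrightarrow> fdim (tangent_space X P) = 1"
    using assms(1) by (auto simp: smooth_proper_curve_def)
  have "prevariety X" using *(1) by (simp add: proper_variety_def variety_def)
  then show ?thesis using * assms(2) by unfold_locales auto
qed

theorem corollary6p2:
  fixes X :: "('a, 'k::alg_closed_field) fun_space" and b :: 'a and N r :: nat
  assumes "smooth_proper_curve X"
    and "genus X \<ge> 2"
    and "b \<in> points X"
    and "N \<ge> 2"
    and "int r \<in> {0 .. int N - int (pole_dim X b N)}"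
  shows "(CHAR('k) = 0 \<longrightarrow> \<not> mult_image X b (int N - int r) \<subseteq> W_minus X b r) \<and>
         (CHAR('k) > N \<longrightarrow>
            \<not> mult_image X b (int (pole_dim X b N)) \<subseteq> W_minus X b (N - pole_dim X b N))"
proof (intro conjI impI)
  interpret pointed_curve X b by (rule smooth_proper_curve_pointed[OF assms(1,3)])
  have r: "r + pole_dim X b N \<le> N" using assms(5) by auto
  {
    assume p: "CHAR('k) = 0"
    have "\<not> mult_image X b (int (N - r)) \<subseteq> W_minus X b r"
    proof (rule mult_image_not_subset)
      fix n :: nat assume "0 < n"
      then show "of_nat n \<noteq> (0::'k)" by (simp add: of_nat_eq_0_iff_char_dvd p)
    qed (use r in simp)
    then show "\<not> mult_image X b (int N - int r) \<subseteq> W_minus X b r" using r by (simp add: of_nat_diff)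
  next
    assume p: "CHAR('k) > N"
    show "\<not> mult_image X b (int (pole_dim X b N)) \<subseteq> W_minus X b (N - pole_dim X b N)"
    proof (rule mult_image_not_subset)
      fix n :: nat assume "0 < n" "n \<le> pole_dim X b N + (N - pole_dim X b N)"
      then have "n < CHAR('k)" using p r by simp
      then show "of_nat n \<noteq> (0::'k)"
        using \<open>0 < n\<close> by (auto simp: of_nat_eq_0_iff_char_dvd dest: dvd_imp_le)
    qed (use r in simp)
  }
qed

end
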